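(* Let $\Gamma=\mathbb Z/2\wr\mathbb Z=\langle a,t\mid a^2,\ [a,t^nat^{-n}],\ n\in\mathbb N\rangle$ be the lamplighter group. Then: (1) $\mathrm{SRad}_\Gamma(r)\preceq r^{21}$; that is, for every finite generating set $S'$ of $\Gamma$ there is a constant $C'\ge 1$ such that $\mathrm{SRad}^{S'}_\Gamma(x)\le C'(C'x)^{21}$ for all real $x\ge 1$. (2) There exist universal constants $C,c>0$ such that, with $S=\{a,t\}$ the standard generating set, for every $\kappa>0$, setting $r_\kappa=\lceil C\kappa^{-21}\rceil$, one has $$\mathrm{SRate}^{S,r_\kappa}_\Gamma(\kappa)\ \ge\ c\,\kappa^{70}.$$
   Context: $\mathbb N=\{1,2,\dots\}$. $U(d)$ is the group of $d\times d$ unitary matrices, $\|A\|_{\mathrm{HS}}=\sqrt{\frac1d\operatorname{Tr}(A^*A)}$ is the normalized Hilbert--Schmidt norm. Let $\Gamma$ be a group with finite generating set $S$; for $r\in\mathbb N$ let $B_S(r)$ be the ball of radius $r$ around the identity in the word metric of $\Gamma$ with respect to $S$. Local defect: for $\varphi:B_S(r)\to U(d)$, $L_{S,r}(\varphi)=\max\{\|\varphi(gh)-\varphi(g)\varphi(h)\|_{\mathrm{HS}} : g,h,gh\in B_S(r)\}$. Global defect: $G_S(\varphi)=\inf_\pi\max_{g\in S}\|\varphi(g)-\pi(g)\|_{\mathrm{HS}}$, the infimum being over all unitary representations $\pi:\Gamma\to U(d)$. Stability rate: for $\kappa>0$, $\mathrm{SRate}^{S,r}_\Gamma(\kappa)$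 is the supremum (in $[0,\infty]$) of all $\delta>0$ such that for every $d\in\mathbb N$ and every $\varphi:B_S(r)\to U(d)$ with $L_{S,r}(\varphi)<\delta$ one has $G_S(\varphi)<\kappa$; it is $0$ if no such $\delta>0$ exists. Stability radius growth: for real $x>0$, $\mathrm{SRad}^S_\Gamma(x)=\min\{r\in\mathbb N:\mathrm{SRate}^{S,r}_\Gamma(1/x)>0\}$, and $\mathrm{SRad}^S_\Gamma(x)=\infty$ if no such $r$ exists. *)

theory Defs
  imports
    "HOL-Algebra.Elementary_Groups"
    "HOL-Algebra.Product_Groups"
    "HOL-Library.Extended_Nat"
    "HOL-Library.Extended_Real"
    "HOL-Library.Extended_Nonnegative_Real"
    "Jordan_Normal_Form.Schur_Decomposition"
begin

section \<open>Unitary matrices and the normalized Hilbert--Schmidt norm\<close>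

definition mat_trace :: "'a :: comm_monoid_add mat \<Rightarrow> 'a" where
  "mat_trace A = (\<Sum>i<dim_row A. A $$ (i, i))"

text \<open>The trace below is a nonnegative real number, so taking real parts loses nothing.\<close>

definition hs_norm :: "complex mat \<Rightarrow> real" where
  "hs_norm A = sqrt (1 / real (dim_row A) * Re (mat_trace (mat_adjoint A * A)))"

definition unitary_group :: "nat \<Rightarrow> complex mat monoid" where
  "unitary_group d =
     \<lparr>carrier = {A \<in> carrier_mat d d. mat_adjoint A * A = 1\<^sub>m d \<and> A * mat_adjoint A = 1\<^sub>m d},
      monoid.mult = (*), one = 1\<^sub>m d\<rparr>"

section \<open>Stability rate and stability radius growth\<close>

definition finite_generating_set :: "('g, 'm) monoid_scheme \<Rightarrow> 'g set \<Rightarrow> bool" where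
  "finite_generating_set \<Gamma> S \<longleftrightarrow> finite S \<and> S \<subseteq> carrier \<Gamma> \<and> generate \<Gamma> S = carrier \<Gamma>"

text \<open>Elements of word length at most \<open>r\<close>, i.e. products of at most \<open>r\<close> letters from
  \<open>S \<union> S\<inverse>\<close>.\<close>

definition word_ball :: "('g, 'm) monoid_scheme \<Rightarrow> 'g set \<Rightarrow> nat \<Rightarrow> 'g set" where
  "word_ball \<Gamma> S r =
     {foldr (\<lambda>s g. s \<otimes>\<^bsub>\<Gamma>\<^esub> g) ws \<one>\<^bsub>\<Gamma>\<^esub> | ws.
        set ws \<subseteq> S \<union> m_inv \<Gamma> ` S \<and> length ws \<le> r}"

text \<open>A map \<open>B\<^sub>S(r) \<rightarrow> U(d)\<close> is represented by a total function whose values outside the ball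
  are irrelevant: for \<open>r \<ge> 1\<close> neither defect depends on them. Both maxima are over finite sets,
  which are nonempty when \<open>S\<close> is.\<close>

definition local_defect ::
  "('g, 'm) monoid_scheme \<Rightarrow> 'g set \<Rightarrow> nat \<Rightarrow> ('g \<Rightarrow> complex mat) \<Rightarrow> real" where
  "local_defect \<Gamma> S r \<phi> =
     Max {hs_norm (\<phi> (g \<otimes>\<^bsub>\<Gamma>\<^esub> h) - \<phi> g * \<phi> h) | g h.
            g \<in> word_ball \<Gamma> S r \<and> h \<in> word_ball \<Gamma> S r \<and> g \<otimes>\<^bsub>\<Gamma>\<^esub> h \<in> word_ball \<Gamma> S r}"

definition global_defect ::
  "('g, 'm) monoid_scheme \<Rightarrow> 'g set \<Rightarrow> nat \<Rightarrow> ('g \<Rightarrow> complex mat) \<Rightarrow> real" where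
  "global_defect \<Gamma> S d \<phi> =
     (INF \<pi> \<in> hom \<Gamma> (unitary_group d). MAX g \<in> S. hs_norm (\<phi> g - \<pi> g))"

definition SRate :: "('g, 'm) monoid_scheme \<Rightarrow> 'g set \<Rightarrow> nat \<Rightarrow> real \<Rightarrow> ennreal" where
  "SRate \<Gamma> S r \<kappa> =
     Sup {ennreal \<delta> | \<delta>. \<delta> > 0 \<and>
       (\<forall>d\<ge>1. \<forall>\<phi> \<in> word_ball \<Gamma> S r \<rightarrow> carrier (unitary_group d).
          local_defect \<Gamma> S r \<phi> < \<delta> \<longrightarrow> global_defect \<Gamma> S d \<phi> < \<kappa>)}"

text \<open>The infimum in \<^typ>\<open>enat\<close> is a minimum if the set is nonempty, and \<open>\<infinity>\<close> otherwise.\<close>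

definition SRad :: "('g, 'm) monoid_scheme \<Rightarrow> 'g set \<Rightarrow> real \<Rightarrow> enat" where
  "SRad \<Gamma> S x = Inf {enat r | r. r \<ge> 1 \<and> SRate \<Gamma> S r (1 / x) > 0}"

section \<open>The lamplighter group\<close>

text \<open>The restricted wreath product: \<open>H\<close> acts on the direct sum of copies of \<open>G\<close> indexed by \<open>H\<close>
  by left translation of the index.\<close>

definition wreath_product ::
  "('a, 'm) monoid_scheme \<Rightarrow> ('b, 'n) monoid_scheme \<Rightarrow> (('b \<Rightarrow> 'a) \<times> 'b) monoid" where
  "wreath_product G H =
     \<lparr>carrier = carrier (sum_group (carrier H) (\<lambda>_. G)) \<times> carrier H,
      monoid.mult = (\<lambda>(f, x) (g, y).
        (f \<otimes>\<^bsub>sum_group (carrier H) (\<lambda>_. G)\<^esub> (\<lambda>i\<in>carrier H. g (inv\<^bsub>H\<^esub> x \<otimes>\<^bsub>H\<^esub> i)),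
         x \<otimes>\<^bsub>H\<^esub> y)),
      one = (\<one>\<^bsub>sum_group (carrier H) (\<lambda>_. G)\<^esub>, \<one>\<^bsub>H\<^esub>)\<rparr>"

definition lamplighter :: "((int \<Rightarrow> int) \<times> int) monoid" where
  "lamplighter = wreath_product (integer_mod_group 2) integer_group"

definition lamp_a :: "(int \<Rightarrow> int) \<times> int" where
  "lamp_a = ((\<lambda>i. if i = 0 then 1 else 0), 0)"

definition lamp_t :: "(int \<Rightarrow> int) \<times> int" where
  "lamp_t = ((\<lambda>_. 0), 1)"

lemma carrier_lamplighter:
  "carrier lamplighter = {f. (\<forall>i. f i \<in> {0, 1}) \<and> finite {i. f i \<noteq> 0}} \<times> UNIV"
proof -
  have "{0..<2::int} = {0, 1}" by auto
  then show ?thesis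
    by (auto simp: lamplighter_def wreath_product_def carrier_sum_group
        carrier_integer_mod_group PiE_iff extensional_def)
qed

lemma mult_lamplighter:
  "(f, m) \<otimes>\<^bsub>lamplighter\<^esub> (g, n) = ((\<lambda>i. (f i + g (i - m)) mod 2), m + n)"
  by (simp add: lamplighter_def wreath_product_def restrict_def)

lemma one_lamplighter: "\<one>\<^bsub>lamplighter\<^esub> = ((\<lambda>_. 0), 0)"
  by (simp add: lamplighter_def wreath_product_def restrict_def)

lemma finite_support_shift:
  fixes f :: "int \<Rightarrow> int"
  assumes "finite {i. f i \<noteq> 0}"
  shows "finite {i. f (i + k) \<noteq> 0}"
proof -
  have "{i. f (i + k) \<noteq> 0} = (\<lambda>i. i - k) ` {i. f i \<noteq> 0}"
    by (auto simp: image_iff) (metis add_diff_cancel_right')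
  then show ?thesis using assms by simp
qed

lemma group_lamplighter: "group lamplighter"
proof (rule groupI)
  fix x y
  assume "x \<in> carrier lamplighter" "y \<in> carrier lamplighter"
  then obtain f m g n where x: "x = (f, m)" and y: "y = (g, n)"
    and f: "\<And>i. f i \<in> {0, 1}" "finite {i. f i \<noteq> 0}"
    and g: "\<And>i. g i \<in> {0, 1}" "finite {i. g i \<noteq> 0}"
    by (cases x, cases y) (auto simp: carrier_lamplighter)
  have "finite {i. g (i + - m) \<noteq> 0}"
    by (rule finite_support_shift[OF g(2)])
  then have "finite ({i. f i \<noteq> 0} \<union> {i. g (i - m) \<noteq> 0})"
    using f(2) by simp
  then have "finite {i. (f i + g (i - m)) mod 2 \<noteq> 0}"
    by (rule rev_finite_subset) auto
  moreover have "(f i + g (i - m)) mod 2 \<in> {0, 1}" for i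
    by auto
  ultimately show "x \<otimes>\<^bsub>lamplighter\<^esub> y \<in> carrier lamplighter"
    by (simp add: x y mult_lamplighter carrier_lamplighter)
next
  show "\<one>\<^bsub>lamplighter\<^esub> \<in> carrier lamplighter"
    by (simp add: one_lamplighter carrier_lamplighter)
next
  fix x y z
  show "x \<otimes>\<^bsub>lamplighter\<^esub> y \<otimes>\<^bsub>lamplighter\<^esub> z = x \<otimes>\<^bsub>lamplighter\<^esub> (y \<otimes>\<^bsub>lamplighter\<^esub> z)"
    by (cases x, cases y, cases z)
      (simp add: mult_lamplighter mod_add_left_eq mod_add_right_eq algebra_simps)
next
  fix x
  assume "x \<in> carrier lamplighter"
  then obtain f m where x: "x = (f, m)"
    and f: "\<And>i. f i \<in> {0, 1}" "finite {i. f i \<noteq> 0}"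
    by (cases x) (auto simp: carrier_lamplighter)
  have f2: "f i mod 2 = f i" "(f i + f i) mod 2 = 0" for i
    using f(1)[of i] by auto
  show "\<one>\<^bsub>lamplighter\<^esub> \<otimes>\<^bsub>lamplighter\<^esub> x = x"
    by (simp add: x one_lamplighter mult_lamplighter f2)
  have "((\<lambda>i. f (i + m)), - m) \<in> carrier lamplighter"
    using f finite_support_shift[OF f(2), of m] by (simp add: carrier_lamplighter)
  moreover have "((\<lambda>i. f (i + m)), - m) \<otimes>\<^bsub>lamplighter\<^esub> x = \<one>\<^bsub>lamplighter\<^esub>"
    by (simp add: x one_lamplighter mult_lamplighter f2)
  ultimately show "\<exists>y\<in>carrier lamplighter. y \<otimes>\<^bsub>lamplighter\<^esub> x = \<one>\<^bsub>lamplighter\<^esub>"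
    by blast
qed

lemma lamp_a_in: "lamp_a \<in> carrier lamplighter"
  by (simp add: lamp_a_def carrier_lamplighter)

lemma lamp_t_in: "lamp_t \<in> carrier lamplighter"
  by (simp add: lamp_t_def carrier_lamplighter)

lemma lamp_t_int_pow: "lamp_t [^]\<^bsub>lamplighter\<^esub> (k :: int) = ((\<lambda>_. 0), k)"
proof -
  interpret group lamplighter by (rule group_lamplighter)
  have nat: "lamp_t [^]\<^bsub>lamplighter\<^esub> (n :: nat) = ((\<lambda>_. 0), int n)" for n
    by (induction n) (simp_all add: one_lamplighter mult_lamplighter lamp_t_def)
  show ?thesis
  proof (cases k rule: int_cases2)
    case (nonneg n)
    then show ?thesis by (simp add: int_pow_int nat)
  next
    case (nonpos n)
    have "inv\<^bsub>lamplighter\<^esub> ((\<lambda>_. 0), int n) = ((\<lambda>_. 0), - int n)"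
      by (rule inv_equality)
        (simp_all add: carrier_lamplighter mult_lamplighter one_lamplighter)
    then show ?thesis
      by (simp add: nonpos int_pow_neg_int nat lamp_t_in)
  qed
qed

lemma lamp_conj:
  "lamp_t [^]\<^bsub>lamplighter\<^esub> (k :: int) \<otimes>\<^bsub>lamplighter\<^esub> lamp_a \<otimes>\<^bsub>lamplighter\<^esub>
     lamp_t [^]\<^bsub>lamplighter\<^esub> (- k) = ((\<lambda>i. if i = k then 1 else 0), 0)"
  by (auto simp: lamp_t_int_pow lamp_a_def mult_lamplighter)

text \<open>The defining relations \<open>a\<^sup>2\<close> and \<open>[a, t\<^sup>n a t\<^sup>-\<^sup>n]\<close> hold, and \<open>a\<close>, \<open>t\<close> generate.\<close>

lemma lamp_relations:
  fixes n :: int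
  defines "b \<equiv> lamp_t [^]\<^bsub>lamplighter\<^esub> n \<otimes>\<^bsub>lamplighter\<^esub> lamp_a \<otimes>\<^bsub>lamplighter\<^esub>
     lamp_t [^]\<^bsub>lamplighter\<^esub> (- n)"
  shows "lamp_a \<otimes>\<^bsub>lamplighter\<^esub> lamp_a = \<one>\<^bsub>lamplighter\<^esub>"
    and "lamp_a \<otimes>\<^bsub>lamplighter\<^esub> b = b \<otimes>\<^bsub>lamplighter\<^esub> lamp_a"
  unfolding b_def lamp_conj
  by (auto simp: lamp_a_def mult_lamplighter one_lamplighter)

lemma finite_generating_set_lamplighter:
  "finite_generating_set lamplighter {lamp_a, lamp_t}"
proof -
  interpret group lamplighter by (rule group_lamplighter)
  let ?H = "generate lamplighter {lamp_a, lamp_t}"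
  have sub: "{lamp_a, lamp_t} \<subseteq> carrier lamplighter"
    by (simp add: lamp_a_in lamp_t_in)
  interpret H: subgroup ?H lamplighter
    by (rule generate_is_subgroup[OF sub])
  have t: "((\<lambda>_. 0), k) \<in> ?H" for k
    using subgroup_int_pow_closed[OF H.subgroup_axioms generate.incl, of lamp_t k]
    by (simp add: lamp_t_int_pow)
  have d: "((\<lambda>i. if i = k then 1 else 0), 0) \<in> ?H" for k
    unfolding lamp_conj[symmetric] lamp_t_int_pow
    by (intro H.m_closed t generate.incl) simp
  have base: "((\<lambda>i. if i \<in> A then 1 else 0), 0) \<in> ?H" if "finite A" for A
    using that
  proof (induction A rule: finite_induct)
    case empty
    then show ?case using t by simp
  next
    case (insert k A)
    have "((\<lambda>i. if i \<in> insert k A then 1 else 0), 0) =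
      ((\<lambda>i. if i = k then 1 else 0), 0) \<otimes>\<^bsub>lamplighter\<^esub> ((\<lambda>i. if i \<in> A then 1 else 0), 0)"
      using insert.hyps by (auto simp: mult_lamplighter)
    then show ?case using H.m_closed[OF d insert.IH] by simp
  qed
  have "x \<in> ?H" if "x \<in> carrier lamplighter" for x
  proof -
    obtain f m where x: "x = (f, m)"
      and f: "\<And>i. f i \<in> {0, 1}" "finite {i. f i \<noteq> 0}"
      using \<open>x \<in> carrier lamplighter\<close> by (cases x) (auto simp: carrier_lamplighter)
    have "(if i \<in> {i. f i \<noteq> 0} then 1 else 0) mod 2 = f i" for i
      using f(1)[of i] by auto
    then have "x = ((\<lambda>i. if i \<in> {i. f i \<noteq> 0} then 1 else 0), 0) \<otimes>\<^bsub>lamplighter\<^esub> ((\<lambda>_. 0), m)"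
      by (simp only: x mult_lamplighter add_0_right add_0_left)
    then show ?thesis using H.m_closed[OF base[OF f(2)] t] by simp
  qed
  then show ?thesis
    using sub H.subset by (auto simp: finite_generating_set_def)
qed

end

theory Submission
  imports Defs "HOL-Analysis.L2_Norm" "HOL-Combinatorics.List_Permutation"
begin

text \<open>
  A unitary representation of the lamplighter group is a unitary \<open>T\<close> together with an involution
  \<open>A\<close> whose conjugates \<open>T\<^sup>n A T\<^sup>-\<^sup>n\<close> all commute. Such pairs arise whenever the standard basis
  vectors carry labels, \<open>A\<close> is diagonal and depends on the label only, and \<open>T\<close> permutes the blocks
  of equally labelled vectors: conjugating a function of the label by \<open>T\<close> gives another function
  of the label (\<open>permuted_labels_representation\<close>). The proof produces such a pair near a map
  \<open>\<phi>\<close> that is almost multiplicative on a large ball.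

  \<^item> \<^emph>\<open>Commuting lamps.\<close> The configurations supported in \<open>{-N..N}\<close> form an elementary abelian
    2-group inside the ball. Its Fourier coefficients \<open>K x\<close> are almost projections; choosing
    eigenvectors of \<open>K x (K x)\<^sup>*\<close> with large eigenvalues and then the unitary part of a polar
    decomposition gives a basis of \<open>\<complex>\<^sup>d\<close> in which all these lamps are, up to a small error,
    diagonal sign matrices (\<open>elementary_abelian_rounding\<close>). The error depends neither on \<open>d\<close> nor on \<open>N\<close>.

  \<^item> \<^emph>\<open>A finite cyclic model of the shift.\<close> Every basis vector now has a label, a two-sided sequence
    of which only a window is meaningful, and the numbers \<open>\<bar>T i j\<bar>\<^sup>2\<close> form a doubly stochastic matrix
    concentrated on pairs whose labels differ by a shift. Labels that look periodic on a long window
    are replaced by their periodic extensions. All other labels are cut wherever one of finitely many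
    marker words occurs, and each piece between consecutive cuts is closed up to a cycle. The marker
    words come from minimising one functional: they occur rarely, yet few aperiodic windows
    avoid them (\<open>exists_marker_words\<close>). The result is a finite set of states with a permutation
    \<open>advance\<close> that agrees with the action of \<open>T\<close> off a set of small mass (\<open>periodic_labelling\<close>).

  \<^item> \<^emph>\<open>Exact blocks.\<close> Along a cycle of states the numbers of basis vectors are nearly constant;
    discarding few vectors makes them equal. Then the part of \<open>T\<close> that respects the states is close
    to a unitary with the same block pattern (\<open>block_rounding\<close>), again by polar decomposition.

  With a parameter \<open>n\<close>, cuts have frequency \<open>1/n\<close>, periods are at most \<open>n\<^sup>2\<close>, windows have length of
  order \<open>n\<^sup>3\<close>, a defect of order \<open>n\<^sup>-\<^sup>7\<close> is small enough, and the resulting distance is of order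
  \<open>n\<^sup>-\<^sup>1\<^sup>/\<^sup>2\<close>. For \<open>\<kappa> \<le> 2\<close> and \<open>n\<close> of order \<open>\<kappa>\<^sup>-\<^sup>2\<close> this is radius \<open>\<kappa>\<^sup>-\<^sup>6\<close> and defect \<open>\<kappa>\<^sup>1\<^sup>4\<close>, up to constants,
  which implies the bounds with exponents 21 and 70. For \<open>\<kappa> > 2\<close> there is nothing to do, as two
  unitaries are at distance at most 2. Another generating set changes balls by a bounded factor, and
  closeness on one generating set passes to words of bounded length in it.
\<close>

section \<open>Unitary matrices and the Frobenius norm\<close>

lemma mat_adjoint_index [simp]:
  assumes "i < dim_col A" "j < dim_row A"
  shows "mat_adjoint A $$ (i, j) = cnj ((A :: complex mat) $$ (j, i))"
  using assms by (simp add: mat_adjoint_def mat_of_rows_index)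

lemma mat_adjoint_dim [simp]:
  "dim_row (mat_adjoint A) = dim_col A" "dim_col (mat_adjoint A) = dim_row A"
  by (simp_all add: mat_adjoint_def)

lemma mat_adjoint_carrier [simp]:
  "A \<in> carrier_mat m n \<Longrightarrow> mat_adjoint A \<in> carrier_mat n m"
  by (auto intro: carrier_matI)

lemma mult_square_carrier [simp]:
  "A \<in> carrier_mat d d \<Longrightarrow> B \<in> carrier_mat d d \<Longrightarrow> A * B \<in> carrier_mat d d"
  by (rule mult_carrier_mat)

lemma mat_adjoint_adjoint [simp]: "mat_adjoint (mat_adjoint A) = (A :: complex mat)"
  by (rule eq_matI) simp_all

lemma mat_adjoint_mult:
  fixes A B :: "complex mat"
  assumes "A \<in> carrier_mat l m" "B \<in> carrier_mat m n"
  shows "mat_adjoint (A * B) = mat_adjoint B * mat_adjoint A"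
  using assms by (intro eq_matI) (auto simp: scalar_prod_def mult.commute intro!: sum.cong)

lemma mat_adjoint_one [simp]: "mat_adjoint (1\<^sub>m n) = (1\<^sub>m n :: complex mat)"
  by (rule eq_matI) auto

text \<open>The unnormalised squared Frobenius norm; sums of \<open>fro\<close> behave additively over blocks and
  characters, which is why most estimates are made before normalising.\<close>

definition fro :: "complex mat \<Rightarrow> real" where
  "fro A = (\<Sum>i<dim_row A. \<Sum>j<dim_col A. (cmod (A $$ (i, j)))\<^sup>2)"

definition fnorm :: "complex mat \<Rightarrow> real" where
  "fnorm A = sqrt (fro A)"

lemma fro_nonneg [simp]: "0 \<le> fro A"
  by (simp add: fro_def sum_nonneg)

lemma fnorm_nonneg [simp]: "0 \<le> fnorm A"
  by (simp add: fnorm_def)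

lemma fnorm_power2 [simp]: "(fnorm A)\<^sup>2 = fro A"
  by (simp add: fnorm_def)

lemma fro_trace: "mat_trace (mat_adjoint A * A) = complex_of_real (fro A)"
proof -
  have "mat_trace (mat_adjoint A * A)
      = (\<Sum>j<dim_col A. \<Sum>i<dim_row A. complex_of_real ((cmod (A $$ (i, j)))\<^sup>2))"
    by (auto simp: mat_trace_def scalar_prod_def complex_norm_square[unfolded of_real_power]
        mult.commute lessThan_atLeast0 intro!: sum.cong)
  also have "\<dots> = complex_of_real (fro A)"
    by (subst sum.swap) (simp add: fro_def)
  finally show ?thesis .
qed

lemma hs_norm_fnorm: "hs_norm A = fnorm A / sqrt (dim_row A)"
  by (simp add: hs_norm_def fro_trace fnorm_def real_sqrt_divide)

lemma fnorm_L2: "fnorm A = L2_set (\<lambda>p. cmod (A $$ p)) ({..<dim_row A} \<times> {..<dim_col A})"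
  by (simp add: fnorm_def fro_def L2_set_def sum.cartesian_product case_prod_unfold)

lemma fnorm_triangle:
  assumes "A \<in> carrier_mat m n" "B \<in> carrier_mat m n"
  shows "fnorm (A + B) \<le> fnorm A + fnorm B"
proof -
  let ?I = "{..<m} \<times> {..<n}"
  have "fnorm (A + B) = L2_set (\<lambda>p. cmod (A $$ p + B $$ p)) ?I"
    using assms by (auto simp: fnorm_L2 intro!: L2_set_cong)
  also have "\<dots> \<le> L2_set (\<lambda>p. cmod (A $$ p) + cmod (B $$ p)) ?I"
    by (intro L2_set_mono) (auto intro: norm_triangle_ineq)
  also have "\<dots> \<le> fnorm A + fnorm B"
    using assms by (auto simp: fnorm_L2 intro!: L2_set_triangle_ineq)
  finally show ?thesis .
qed

lemma fnorm_smult: "fnorm (c \<cdot>\<^sub>m A) = cmod c * fnorm A"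
  by (simp add: fnorm_def fro_def norm_mult power_mult_distrib real_sqrt_mult
      flip: sum_distrib_left)

lemma fnorm_minus_commute:
  assumes "A \<in> carrier_mat m n" "B \<in> carrier_mat m n"
  shows "fnorm (A - B) = fnorm (B - A)"
  using assms by (simp add: fnorm_def fro_def norm_minus_commute)

lemma fnorm_diff_triangle:
  assumes "A \<in> carrier_mat m n" "B \<in> carrier_mat m n" "C \<in> carrier_mat m n"
  shows "fnorm (A - C) \<le> fnorm (A - B) + fnorm (B - C)"
proof -
  have "A - C = (A - B) + (B - C)"
    using assms by (intro eq_matI) auto
  then show ?thesis using assms by (metis fnorm_triangle minus_carrier_mat)
qed

lemma fro_adjoint [simp]: "fro (mat_adjoint A) = fro A"
  unfolding fro_def by (subst sum.swap) (auto intro!: sum.cong)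

abbreviation unitaries :: "nat \<Rightarrow> complex mat set" where
  "unitaries d \<equiv> carrier (unitary_group d)"

lemma unitaries_iff:
  "U \<in> unitaries d \<longleftrightarrow> U \<in> carrier_mat d d \<and> mat_adjoint U * U = 1\<^sub>m d \<and> U * mat_adjoint U = 1\<^sub>m d"
  by (auto simp: unitary_group_def)

lemma unitaries_carrier [dest]: "U \<in> unitaries d \<Longrightarrow> U \<in> carrier_mat d d"
  by (simp add: unitaries_iff)

lemma unitariesI:
  fixes U :: "complex mat"
  assumes "U \<in> carrier_mat d d" "mat_adjoint U * U = 1\<^sub>m d"
  shows "U \<in> unitaries d"
  using assms mat_mult_left_right_inverse[of "mat_adjoint U" d U] by (auto simp: unitaries_iff)

lemma unitaries_adjoint: "U \<in> unitaries d \<Longrightarrow> mat_adjoint U \<in> unitaries d"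
  by (auto simp: unitaries_iff)

lemma unitaries_one [simp]: "1\<^sub>m d \<in> unitaries d"
  by (auto simp: unitaries_iff)

lemma adjoint_cancel_left:
  assumes "U \<in> unitaries d" "A \<in> carrier_mat d n"
  shows "mat_adjoint U * (U * A) = A" "U * (mat_adjoint U * A) = A"
  using assms by (auto simp: unitaries_iff simp flip: assoc_mult_mat[of _ d d _ d A n])

lemma adjoint_cancel_right:
  assumes "U \<in> unitaries d" "A \<in> carrier_mat n d"
  shows "A * U * mat_adjoint U = A" "A * mat_adjoint U * U = A"
  using assms by (auto simp: unitaries_iff assoc_mult_mat[of A n d _ d _ d])

lemma unitaries_mult:
  assumes "U \<in> unitaries d" "V \<in> unitaries d"
  shows "U * V \<in> unitaries d"
proof (rule unitariesI)
  have c: "U \<in> carrier_mat d d" "V \<in> carrier_mat d d" using assms by auto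
  then show "U * V \<in> carrier_mat d d" by auto
  have "mat_adjoint (U * V) * (U * V) = mat_adjoint V * (mat_adjoint U * (U * V))"
    using c by (simp add: mat_adjoint_mult[of _ d d _ d] assoc_mult_mat[of _ d d _ d _ d])
  also have "\<dots> = 1\<^sub>m d"
    using assms c by (simp add: adjoint_cancel_left unitaries_iff)
  finally show "mat_adjoint (U * V) * (U * V) = 1\<^sub>m d" .
qed

lemma unitary_group_simps [simp]:
  "x \<otimes>\<^bsub>unitary_group d\<^esub> y = x * y" "\<one>\<^bsub>unitary_group d\<^esub> = 1\<^sub>m d"
  by (simp_all add: unitary_group_def)

lemma group_unitary_group: "group (unitary_group d)"
proof (rule groupI)
  show "\<exists>V\<in>unitaries d. V \<otimes>\<^bsub>unitary_group d\<^esub> U = \<one>\<^bsub>unitary_group d\<^esub>" if "U \<in> unitaries d" for U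
    using that unitaries_adjoint[OF that] by (auto simp: unitaries_iff)
next
  show "x \<otimes>\<^bsub>unitary_group d\<^esub> y \<otimes>\<^bsub>unitary_group d\<^esub> z
      = x \<otimes>\<^bsub>unitary_group d\<^esub> (y \<otimes>\<^bsub>unitary_group d\<^esub> z)"
    if "x \<in> unitaries d" "y \<in> unitaries d" "z \<in> unitaries d" for x y z
    using that by (auto intro!: assoc_mult_mat)
next
  show "\<one>\<^bsub>unitary_group d\<^esub> \<otimes>\<^bsub>unitary_group d\<^esub> x = x" if "x \<in> unitaries d" for x
    using that by (auto simp: unitaries_iff)
qed (simp_all add: unitaries_mult)

lemma fro_unitary_left:
  assumes U: "U \<in> unitaries d" and A: "A \<in> carrier_mat d n"
  shows "fro (U * A) = fro A"
proof -
  have c: "U \<in> carrier_mat d d" using U by auto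
  have "mat_adjoint (U * A) * (U * A) = mat_adjoint A * (mat_adjoint U * (U * A))"
    using A c by (simp add: mat_adjoint_mult[of _ d d _ n] assoc_mult_mat[of _ n d _ d _ n])
  then have "complex_of_real (fro (U * A)) = complex_of_real (fro A)"
    using adjoint_cancel_left[OF U A] by (simp flip: fro_trace)
  then show ?thesis by simp
qed

lemma fro_unitary_right:
  assumes U: "U \<in> unitaries d" and A: "A \<in> carrier_mat n d"
  shows "fro (A * U) = fro A"
proof -
  have "fro (A * U) = fro (mat_adjoint (A * U))" by simp
  also have "mat_adjoint (A * U) = mat_adjoint U * mat_adjoint A"
    using A U by (intro mat_adjoint_mult) auto
  also have "fro \<dots> = fro A"
    using fro_unitary_left[OF unitaries_adjoint[OF U]] A by (metis fro_adjoint mat_adjoint_carrier)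
  finally show ?thesis .
qed

lemma fnorm_unitary_left:
  "U \<in> unitaries d \<Longrightarrow> A \<in> carrier_mat d n \<Longrightarrow> fnorm (U * A) = fnorm A"
  by (simp add: fnorm_def fro_unitary_left)

lemma fnorm_unitary_right:
  "U \<in> unitaries d \<Longrightarrow> A \<in> carrier_mat n d \<Longrightarrow> fnorm (A * U) = fnorm A"
  by (simp add: fnorm_def fro_unitary_right)

lemma fro_one [simp]: "fro (1\<^sub>m d) = real d"
proof -
  have "(\<Sum>j<d. (cmod (1\<^sub>m d $$ (i, j)))\<^sup>2) = 1" if "i < d" for i
    using that by (subst sum.remove[of _ i]) (auto intro!: sum.neutral)
  then show ?thesis by (simp add: fro_def)
qed

lemma fro_unitary: "U \<in> unitaries d \<Longrightarrow> fro U = real d"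
  using fro_unitary_left[of U d "1\<^sub>m d" d] by (auto dest!: unitaries_carrier)

definition diag :: "nat \<Rightarrow> (nat \<Rightarrow> complex) \<Rightarrow> complex mat" where
  "diag d f = mat d d (\<lambda>(i, j). if i = j then f i else 0)"

lemma diag_carrier [simp]: "diag d f \<in> carrier_mat d d"
  by (simp add: diag_def)

lemma diag_dim [simp]: "dim_row (diag d f) = d" "dim_col (diag d f) = d"
  by (simp_all add: diag_def)

lemma diag_index [simp]: "i < d \<Longrightarrow> j < d \<Longrightarrow> diag d f $$ (i, j) = (if i = j then f i else 0)"
  by (simp add: diag_def)

lemma diag_mult_index [simp]:
  assumes "dim_row A = d" "i < d" "j < dim_col A"
  shows "(diag d f * A) $$ (i, j) = f i * A $$ (i, j)"
proof -
  have "(diag d f * A) $$ (i, j) = (\<Sum>k\<in>{0..<d}. diag d f $$ (i, k) * A $$ (k, j))"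
    using assms by (simp add: scalar_prod_def)
  also have "\<dots> = (\<Sum>k\<in>{0..<d}. if i = k then f i * A $$ (i, j) else 0)"
    using assms(2) by (intro sum.cong) auto
  finally show ?thesis using assms by simp
qed

lemma mult_diag_index [simp]:
  assumes "dim_col A = d" "i < dim_row A" "j < d"
  shows "(A * diag d f) $$ (i, j) = A $$ (i, j) * f j"
proof -
  have "(A * diag d f) $$ (i, j) = (\<Sum>k\<in>{0..<d}. A $$ (i, k) * diag d f $$ (k, j))"
    using assms by (simp add: scalar_prod_def)
  also have "\<dots> = (\<Sum>k\<in>{0..<d}. if j = k then A $$ (i, j) * f j else 0)"
    using assms(3) by (intro sum.cong) auto
  finally show ?thesis using assms by simp
qed

lemma diag_mult_diag: "diag d f * diag d g = diag d (\<lambda>i. f i * g i)"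
  by (rule eq_matI) (auto simp del: index_mult_mat(1))

lemma adjoint_diag: "mat_adjoint (diag d f) = diag d (\<lambda>i. cnj (f i))"
  by (rule eq_matI) auto

lemma diag_one: "diag d (\<lambda>_. 1) = 1\<^sub>m d"
  by (rule eq_matI) auto

lemma diag_unitary: "(\<And>i. i < d \<Longrightarrow> cmod (f i) = 1) \<Longrightarrow> diag d f \<in> unitaries d"
  by (intro unitariesI)
    (auto simp: adjoint_diag diag_mult_diag complex_norm_square[symmetric] mult.commute
      intro!: eq_matI)

lemma fro_diag: "fro (diag d f) = (\<Sum>i<d. (cmod (f i))\<^sup>2)"
proof -
  have "(\<Sum>j<d. (cmod (diag d f $$ (i, j)))\<^sup>2) = (cmod (f i))\<^sup>2" if "i < d" for i
    using that by (subst sum.remove[of _ i]) (auto intro!: sum.neutral)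
  then show ?thesis by (simp add: fro_def)
qed

section \<open>Spectral theorem and polar decomposition\<close>

lemma unitary_with_first_column:
  fixes v :: "complex vec"
  assumes v: "v \<in> carrier_vec (Suc n)" "v \<noteq> 0\<^sub>v (Suc n)"
  obtains W c where "W \<in> unitaries (Suc n)" "\<And>i. i < Suc n \<Longrightarrow> W $$ (i, 0) = c * v $ i"
proof -
  interpret cof_vec_space "Suc n" "TYPE(complex)" .
  define ws where "ws = gram_schmidt (Suc n) (basis_completion v)"
  note bc = basis_completion[OF v]
  note gs = gram_schmidt_result[OF bc(2) bc(4) bc(5) ws_def]
  have len: "length ws = Suc n" using gs bc by simp
  have "List.hd ws = v"
  proof (cases "basis_completion v")
    case (Cons w us)
    then have "w = v" using bc(7) by simp
    then show ?thesis unfolding ws_def Cons using gram_schmidt_hd[OF v(1)] by simp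
  qed (use bc(6) in simp)
  moreover have "ws \<noteq> []" using len by (metis length_0_conv nat.distinct(1))
  ultimately have hd: "ws ! 0 = v" by (metis hd_conv_nth)
  have wsc: "ws ! j \<in> carrier_vec (Suc n)" if "j < Suc n" for j
    using that len by (intro subsetD[OF gs(3)] nth_mem) simp
  define nm where "nm j = sqrt (\<Sum>k<Suc n. (cmod (ws ! j $ k))\<^sup>2)" for j
  define W where "W = mat (Suc n) (Suc n) (\<lambda>(i, j). ws ! j $ i / complex_of_real (nm j))"
  have W: "W \<in> carrier_mat (Suc n) (Suc n)" by (simp add: W_def)
  have sp: "ws ! j \<bullet>c ws ! i = (\<Sum>k<Suc n. ws ! j $ k * cnj (ws ! i $ k))"
    if "i < Suc n" "j < Suc n" for i j
    using wsc[OF that(1)] wsc[OF that(2)] by (simp add: scalar_prod_def lessThan_atLeast0 del: sum.op_ivl_Suc)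
  have self: "ws ! i \<bullet>c ws ! i = complex_of_real ((nm i)\<^sup>2)" if "i < Suc n" for i
    using that by (simp add: sp nm_def sum_nonneg complex_norm_square[unfolded of_real_power] del: sum.lessThan_Suc)
  have pos: "nm i \<noteq> 0" if "i < Suc n" for i
    using self[OF that] corthogonalD[OF gs(2), of i i] that len by auto
  have "mat_adjoint W * W = 1\<^sub>m (Suc n)"
  proof (rule eq_matI)
    fix i j assume "i < dim_row (1\<^sub>m (Suc n))" "j < dim_col (1\<^sub>m (Suc n))"
    then have ij: "i < Suc n" "j < Suc n" by auto
    have "(mat_adjoint W * W) $$ (i, j)
        = (\<Sum>k<Suc n. cnj (ws ! i $ k / complex_of_real (nm i)) * (ws ! j $ k / complex_of_real (nm j)))"
      using ij W by (auto simp: scalar_prod_def W_def lessThan_atLeast0 intro!: sum.cong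
        simp del: sum.lessThan_Suc sum.op_ivl_Suc)
    also have "\<dots> = (ws ! j \<bullet>c ws ! i) / (complex_of_real (nm i) * complex_of_real (nm j))"
      using ij by (simp add: sp sum_divide_distrib mult.commute del: sum.lessThan_Suc)
    also have "\<dots> = 1\<^sub>m (Suc n) $$ (i, j)"
    proof (cases "i = j")
      case True
      then show ?thesis using ij pos self by (simp add: power2_eq_square)
    next
      case False
      then show ?thesis using ij corthogonalD[OF gs(2), of j i] len by simp
    qed
    finally show "(mat_adjoint W * W) $$ (i, j) = 1\<^sub>m (Suc n) $$ (i, j)" .
  qed (use W in auto)
  then have "W \<in> unitaries (Suc n)" by (rule unitariesI[OF W])
  moreover have "W $$ (i, 0) = (1 / complex_of_real (nm 0)) * v $ i" if "i < Suc n" for i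
    using that by (simp add: W_def hd)
  ultimately show ?thesis by (rule that)
qed

lemma block_diagonal_mult:
  fixes X Y :: "complex mat"
  assumes "A \<in> carrier_mat 1 1" "B \<in> carrier_mat 1 1" "X \<in> carrier_mat n n" "Y \<in> carrier_mat n n"
  shows "four_block_mat A (0\<^sub>m 1 n) (0\<^sub>m n 1) X * four_block_mat B (0\<^sub>m 1 n) (0\<^sub>m n 1) Y
    = four_block_mat (A * B) (0\<^sub>m 1 n) (0\<^sub>m n 1) (X * Y)"
proof -
  have "A * B \<in> carrier_mat 1 1" "X * Y \<in> carrier_mat n n" using assms by auto
  then show ?thesis
    using assms
    by (subst mult_four_block_mat[of _ 1 1 _ n _ n _ _ 1 _ n])
      (simp_all add: left_mult_zero_mat[of _ n] left_mult_zero_mat[of _ 1]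
        right_mult_zero_mat[of _ 1 1] right_mult_zero_mat[of _ n n])
qed

text \<open>Conjugating by a unitary whose first column is an eigenvector makes the first column of a
  Hermitian matrix diagonal, hence by symmetry its first row too, and the induction hypothesis
  applies to the remaining block.\<close>

lemma hermitian_diagonalization_aux:
  assumes "H \<in> carrier_mat d d" "mat_adjoint H = H"
  shows "\<exists>U\<in>unitaries d. \<exists>g. mat_adjoint U * H * U = diag d g"
  using assms
proof (induction d arbitrary: H)
  case 0
  then show ?case by (intro bexI[of _ "1\<^sub>m 0"] exI[of _ "\<lambda>_. 0"]) (auto intro!: eq_matI)
next
  case (Suc n H)
  let ?N = "Suc n"
  note H = Suc.prems
  obtain as where as: "char_poly H = (\<Prod>a\<leftarrow>as. [:- a, 1:])" "length as = ?N"
    using char_poly_factorized[OF H(1)] by blast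
  then obtain e as' where "as = e # as'" by (cases as) auto
  then have "poly (char_poly H) e = 0" by (simp add: as)
  then have "eigenvalue H e" using eigenvalue_root_char_poly[OF H(1)] by simp
  then obtain v where v: "v \<in> carrier_vec ?N" "v \<noteq> 0\<^sub>v ?N" "H *\<^sub>v v = e \<cdot>\<^sub>v v"
    using H(1) by (auto simp: eigenvalue_def eigenvector_def)
  obtain W c where W: "W \<in> unitaries ?N" and Wc: "\<And>i. i < ?N \<Longrightarrow> W $$ (i, 0) = c * v $ i"
    using unitary_with_first_column[OF v(1,2)] by blast
  have Wcar: "W \<in> carrier_mat ?N ?N" using W by auto
  define B where "B = mat_adjoint W * H * W"
  have Bcar: "B \<in> carrier_mat ?N ?N" using Wcar H(1) by (auto simp: B_def)
  have Bherm: "mat_adjoint B = B"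
    using Wcar H by (simp add: B_def mat_adjoint_mult[of _ ?N ?N _ ?N] assoc_mult_mat[of _ ?N ?N _ ?N _ ?N])
  have HW: "(H * W) $$ (k, 0) = e * W $$ (k, 0)" if "k < ?N" for k
  proof -
    have "(H * W) $$ (k, 0) = c * (\<Sum>l\<in>{0..<?N}. H $$ (k, l) * v $ l)"
      using that Wcar H(1) Wc
      by (simp add: scalar_prod_def sum_distrib_left mult.left_commute del: sum.op_ivl_Suc)
    also have "(\<Sum>l\<in>{0..<?N}. H $$ (k, l) * v $ l) = (H *\<^sub>v v) $ k"
      using that H(1) v(1) by (simp add: scalar_prod_def del: sum.op_ivl_Suc)
    finally show ?thesis using that v Wc by simp
  qed
  have B0: "B $$ (i, 0) = (if i = 0 then e else 0)" if "i < ?N" for i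
  proof -
    have "B $$ (i, 0) = (mat_adjoint W * (H * W)) $$ (i, 0)"
      using Wcar H(1) by (simp add: B_def assoc_mult_mat[of _ ?N ?N _ ?N _ ?N])
    also have "\<dots> = e * (\<Sum>k\<in>{0..<?N}. mat_adjoint W $$ (i, k) * W $$ (k, 0))"
      using that Wcar H(1) HW
      by (simp add: scalar_prod_def sum_distrib_left mult.left_commute del: sum.op_ivl_Suc
        index_mult_mat(1)[of _ H] flip: index_mult_mat(1)[of _ H])
    also have "(\<Sum>k\<in>{0..<?N}. mat_adjoint W $$ (i, k) * W $$ (k, 0)) = (mat_adjoint W * W) $$ (i, 0)"
      using that Wcar by (simp add: scalar_prod_def del: sum.op_ivl_Suc)
    finally show ?thesis using W that by (simp add: unitaries_iff)
  qed
  have B0': "B $$ (0, i) = 0" if "0 < i" "i < ?N" for i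
  proof -
    have "B $$ (0, i) = cnj (B $$ (i, 0))"
      using that Bcar by (metis Bherm mat_adjoint_index carrier_matD zero_less_Suc)
    then show ?thesis using B0 that by simp
  qed
  define H' where "H' = mat n n (\<lambda>(i, j). B $$ (Suc i, Suc j))"
  have H': "H' \<in> carrier_mat n n" by (simp add: H'_def)
  have BB: "B = four_block_mat (mat 1 1 (\<lambda>_. e)) (0\<^sub>m 1 n) (0\<^sub>m n 1) H'"
    using Bcar B0 B0' by (intro eq_matI) (auto simp: H'_def)
  have "mat_adjoint H' = H'"
  proof (rule eq_matI)
    fix i j assume "i < dim_row H'" "j < dim_col H'"
    then have ij: "i < n" "j < n" using H' by auto
    have "B $$ (Suc i, Suc j) = cnj (B $$ (Suc j, Suc i))"
      using ij Bcar by (metis Bherm mat_adjoint_index carrier_matD Suc_less_eq)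
    then show "mat_adjoint H' $$ (i, j) = H' $$ (i, j)" using ij by (simp add: H'_def)
  qed (use H' in auto)
  then obtain V g where V: "V \<in> unitaries n" and g: "mat_adjoint V * H' * V = diag n g"
    using Suc.IH[OF H'] by blast
  have Vcar: "V \<in> carrier_mat n n" using V by auto
  define F where "F = four_block_mat (1\<^sub>m 1) (0\<^sub>m 1 n) (0\<^sub>m n 1) V"
  have Fa: "mat_adjoint F = four_block_mat (1\<^sub>m 1) (0\<^sub>m 1 n) (0\<^sub>m n 1) (mat_adjoint V)"
    using Vcar by (intro eq_matI) (auto simp: F_def)
  have Fcar: "F \<in> carrier_mat ?N ?N" using Vcar by (auto simp: F_def)
  have "mat_adjoint F * F = 1\<^sub>m ?N"
  proof -
    have "mat_adjoint F * F = four_block_mat (1\<^sub>m 1 * 1\<^sub>m 1) (0\<^sub>m 1 n) (0\<^sub>m n 1) (mat_adjoint V * V)"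
      unfolding Fa unfolding F_def using Vcar by (intro block_diagonal_mult) auto
    also have "\<dots> = 1\<^sub>m ?N"
      using V by (simp only: unitaries_iff) (intro eq_matI, auto)
    finally show ?thesis .
  qed
  then have F: "F \<in> unitaries ?N" by (rule unitariesI[OF Fcar])
  have "mat_adjoint W * H \<in> carrier_mat ?N ?N" "H * W \<in> carrier_mat ?N ?N"
    "W * F \<in> carrier_mat ?N ?N" "mat_adjoint W * (H * W) \<in> carrier_mat ?N ?N"
    using Wcar Fcar H(1) by auto
  then have "mat_adjoint (W * F) * H * (W * F) = mat_adjoint F * B * F"
    using Wcar Fcar H(1)
    by (simp add: B_def mat_adjoint_mult[of _ ?N ?N _ ?N] assoc_mult_mat[of _ ?N ?N _ ?N _ ?N])
  also have "\<dots> = four_block_mat (mat 1 1 (\<lambda>_. e)) (0\<^sub>m 1 n) (0\<^sub>m n 1) (mat_adjoint V * H' * V)"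
  proof -
    have VH: "mat_adjoint V * H' \<in> carrier_mat n n" "mat_adjoint V * H' * V \<in> carrier_mat n n"
      using Vcar H' by auto
    have "mat_adjoint F * B
        = four_block_mat (1\<^sub>m 1 * mat 1 1 (\<lambda>_. e)) (0\<^sub>m 1 n) (0\<^sub>m n 1) (mat_adjoint V * H')"
      unfolding Fa BB using Vcar H' by (intro block_diagonal_mult) auto
    then have "mat_adjoint F * B * F
        = four_block_mat (1\<^sub>m 1 * mat 1 1 (\<lambda>_. e)) (0\<^sub>m 1 n) (0\<^sub>m n 1) (mat_adjoint V * H') *
          four_block_mat (1\<^sub>m 1) (0\<^sub>m 1 n) (0\<^sub>m n 1) V"
      by (simp only: F_def)
    also have "\<dots> = four_block_mat (1\<^sub>m 1 * mat 1 1 (\<lambda>_. e) * 1\<^sub>m 1) (0\<^sub>m 1 n) (0\<^sub>m n 1)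
        (mat_adjoint V * H' * V)"
      using Vcar VH by (intro block_diagonal_mult) auto
    also have "1\<^sub>m 1 * mat 1 1 (\<lambda>_. e) * 1\<^sub>m 1 = mat 1 1 (\<lambda>_. e)"
      by (simp add: left_mult_one_mat[of _ 1 1] right_mult_one_mat[of _ 1 1])
    finally show ?thesis .
  qed
  also have "\<dots> = diag ?N (case_nat e g)"
    unfolding g by (intro eq_matI) (auto split: nat.split)
  finally show ?case using unitaries_mult[OF W F] by blast
qed

theorem hermitian_diagonalization:
  assumes H: "H \<in> carrier_mat d d" "mat_adjoint H = H"
  obtains U f where "U \<in> unitaries d" "H = U * diag d (\<lambda>i. complex_of_real (f i)) * mat_adjoint U"
proof -
  obtain U g where U: "U \<in> unitaries d" and g: "mat_adjoint U * H * U = diag d g"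
    using hermitian_diagonalization_aux[OF H] by blast
  have c: "U \<in> carrier_mat d d" using U by auto
  have "mat_adjoint (diag d g) = diag d g"
    unfolding g[symmetric] using c H
    by (simp add: mat_adjoint_mult[of _ d d _ d] assoc_mult_mat[of _ d d _ d _ d])
  then have "cnj (g i) = g i" if "i < d" for i
    using that by (metis adjoint_diag diag_index)
  then have "diag d g = diag d (\<lambda>i. complex_of_real (Re (g i)))"
    by (intro eq_matI) (auto simp: complex_eq_iff)
  moreover have "H = U * (mat_adjoint U * H * U) * mat_adjoint U"
    using U c H(1)
    by (simp add: assoc_mult_mat[of _ d d _ d _ d] adjoint_cancel_left[where d = d and n = d])
      (simp add: unitaries_iff)
  ultimately show ?thesis using that[OF U] g by metis
qed

lemma diag_cong: "(\<And>i. i < d \<Longrightarrow> f i = g i) \<Longrightarrow> diag d f = diag d g"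
  by (intro eq_matI) auto

lemma fro_mult_diag:
  fixes Y :: "complex mat"
  assumes Y: "Y \<in> carrier_mat d d" and D: "mat_adjoint Y * Y = diag d (\<lambda>j. complex_of_real (l j))"
  shows "fro (Y * diag d g) = (\<Sum>j<d. l j * (cmod (g j))\<^sup>2)"
proof -
  let ?G = "diag d g"
  have c: "?G \<in> carrier_mat d d" "mat_adjoint ?G \<in> carrier_mat d d" "mat_adjoint Y \<in> carrier_mat d d"
    "Y * ?G \<in> carrier_mat d d"
    using Y by simp_all
  have "mat_adjoint (Y * ?G) * (Y * ?G) = mat_adjoint ?G * ((mat_adjoint Y * Y) * ?G)"
    using c Y by (simp add: mat_adjoint_mult[OF Y c(1)] assoc_mult_mat[of _ d d _ d _ d])
  also have "\<dots> = diag d (\<lambda>j. complex_of_real (l j * (cmod (g j))\<^sup>2))"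
    unfolding D adjoint_diag diag_mult_diag
    by (intro arg_cong[of _ _ "diag d"] ext)
      (simp add: complex_norm_square[unfolded of_real_power] mult.commute mult.left_commute)
  finally have "complex_of_real (fro (Y * ?G)) = (\<Sum>j<d. complex_of_real (l j * (cmod (g j))\<^sup>2))"
    by (simp add: mat_trace_def flip: fro_trace)
  then show ?thesis by (simp only: of_real_sum[symmetric] of_real_eq_iff)
qed

text \<open>With \<open>X\<^sup>* X = W diag(l) W\<^sup>*\<close> the unitary is \<open>U = X W diag(1/\<surd>l) W\<^sup>*\<close>. For a contraction
  \<open>(1 - \<surd>l)\<^sup>2 \<le> 1 - l\<close>, so the distance is controlled by the missing norm \<open>d - fro X\<close>, free of any
  dimension constant. Since \<open>U\<close> is \<open>X\<close> times a function of \<open>X\<^sup>* X\<close>, Hermitian symmetries of \<open>X\<close>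
  survive; they will encode block patterns.\<close>

lemma polar_decomposition:
  fixes X :: "complex mat"
  assumes X: "X \<in> carrier_mat d d"
    and contr: "\<And>B. B \<in> carrier_mat d d \<Longrightarrow> fro (X * B) \<le> fro B"
    and inj: "\<And>v. v \<in> carrier_vec d \<Longrightarrow> X *\<^sub>v v = 0\<^sub>v d \<Longrightarrow> v = 0\<^sub>v d"
  obtains U where "U \<in> unitaries d" "fro (X - U) \<le> d - fro X"
    "\<And>C. C \<in> carrier_mat d d \<Longrightarrow> mat_adjoint C = C \<Longrightarrow> C * X = X * C \<Longrightarrow> C * U = U * C"
proof -
  have Hc: "mat_adjoint X * X \<in> carrier_mat d d" and Xa: "mat_adjoint X \<in> carrier_mat d d"
    using X by simp_all
  have "mat_adjoint (mat_adjoint X * X) = mat_adjoint X * X"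
    using X by (simp add: mat_adjoint_mult[OF Xa X])
  then obtain W l where W: "W \<in> unitaries d"
    and H: "mat_adjoint X * X = W * diag d (\<lambda>i. complex_of_real (l i)) * mat_adjoint W"
    using hermitian_diagonalization[OF Hc] by metis
  let ?L = "diag d (\<lambda>i. complex_of_real (l i))"
  have Wc: "W \<in> carrier_mat d d" and Wac: "mat_adjoint W \<in> carrier_mat d d"
    using unitaries_carrier[OF W] by simp_all
  define Y where "Y = X * W"
  have Y: "Y \<in> carrier_mat d d" and Ya: "mat_adjoint Y \<in> carrier_mat d d" using X Wc by (simp_all add: Y_def)
  note assoc = assoc_mult_mat[of _ d d _ d _ d]
  note cancel = adjoint_cancel_left[OF W, where n = d]
  have WW: "mat_adjoint W * W = 1\<^sub>m d" "W * mat_adjoint W = 1\<^sub>m d" using W by (auto simp: unitaries_iff)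
  have "mat_adjoint Y * Y = mat_adjoint W * ((mat_adjoint X * X) * W)"
    using X Xa Wc Wac by (simp add: Y_def mat_adjoint_mult[OF X Wc] assoc)
  also have "\<dots> = ?L"
    unfolding H using Wc Wac WW by (simp add: assoc cancel)
  finally have YY: "mat_adjoint Y * Y = ?L" .
  have XY: "X = Y * mat_adjoint W"
    using X Wc Wac WW by (simp add: Y_def assoc)
  define E where "E j = diag d (\<lambda>i. if i = j then 1 else 0 :: complex)" for j
  have Ec: "E j \<in> carrier_mat d d" for j by (simp add: E_def)
  have froE: "fro (Y * E j) = l j" if "j < d" for j
  proof -
    have "fro (Y * E j) = (\<Sum>i<d. if i = j then l j else 0)"
      unfolding E_def fro_mult_diag[OF Y YY] by (intro sum.cong) auto
    then show ?thesis using that by simp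
  qed
  have le1: "l j \<le> 1" if "j < d" for j
  proof -
    have "l j = fro (X * (W * E j))"
      using froE[OF that] X Wc Ec by (simp add: Y_def assoc)
    also have "\<dots> \<le> fro (W * E j)" using Wc Ec by (intro contr) simp
    also have "\<dots> = fro (E j)" by (rule fro_unitary_left[OF W Ec])
    also have "\<dots> = (\<Sum>i<d. if i = j then 1 else 0)" unfolding E_def fro_diag by (intro sum.cong) auto
    finally show ?thesis using that by simp
  qed
  have pos: "0 < l j" if j: "j < d" for j
  proof -
    have "l j \<noteq> 0"
    proof
      assume "l j = 0"
      then have "fro Y' = 0" if "Y' = Y * E j" for Y' using froE[OF j] that by simp
      then have *: "\<forall>i<d. \<forall>k<d. (Y * E j) $$ (i, k) = 0"
        using Y Ec[of j] by (auto simp: fro_def sum_nonneg_eq_0_iff sum_nonneg)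
      have "(Y * E j) $$ (i, j) = Y $$ (i, j)" if "i < d" for i
        using that j Y by (simp add: E_def del: index_mult_mat(1))
      with * have Y0: "Y $$ (i, j) = 0" if "i < d" for i using that j by metis
      have "X *\<^sub>v col W j = col Y j"
        using X Wc j by (intro eq_vecI) (simp_all add: Y_def)
      also have "\<dots> = 0\<^sub>v d" using Y j Y0 by (intro eq_vecI) auto
      finally have "X *\<^sub>v col W j = 0\<^sub>v d" .
      then have "col W j = 0\<^sub>v d" by (rule inj[rotated]) (rule carrier_vecI, use Wc in simp)
      then have "W $$ (i, j) = 0" if "i < d" for i
      proof -
        have "W $$ (i, j) = col W j $ i" using that Wc j by simp
        then show ?thesis using \<open>col W j = 0\<^sub>v d\<close> that by simp
      qed
      then have "(mat_adjoint W * W) $$ (j, j) = 0"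
        using Wc j by (simp add: scalar_prod_def)
      then show False using WW j by simp
    qed
    moreover have "0 \<le> l j" by (simp flip: froE[OF j])
    ultimately show ?thesis by simp
  qed
  define G where "G = diag d (\<lambda>i. complex_of_real (1 / sqrt (l i)))"
  define R where "R = diag d (\<lambda>i. complex_of_real (sqrt (l i)))"
  have Gc: "G \<in> carrier_mat d d" and Rc: "R \<in> carrier_mat d d" by (simp_all add: G_def R_def)
  define V where "V = Y * G"
  have Vc: "V \<in> carrier_mat d d" using Y Gc by (simp add: V_def)
  have "mat_adjoint V * V = mat_adjoint G * (?L * G)"
    using Y Ya Gc by (simp add: V_def mat_adjoint_mult[OF Y Gc] assoc flip: YY)
  also have "\<dots> = diag d (\<lambda>_. 1)"
    unfolding G_def adjoint_diag diag_mult_diag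
  proof (rule diag_cong)
    fix i assume "i < d"
    then have "1 / sqrt (l i) * (l i * (1 / sqrt (l i))) = 1"
      using pos[of i] by (simp add: field_simps)
    then show "cnj (complex_of_real (1 / sqrt (l i))) * (complex_of_real (l i) * complex_of_real (1 / sqrt (l i))) = 1"
      unfolding complex_cnj_complex_of_real of_real_mult[symmetric] by (simp only: of_real_1)
  qed
  finally have V: "V \<in> unitaries d" using Vc by (intro unitariesI) (simp_all add: diag_one)
  have VR: "Y = V * R"
  proof -
    have "G * R = 1\<^sub>m d"
      unfolding G_def R_def diag_mult_diag diag_one[symmetric]
    proof (rule diag_cong)
      fix i assume "i < d"
      then have "1 / sqrt (l i) * sqrt (l i) = 1" using pos[of i] by simp
      then show "complex_of_real (1 / sqrt (l i)) * complex_of_real (sqrt (l i)) = 1"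
        unfolding of_real_mult[symmetric] by (simp only: of_real_1)
    qed
    then show ?thesis using Y Gc Rc by (simp add: V_def assoc)
  qed
  define U where "U = V * mat_adjoint W"
  have U: "U \<in> unitaries d" unfolding U_def by (intro unitaries_mult V unitaries_adjoint W)
  have "X - U = V * ((R - 1\<^sub>m d) * mat_adjoint W)"
  proof -
    have "V * ((R - 1\<^sub>m d) * mat_adjoint W) = V * (R * mat_adjoint W) - V * (1\<^sub>m d * mat_adjoint W)"
      using Vc Rc Wac by (simp add: minus_mult_distrib_mat[of _ d d _ _ d] mult_minus_distrib_mat[of _ d d _ d])
    also have "1\<^sub>m d * mat_adjoint W = mat_adjoint W" using Wac by (rule left_mult_one_mat)
    finally show ?thesis using Vc Rc Wac by (simp add: U_def XY VR assoc)
  qed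
  moreover have RI: "R - 1\<^sub>m d \<in> carrier_mat d d" by (rule minus_carrier_mat) simp
  ultimately have "fro (X - U) = fro ((R - 1\<^sub>m d) * mat_adjoint W)"
    using Rc Wac by (simp add: fro_unitary_left[OF V, where n = d])
  also have "\<dots> = fro (R - 1\<^sub>m d)"
    by (rule fro_unitary_right[OF unitaries_adjoint[OF W] RI])
  also have "R - 1\<^sub>m d = diag d (\<lambda>i. complex_of_real (sqrt (l i) - 1))"
    unfolding R_def by (intro eq_matI) auto
  also have "fro \<dots> = (\<Sum>i<d. (sqrt (l i) - 1)\<^sup>2)"
    unfolding fro_diag by (simp only: norm_of_real power2_abs)
  also have "\<dots> \<le> (\<Sum>i<d. 1 - l i)"
  proof (rule sum_mono)
    fix i assume "i \<in> {..<d}"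
    then have i: "i < d" by simp
    have "sqrt (l i) * sqrt (l i) = l i" using pos[OF i] by simp
    moreover have "sqrt (l i) \<le> 1" "0 \<le> sqrt (l i)" using le1[OF i] pos[OF i] by simp_all
    moreover have "sqrt (l i) * sqrt (l i) \<le> sqrt (l i)"
      by (rule mult_left_le) fact+
    ultimately show "(sqrt (l i) - 1)\<^sup>2 \<le> 1 - l i" by (simp add: power2_eq_square algebra_simps)
  qed
  also have "\<dots> = d - fro X"
  proof -
    have "fro X = fro Y" unfolding Y_def using fro_unitary_right[OF W X] by simp
    also have "Y = Y * diag d (\<lambda>_. 1)" using Y by (simp add: diag_one)
    also have "fro \<dots> = (\<Sum>i<d. l i)" unfolding fro_mult_diag[OF Y YY] by simp
    finally show ?thesis by (simp add: sum_subtractf)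
  qed
  finally have close: "fro (X - U) \<le> d - fro X" .
  have "C * U = U * C" if C: "C \<in> carrier_mat d d" and Ca: "mat_adjoint C = C" and CX: "C * X = X * C" for C
  proof -
    have CXa: "C * mat_adjoint X = mat_adjoint X * C"
      using arg_cong[OF CX, of mat_adjoint] by (simp add: mat_adjoint_mult[OF C X] mat_adjoint_mult[OF X C] Ca)
    have "C * (mat_adjoint X * X) = (C * mat_adjoint X) * X" using C X Xa by (simp add: assoc)
    also have "\<dots> = mat_adjoint X * (C * X)" using C X Xa by (simp add: assoc CXa)
    also have "\<dots> = (mat_adjoint X * X) * C" using C X Xa by (simp add: assoc CX)
    finally have CH: "C * (mat_adjoint X * X) = (mat_adjoint X * X) * C" .
    define C' where "C' = mat_adjoint W * C * W"
    have C'c: "C' \<in> carrier_mat d d" using C Wc Wac by (simp add: C'_def)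
    have "C' * ?L = mat_adjoint W * (C * (W * ?L * mat_adjoint W)) * W"
      using C Wc Wac WW by (simp add: C'_def assoc)
    also have "\<dots> = mat_adjoint W * ((W * ?L * mat_adjoint W) * C) * W"
      using CH unfolding H by simp
    also have "\<dots> = ?L * C'"
      using C Wc Wac WW by (simp add: C'_def assoc cancel)
    finally have comm: "C' * ?L = ?L * C'" .
    have "C' * G = G * C'"
    proof (rule eq_matI)
      fix i j assume "i < dim_row (G * C')" "j < dim_col (G * C')"
      then have ij: "i < d" "j < d" using Gc C'c by auto
      have "C' $$ (i, j) * l j = l i * C' $$ (i, j)"
        using arg_cong[OF comm, of "\<lambda>A. A $$ (i, j)"] ij C'c by (simp del: index_mult_mat(1))
      then have "C' $$ (i, j) = 0 \<or> l i = l j"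
        by (auto simp: mult.commute)
      then show "(C' * G) $$ (i, j) = (G * C') $$ (i, j)"
        using ij C'c by (auto simp: G_def simp del: index_mult_mat(1))
    qed (use Gc C'c in auto)
    moreover have "C * U = Y * (C' * G) * mat_adjoint W"
    proof -
      have "C * U = (C * X) * (W * (G * mat_adjoint W))"
        using C X Wc Wac Gc by (simp add: U_def V_def Y_def assoc)
      also have "\<dots> = X * (W * (mat_adjoint W * (C * (W * (G * mat_adjoint W)))))"
        using C X Wc Wac Gc by (simp add: CX assoc cancel)
      finally show ?thesis using C X Wc Wac Gc by (simp add: Y_def C'_def assoc)
    qed
    moreover have "U * C = Y * (G * C') * mat_adjoint W"
      using C Y Wc Wac Gc WW by (simp add: U_def V_def C'_def assoc)
    ultimately show ?thesis by simp
  qed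
  then show ?thesis using that U close by blast
qed

section \<open>Selecting large eigenvalues\<close>

lemma exists_large_subset:
  fixes f :: "'a \<Rightarrow> real"
  assumes "finite A" "d \<le> card A"
  shows "\<exists>R\<subseteq>A. card R = d \<and> (\<exists>c. (\<forall>i\<in>R. c \<le> f i) \<and> (\<forall>i\<in>A - R. f i \<le> c))"
  using assms
proof (induction d arbitrary: A)
  case 0
  then show ?case
    by (intro exI[of _ "{}"]) (auto intro!: exI[of _ "Max (insert 0 (f ` A))"])
next
  case (Suc d)
  then have "A \<noteq> {}" by auto
  then have "Max (f ` A) \<in> f ` A" using Suc.prems(1) by (intro Max_in) auto
  then obtain m where "m \<in> A" "f m = Max (f ` A)" by auto
  then have m: "m \<in> A" "\<forall>i\<in>A. f i \<le> f m" using Suc.prems(1) by simp_all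
  have "d \<le> card (A - {m})" using Suc.prems m by simp
  then obtain R c where R: "R \<subseteq> A - {m}" "card R = d" "\<forall>i\<in>R. c \<le> f i" "\<forall>i\<in>A - {m} - R. f i \<le> c"
    using Suc.IH[of "A - {m}"] Suc.prems(1) by (metis finite_Diff)
  have "card (insert m R) = Suc d"
    using R Suc.prems(1) by (subst card_insert_disjoint) (auto dest: finite_subset)
  moreover have "\<exists>c. (\<forall>i\<in>insert m R. c \<le> f i) \<and> (\<forall>i\<in>A - insert m R. f i \<le> c)"
    using R m by (intro exI[of _ "min c (f m)"]) (auto simp: min_def)
  ultimately show ?case using R m by (intro exI[of _ "insert m R"]) auto
qed

text \<open>The point of the bound is that it has no loss in the number of values: if the values are
  nearly 0 or 1 in the sense that \<open>\<Sum>f (1 - f)\<close> is small, then the \<open>d\<close> largest ones carry almost the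
  full sum. With a threshold \<open>c\<close> between the selected and the other values, the deficit \<open>d - sum f R\<close>
  serves as a weight on either side.\<close>

lemma sum_top_ge_sum_squares:
  fixes f :: "'a \<Rightarrow> real"
  assumes A: "finite A" and f: "\<And>i. i \<in> A \<Longrightarrow> 0 \<le> f i \<and> f i \<le> 1" and s: "sum f A = real d"
  obtains R where "R \<subseteq> A" "card R = d" "(\<Sum>i\<in>A. (f i)\<^sup>2) \<le> sum f R"
proof -
  have "sum f A \<le> real (card A)" using sum_bounded_above[of A f 1] f by simp
  then have "d \<le> card A" using s by simp
  then obtain R c where R: "R \<subseteq> A" "card R = d" "\<forall>i\<in>R. c \<le> f i" "\<forall>i\<in>A - R. f i \<le> c"
    using exists_large_subset[OF A, of d f] by blast
  have fR: "finite R" using R A finite_subset by blast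
  have split: "sum g A = sum g (A - R) + sum g R" for g :: "'a \<Rightarrow> real"
    by (rule sum.subset_diff[OF R(1) A])
  have "(\<Sum>i\<in>A - R. (f i)\<^sup>2) \<le> (\<Sum>i\<in>A - R. c * f i)"
    using R f by (intro sum_mono) (auto simp: power2_eq_square intro: mult_right_mono)
  also have "\<dots> = c * (real d - sum f R)"
    using split[of f] s by (simp add: sum_distrib_left[symmetric])
  also have "\<dots> = (\<Sum>i\<in>R. c * (1 - f i))"
    using R by (simp add: sum_distrib_left[symmetric] sum_subtractf)
  also have "\<dots> \<le> (\<Sum>i\<in>R. f i * (1 - f i))"
    using R f by (intro sum_mono mult_right_mono) auto
  also have "\<dots> = sum f R - (\<Sum>i\<in>R. (f i)\<^sup>2)"
    by (simp add: algebra_simps power2_eq_square sum_subtractf)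
  finally have "(\<Sum>i\<in>A. (f i)\<^sup>2) \<le> sum f R" by (simp add: split)
  then show ?thesis using that R by blast
qed

section \<open>Unitaries near contractions\<close>

text \<open>The matrices \<open>(X + t)/(1 + t)\<close> are injective contractions with the same symmetries for all but
  finitely many small \<open>t > 0\<close>, which removes the injectivity hypothesis at the price of \<open>e\<close>.\<close>

lemma nearby_unitary:
  fixes X :: "complex mat"
  assumes X: "X \<in> carrier_mat d d"
    and contr: "\<And>B. B \<in> carrier_mat d d \<Longrightarrow> fro (X * B) \<le> fro B" and e: "0 < e"
  obtains U where "U \<in> unitaries d" "fnorm (X - U) \<le> sqrt (d - fro X) + e"
    "\<And>C. C \<in> carrier_mat d d \<Longrightarrow> mat_adjoint C = C \<Longrightarrow> C * X = X * C \<Longrightarrow> C * U = U * C"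
proof -
  \<comment> \<open>The bound makes both \<open>\<surd>(t d)\<close> and \<open>t \<surd>d\<close> at most \<open>e / 4\<close>.\<close>
  define t0 where "t0 = min 1 (e\<^sup>2 / (16 * (real d + 1)))"
  have t0: "0 < t0" using e by (simp add: t0_def)
  have "char_poly X \<noteq> 0" using degree_monic_char_poly[OF X] by auto
  then have "finite {k. poly (char_poly X) k = 0}" by (rule poly_roots_finite)
  moreover define Bad where "Bad = (\<lambda>t. complex_of_real (- t)) -` {k. poly (char_poly X) k = 0}"
  ultimately have "finite Bad" unfolding Bad_def by (intro finite_vimageI) (auto simp: inj_def)
  then have "\<not> {0<..<t0} \<subseteq> Bad"
    using infinite_Ioo[OF t0] by (metis finite_subset)
  then obtain t where "t \<in> {0<..<t0}" "t \<notin> Bad" by blast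
  then have t: "0 < t" "t \<le> 1" "t \<le> e\<^sup>2 / (16 * (real d + 1))"
    and nev: "\<not> eigenvalue X (- complex_of_real t)"
    using eigenvalue_root_char_poly[OF X] by (auto simp: t0_def Bad_def)
  have rd: "(sqrt (real d))\<^sup>2 = real d" by simp
  have "t * real d \<le> t * (real d + 1)" using t by simp
  also have "\<dots> \<le> e\<^sup>2 / (16 * (real d + 1)) * (real d + 1)" using t by (intro mult_right_mono) auto
  also have "\<dots> = (e / 4)\<^sup>2"
  proof -
    have "x / (16 * y) * y = x / 16" if "y \<noteq> 0" for x y :: real using that by simp
    from this[of "real d + 1" "e\<^sup>2"] show ?thesis by (simp add: power_divide)
  qed
  finally have td: "t * real d \<le> (e / 4)\<^sup>2" .
  then have s1: "sqrt (t * real d) \<le> e / 4" using e by (intro real_le_lsqrt) auto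
  have "(t * sqrt (real d))\<^sup>2 = t * (t * real d)" by (simp add: power_mult_distrib power2_eq_square)
  also have "\<dots> \<le> 1 * (t * real d)" using t by (intro mult_right_mono) auto
  finally have "(t * sqrt (real d))\<^sup>2 \<le> (e / 4)\<^sup>2" using td by simp
  then have s2: "t * sqrt (real d) \<le> e / 4" by (rule power2_le_imp_le) (use e in simp)
  define c where "c = complex_of_real (1 / (1 + t))"
  define M where "M = X + complex_of_real t \<cdot>\<^sub>m 1\<^sub>m d"
  define Z where "Z = c \<cdot>\<^sub>m M"
  have cn: "cmod c = 1 / (1 + t)" using t unfolding c_def norm_of_real by simp
  have M: "M \<in> carrier_mat d d" using X by (simp add: M_def)
  have Z: "Z \<in> carrier_mat d d" using M by (simp add: Z_def)
  have fX: "fnorm X \<le> sqrt d"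
    using contr[of "1\<^sub>m d"] X by (simp add: fnorm_def)
  have bnd: "fnorm (Z * B) \<le> fnorm B" if B: "B \<in> carrier_mat d d" for B
  proof -
    have "Z * B = c \<cdot>\<^sub>m (X * B + complex_of_real t \<cdot>\<^sub>m B)"
      using X B by (simp add: Z_def M_def add_mult_distrib_mat[of _ d d] mult_smult_assoc_mat[of _ d d _ d])
    then have "fnorm (Z * B) = fnorm (X * B + complex_of_real t \<cdot>\<^sub>m B) / (1 + t)"
      using t by (simp add: fnorm_smult cn)
    also have "\<dots> \<le> (fnorm (X * B) + fnorm (complex_of_real t \<cdot>\<^sub>m B)) / (1 + t)"
      using X B t by (intro divide_right_mono fnorm_triangle[of _ d d]) simp_all
    also have "\<dots> \<le> (fnorm B + t * fnorm B) / (1 + t)"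
    proof -
      have "fnorm (X * B) \<le> fnorm B" using contr[OF B] by (simp add: fnorm_def)
      moreover have "fnorm (complex_of_real t \<cdot>\<^sub>m B) = t * fnorm B" using t by (simp add: fnorm_smult)
      ultimately show ?thesis using t by (intro divide_right_mono) simp_all
    qed
    also have "\<dots> = fnorm B" using t by (simp add: field_simps)
    finally show ?thesis .
  qed
  have contrZ: "fro (Z * B) \<le> fro B" if "B \<in> carrier_mat d d" for B
    using bnd[OF that] by (simp add: fnorm_def)
  have "v = 0\<^sub>v d" if v: "v \<in> carrier_vec d" and Zv: "Z *\<^sub>v v = 0\<^sub>v d" for v
  proof (rule ccontr)
    assume "v \<noteq> 0\<^sub>v d"
    have "X *\<^sub>v v = (- complex_of_real t) \<cdot>\<^sub>v v"
    proof (rule eq_vecI)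
      fix i assume "i < dim_vec ((- complex_of_real t) \<cdot>\<^sub>v v)"
      then have i: "i < d" using v by simp
      have rows: "row X i \<in> carrier_vec d" "row (1\<^sub>m d) i \<in> carrier_vec d" "unit_vec d i \<in> carrier_vec d"
        using X i by (auto intro: carrier_vecI)
      have "row Z i = c \<cdot>\<^sub>v (row X i + complex_of_real t \<cdot>\<^sub>v unit_vec d i)"
        using X i by (intro eq_vecI) (auto simp: Z_def M_def unit_vec_def)
      then have "(Z *\<^sub>v v) $ i = c * (row X i \<bullet> v + complex_of_real t * v $ i)"
        using i Z rows v by (simp add: add_scalar_prod_distrib[of _ d] scalar_prod_left_unit)
      moreover have "c \<noteq> 0" using cn t by force
      ultimately have "row X i \<bullet> v + complex_of_real t * v $ i = 0" using Zv i by simp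
      then show "(X *\<^sub>v v) $ i = ((- complex_of_real t) \<cdot>\<^sub>v v) $ i"
        using i X v by (simp add: eq_neg_iff_add_eq_0)
    qed (use X v in simp)
    then have "eigenvalue X (- complex_of_real t)"
      unfolding eigenvalue_def eigenvector_def using v \<open>v \<noteq> 0\<^sub>v d\<close> X by auto
    then show False using nev by simp
  qed
  then obtain U where U: "U \<in> unitaries d" "fro (Z - U) \<le> d - fro Z"
    and UC: "\<And>C. C \<in> carrier_mat d d \<Longrightarrow> mat_adjoint C = C \<Longrightarrow> C * Z = Z * C \<Longrightarrow> C * U = U * C"
    using polar_decomposition[OF Z contrZ] by metis
  have Uc: "U \<in> carrier_mat d d" using U by auto
  have XZ: "fnorm (X - Z) \<le> 2 * (t * sqrt d)"
  proof -
    have "X - Z = (c * complex_of_real t) \<cdot>\<^sub>m (X - 1\<^sub>m d)"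
    proof (rule eq_matI)
      fix i j assume "i < dim_row ((c * complex_of_real t) \<cdot>\<^sub>m (X - 1\<^sub>m d))"
        "j < dim_col ((c * complex_of_real t) \<cdot>\<^sub>m (X - 1\<^sub>m d))"
      then have ij: "i < d" "j < d" by auto
      have "(1 + complex_of_real t) * c = 1"
      proof -
        have "(1 + complex_of_real t) * c = complex_of_real ((1 + t) * (1 / (1 + t)))"
          unfolding c_def by (simp only: of_real_mult of_real_add of_real_1)
        then show ?thesis using t by simp
      qed
      then have c1: "c = 1 - c * complex_of_real t" by (simp add: algebra_simps)
      have "x - c * (x + complex_of_real t * o1) = c * complex_of_real t * (x - o1)" for x o1
      proof -
        have "x - c * (x + complex_of_real t * o1) = x - c * x - c * complex_of_real t * o1"
          by (simp add: algebra_simps)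
        also have "x - c * x = c * complex_of_real t * x"
          by (subst (1) c1) (simp add: algebra_simps)
        finally show ?thesis by (simp add: algebra_simps)
      qed
      then show "(X - Z) $$ (i, j) = ((c * complex_of_real t) \<cdot>\<^sub>m (X - 1\<^sub>m d)) $$ (i, j)"
        using ij X by (simp add: Z_def M_def)
    qed (use X Z in auto)
    then have "fnorm (X - Z) = cmod c * t * fnorm (X - 1\<^sub>m d)"
      using t by (simp add: fnorm_smult norm_mult)
    also have "\<dots> \<le> 1 * t * fnorm (X - 1\<^sub>m d)"
      using t by (intro mult_right_mono) (auto simp: cn)
    also have "fnorm (X - 1\<^sub>m d) \<le> fnorm (X - 0\<^sub>m d d) + fnorm (0\<^sub>m d d - 1\<^sub>m d)"
      using X by (intro fnorm_diff_triangle[of _ d d]) auto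
    also have "X - 0\<^sub>m d d = X" using X by (intro eq_matI) auto
    also have "fnorm (0\<^sub>m d d - 1\<^sub>m d) = fnorm (1\<^sub>m d - 0\<^sub>m d d :: complex mat)"
      by (rule fnorm_minus_commute[of _ d d]) auto
    also have "1\<^sub>m d - 0\<^sub>m d d = (1\<^sub>m d :: complex mat)" by (intro eq_matI) auto
    also have "fnorm X + fnorm (1\<^sub>m d) \<le> sqrt d + sqrt d" using fX by (simp add: fnorm_def)
    finally show ?thesis using t by (simp add: mult_left_mono)
  qed
  have "fro X - fro Z \<le> 4 * (t * real d)"
  proof -
    have "fnorm X \<le> fnorm Z + fnorm (X - Z)"
    proof -
      have "X = (X - Z) + Z" using X Z by (intro eq_matI) auto
      then show ?thesis using fnorm_triangle[of "X - Z" d d Z] Z minus_carrier_mat[OF Z, of X] by simp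
    qed
    then have d1: "fnorm X - fnorm Z \<le> 2 * (t * sqrt d)" using XZ by simp
    have fZ: "fnorm Z \<le> sqrt d" using bnd[of "1\<^sub>m d"] Z by (simp add: fnorm_def)
    have "fro X - fro Z = (fnorm X - fnorm Z) * (fnorm X + fnorm Z)"
      by (simp add: algebra_simps flip: power2_eq_square)
    also have "\<dots> \<le> (2 * (t * sqrt d)) * (fnorm X + fnorm Z)"
      using d1 by (intro mult_right_mono) auto
    also have "\<dots> \<le> (2 * (t * sqrt d)) * (sqrt d + sqrt d)"
      using fX fZ t by (intro mult_left_mono add_mono) auto
    also have "\<dots> = 4 * (t * (sqrt (real d))\<^sup>2)" by (simp add: power2_eq_square)
    finally show ?thesis unfolding rd .
  qed
  then have "d - fro Z \<le> (d - fro X) + 4 * (t * real d)" by simp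
  then have "fnorm (Z - U) \<le> sqrt ((d - fro X) + 4 * (t * real d))"
    using U by (simp add: fnorm_def)
  also have "\<dots> \<le> sqrt (d - fro X) + sqrt (4 * (t * real d))"
    using t fX real_sqrt_ge_zero by (intro sqrt_add_le_add_sqrt) (auto simp: fnorm_def)
  also have "sqrt (4 * (t * real d)) = 2 * sqrt (t * real d)" by (simp add: real_sqrt_mult)
  finally have "fnorm (X - U) \<le> sqrt (d - fro X) + e"
    using fnorm_diff_triangle[OF X Z Uc] XZ s1 s2 by linarith
  moreover have "C * U = U * C" if C: "C \<in> carrier_mat d d" "mat_adjoint C = C" "C * X = X * C" for C
  proof (rule UC[OF C(1,2)])
    have "C * Z = c \<cdot>\<^sub>m (C * X + complex_of_real t \<cdot>\<^sub>m C)"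
      using X C(1) by (simp add: Z_def M_def mult_add_distrib_mat[of _ d d] mult_smult_distrib[of _ d d _ d])
    moreover have "Z * C = c \<cdot>\<^sub>m (X * C + complex_of_real t \<cdot>\<^sub>m C)"
      using X C(1) by (simp add: Z_def M_def add_mult_distrib_mat[of _ d d] mult_smult_assoc_mat[of _ d d _ d])
    ultimately show "C * Z = Z * C" using C(3) by simp
  qed
  ultimately show ?thesis using that U(1) by metis
qed

lemma matching_of_equal_fibers:
  fixes a b :: "nat \<Rightarrow> 's"
  assumes "\<And>y. card {i. i < d \<and> a i = y} = card {j. j < d \<and> b j = y}"
  obtains p where "p permutes {..<d}" "\<And>j. j < d \<Longrightarrow> b j = a (p j)"
proof -
  have cnt: "count (mset (map f [0..<d])) y = card {i. i < d \<and> f i = y}" for f :: "nat \<Rightarrow> 's" and y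
  proof -
    have "count (mset (map f xs)) y = length (filter (\<lambda>i. f i = y) xs)" for xs
      by (induction xs) auto
    then have "count (mset (map f [0..<d])) y = length (filter (\<lambda>i. f i = y) [0..<d])" .
    also have "\<dots> = card {i. i < length [0..<d] \<and> f ([0..<d] ! i) = y}"
      by (rule length_filter_conv_card)
    also have "{i. i < length [0..<d] \<and> f ([0..<d] ! i) = y} = {i. i < d \<and> f i = y}" by auto
    finally show ?thesis .
  qed
  have "mset (map b [0..<d]) = mset (map a [0..<d])"
    by (rule multiset_eqI) (simp only: cnt assms)
  then obtain p where p: "p permutes {..<length (map a [0..<d])}"
      and e: "permute_list p (map a [0..<d]) = map b [0..<d]"
    by (rule mset_eq_permutation)
  have "b j = a (p j)" if "j < d" for j
  proof -
    have "p j < d" using p that permutes_in_image[OF p, of j] by simp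
    have "map b [0..<d] ! j = map a [0..<d] ! p j"
      using that by (simp add: permute_list_nth[OF p] flip: e)
    then show ?thesis using that \<open>p j < d\<close> by simp
  qed
  with p show ?thesis using that by simp
qed

text \<open>The compression of \<open>T\<close> to the entries that send a vector with column label \<open>y\<close> to vectors with
  row label \<open>y\<close>.\<close>

definition block_part :: "nat \<Rightarrow> (nat \<Rightarrow> 's) \<Rightarrow> (nat \<Rightarrow> 's) \<Rightarrow> complex mat \<Rightarrow> complex mat" where
  "block_part d a b T = mat d d (\<lambda>(i, j). if a i = b j then T $$ (i, j) else 0)"

text \<open>The block part acts by \<open>T\<close> on each component of a fixed label and then projects, and the
  components are orthogonal.\<close>

lemma block_part_contraction:
  assumes T: "T \<in> unitaries d" and B: "B \<in> carrier_mat d d"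
  shows "fro (block_part d a b T * B) \<le> fro B"
proof -
  define Y where "Y = a ` {..<d} \<union> b ` {..<d}"
  have fY: "finite Y" by (simp add: Y_def)
  have Tc: "T \<in> carrier_mat d d" using T by auto
  define Bp where "Bp y = diag d (\<lambda>j. if b j = y then 1 else 0) * B" for y
  have Bpc: "Bp y \<in> carrier_mat d d" for y using B by (simp add: Bp_def)
  have Bpi: "Bp y $$ (j, k) = (if b j = y then B $$ (j, k) else 0)" if "j < d" "k < d" for y j k
    using that B by (simp add: Bp_def del: index_mult_mat(1))
  have ent: "(block_part d a b T * B) $$ (i, k) = (T * Bp (a i)) $$ (i, k)" if "i < d" "k < d" for i k
    using that B Tc Bpc[of "a i"]
    by (auto simp: scalar_prod_def block_part_def Bpi intro!: sum.cong)
  have "fro (block_part d a b T * B) = (\<Sum>i<d. \<Sum>k<d. (cmod ((T * Bp (a i)) $$ (i, k)))\<^sup>2)"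
    using B by (simp add: fro_def block_part_def ent[unfolded block_part_def] del: index_mult_mat(1))
  also have "\<dots> \<le> (\<Sum>i<d. \<Sum>y\<in>Y. \<Sum>k<d. (cmod ((T * Bp y) $$ (i, k)))\<^sup>2)"
  proof (rule sum_mono)
    fix i assume "i \<in> {..<d}"
    then have "a i \<in> Y" by (simp add: Y_def)
    then show "(\<Sum>k<d. (cmod ((T * Bp (a i)) $$ (i, k)))\<^sup>2)
        \<le> (\<Sum>y\<in>Y. \<Sum>k<d. (cmod ((T * Bp y) $$ (i, k)))\<^sup>2)"
      by (rule member_le_sum) (auto intro: sum_nonneg fY)
  qed
  also have "\<dots> = (\<Sum>y\<in>Y. fro (T * Bp y))"
    using Tc Bpc by (subst sum.swap) (simp add: fro_def carrier_matD[OF Bpc] del: index_mult_mat(1))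
  also have "\<dots> = (\<Sum>y\<in>Y. fro (Bp y))"
    by (intro sum.cong refl fro_unitary_left[OF T Bpc])
  also have "\<dots> = (\<Sum>y\<in>Y. \<Sum>j<d. \<Sum>k<d. if b j = y then (cmod (B $$ (j, k)))\<^sup>2 else 0)"
    by (intro sum.cong refl) (auto simp: fro_def carrier_matD[OF Bpc] Bpi intro!: sum.cong)
  also have "\<dots> = (\<Sum>j<d. \<Sum>k<d. \<Sum>y\<in>Y. if b j = y then (cmod (B $$ (j, k)))\<^sup>2 else 0)"
    by (subst sum.swap, intro sum.cong refl, rule sum.swap)
  also have "\<dots> = fro B"
    using B fY by (auto simp: fro_def Y_def intro!: sum.cong)
  finally show ?thesis .
qed

text \<open>A permutation that matches row and column labels turns the block part into a block diagonal
  matrix, i.e. one that commutes with the diagonal projections onto the labels. The unitary part of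
  its polar decomposition commutes with them as well, so it has the same pattern.\<close>

lemma block_rounding:
  fixes a b :: "nat \<Rightarrow> 's"
  assumes T: "T \<in> unitaries d"
    and fib: "\<And>y. card {i. i < d \<and> a i = y} = card {j. j < d \<and> b j = y}" and e: "0 < e"
  obtains U where "U \<in> unitaries d"
    "fnorm (T - U) \<le> 2 * sqrt (\<Sum>i<d. \<Sum>j<d. if a i = b j then 0 else (cmod (T $$ (i, j)))\<^sup>2) + e"
    "\<And>i j. i < d \<Longrightarrow> j < d \<Longrightarrow> U $$ (i, j) \<noteq> 0 \<Longrightarrow> a i = b j"
proof -
  let ?bad = "\<Sum>i<d. \<Sum>j<d. if a i = b j then 0 else (cmod (T $$ (i, j)))\<^sup>2"
  obtain p where p: "p permutes {..<d}" and bp: "\<And>j. j < d \<Longrightarrow> b j = a (p j)"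
    using matching_of_equal_fibers[OF fib] by metis
  have pd: "p j < d" if "j < d" for j using that permutes_in_image[OF p, of j] by simp
  have pinj: "p i = p j \<longleftrightarrow> i = j" for i j using permutes_inj[OF p] by (auto simp: inj_def)
  have Tc: "T \<in> carrier_mat d d" using T by auto
  define X where "X = block_part d a b T"
  have Xc: "X \<in> carrier_mat d d" by (simp add: X_def block_part_def)
  \<comment> \<open>After this permutation of its rows, \<open>X\<close> is block diagonal.\<close>
  define X' where "X' = mat d d (\<lambda>(k, j). X $$ (p k, j))"
  have X'c: "X' \<in> carrier_mat d d" by (simp add: X'_def)
  have reidx: "(\<Sum>k<d. f (p k)) = (\<Sum>i<d. f i)" for f :: "nat \<Rightarrow> real"
    using sum.permute[OF p, of f] by (simp add: o_def)
  have froperm: "fro (mat d d (\<lambda>(k, j). M $$ (p k, j))) = fro M" if "M \<in> carrier_mat d d" for M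
    using that reidx[of "\<lambda>i. \<Sum>j<d. (cmod (M $$ (i, j)))\<^sup>2"] by (simp add: fro_def)
  have contr: "fro (X' * B) \<le> fro B" if B: "B \<in> carrier_mat d d" for B
  proof -
    have "X' * B = mat d d (\<lambda>(k, j). (X * B) $$ (p k, j))"
      using B Xc pd by (intro eq_matI) (auto simp: X'_def scalar_prod_def)
    then have "fro (X' * B) = fro (X * B)" using Xc B by (simp add: froperm)
    then show ?thesis using block_part_contraction[OF T B, of a b] by (simp add: X_def)
  qed
  obtain U' where U': "U' \<in> unitaries d" "fnorm (X' - U') \<le> sqrt (d - fro X') + e"
    and U'C: "\<And>C. C \<in> carrier_mat d d \<Longrightarrow> mat_adjoint C = C \<Longrightarrow> C * X' = X' * C \<Longrightarrow> C * U' = U' * C"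
    using nearby_unitary[OF X'c contr e] by metis
  have U'c: "U' \<in> carrier_mat d d" using U' by auto
  have U'block: "b k = b j" if kj: "k < d" "j < d" and nz: "U' $$ (k, j) \<noteq> 0" for k j
  proof (rule ccontr)
    assume ne: "b k \<noteq> b j"
    define C where "C = diag d (\<lambda>i. if b i = b j then 1 else 0)"
    have Cc: "C \<in> carrier_mat d d" by (simp add: C_def)
    have "mat_adjoint C = C" unfolding C_def adjoint_diag by (rule diag_cong) simp
    moreover have "C * X' = X' * C"
    proof (rule eq_matI)
      fix r s assume "r < dim_row (X' * C)" "s < dim_col (X' * C)"
      then have rs: "r < d" "s < d" using X'c Cc by auto
      have "X' $$ (r, s) = 0 \<or> b r = b s"
        using rs pd bp by (auto simp: X'_def X_def block_part_def)
      then show "(C * X') $$ (r, s) = (X' * C) $$ (r, s)"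
        using rs X'c by (auto simp: C_def simp del: index_mult_mat(1))
    qed (use X'c Cc in auto)
    ultimately have "C * U' = U' * C" by (intro U'C Cc)
    then have "(C * U') $$ (k, j) = (U' * C) $$ (k, j)" by simp
    then show False using kj nz ne U'c by (simp add: C_def del: index_mult_mat(1))
  qed
  define q where "q = inv_into UNIV p"
  have qd: "q j < d" if "j < d" for j
    using that permutes_in_image[OF permutes_inv[OF p], of j] by (simp add: q_def)
  have pq: "p (q i) = i" and qp: "q (p i) = i" for i
    using permutes_inverses[OF p] by (simp_all add: q_def)
  define U where "U = mat d d (\<lambda>(i, j). U' $$ (q i, j))"
  have Uc: "U \<in> carrier_mat d d" by (simp add: U_def)
  have UU': "U' = mat d d (\<lambda>(k, j). U $$ (p k, j))"
    using U'c pd qp by (intro eq_matI) (auto simp: U_def)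
  have "mat_adjoint U * U = mat_adjoint U' * U'"
  proof (rule eq_matI)
    fix i j assume "i < dim_row (mat_adjoint U' * U')" "j < dim_col (mat_adjoint U' * U')"
    then have ij: "i < d" "j < d" using U'c by auto
    have "(mat_adjoint U * U) $$ (i, j) = (\<Sum>k<d. cnj (U $$ (k, i)) * U $$ (k, j))"
      using ij Uc by (simp add: scalar_prod_def lessThan_atLeast0)
    also have "\<dots> = (\<Sum>k<d. cnj (U $$ (p k, i)) * U $$ (p k, j))"
      using sum.permute[OF p, of "\<lambda>k. cnj (U $$ (k, i)) * U $$ (k, j)"] by (simp add: o_def)
    also have "\<dots> = (mat_adjoint U' * U') $$ (i, j)"
      using ij by (simp add: UU' scalar_prod_def lessThan_atLeast0)
    finally show "(mat_adjoint U * U) $$ (i, j) = (mat_adjoint U' * U') $$ (i, j)" .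
  qed (use Uc U'c in auto)
  then have U: "U \<in> unitaries d"
    using U'(1) by (intro unitariesI Uc) (simp add: unitaries_iff)
  have froX': "fro X' = fro X" unfolding X'_def by (rule froperm[OF Xc])
  have "X' - U' = mat d d (\<lambda>(k, j). (X - U) $$ (p k, j))"
    unfolding X'_def by (subst UU') (use Xc Uc pd in \<open>auto intro!: eq_matI\<close>)
  then have "fro (X' - U') = fro (X - U)" using minus_carrier_mat[OF Uc, of X] by (simp add: froperm)
  then have XU: "fnorm (X - U) \<le> sqrt (d - fro X) + e" using U'(2) froX' by (simp add: fnorm_def)
  have "fro (T - X) = ?bad"
    using Tc by (auto simp: fro_def X_def block_part_def intro!: sum.cong)
  moreover have "fro T = fro X + ?bad"
  proof -
    have "fro X = (\<Sum>i<d. \<Sum>j<d. if a i = b j then (cmod (T $$ (i, j)))\<^sup>2 else 0)"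
      by (auto simp: fro_def X_def block_part_def intro!: sum.cong)
    moreover have "fro T = (\<Sum>i<d. \<Sum>j<d. (cmod (T $$ (i, j)))\<^sup>2)" using Tc by (simp add: fro_def)
    ultimately show ?thesis
      by (simp only: sum.distrib[symmetric]) (intro sum.cong refl, simp)
  qed
  ultimately have "fnorm (T - X) = sqrt ?bad" "d - fro X = ?bad"
    using fro_unitary[OF T] by (simp_all add: fnorm_def)
  then have "fnorm (T - U) \<le> 2 * sqrt ?bad + e"
    using fnorm_diff_triangle[OF Tc Xc Uc] XU by simp
  moreover have "a i = b j" if "i < d" "j < d" "U $$ (i, j) \<noteq> 0" for i j
    using U'block[of "q i" j] that qd bp[of "q i"] pq by (simp add: U_def)
  ultimately show ?thesis by (rule that[OF U])
qed

section \<open>Rounding almost representations of elementary abelian 2-groups\<close>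

definition symdiff :: "'a set \<Rightarrow> 'a set \<Rightarrow> 'a set" where
  "symdiff x y = (x - y) \<union> (y - x)"

text \<open>The characters of the group of subsets of \<open>I\<close> under symmetric difference; \<open>x\<close> names the
  character and \<open>g\<close> the group element.\<close>

definition chi :: "'a set \<Rightarrow> 'a set \<Rightarrow> 'a set \<Rightarrow> real" where
  "chi I x g = (\<Prod>i\<in>I. if i \<in> x \<inter> g then -1 else 1)"

lemma chi_commute: "chi I x g = chi I g x"
  by (simp add: chi_def Int_commute)

lemma chi_symdiff: "chi I x (symdiff g h) = chi I x g * chi I x h"
  unfolding chi_def prod.distrib[symmetric] by (intro prod.cong) (auto simp: symdiff_def)

lemma chi_cases: "chi I x g = 1 \<or> chi I x g = -1"
  unfolding chi_def by (induction I rule: infinite_finite_induct) auto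

lemma chi_square [simp]: "chi I x g * chi I x g = 1"
  using chi_cases[of I x g] by auto

lemma abs_chi [simp]: "\<bar>chi I x g\<bar> = 1"
  using chi_cases[of I x g] by auto

lemma chi_single:
  assumes "finite I" "i \<in> I"
  shows "chi I x {i} = (if i \<in> x then -1 else 1)"
  unfolding chi_def using assms by (subst prod.remove[of I i]) (auto intro!: prod.neutral)

text \<open>Toggling an element of \<open>g\<close> in \<open>x\<close> flips the sign of the character.\<close>

lemma sum_chi:
  assumes I: "finite I" and g: "g \<subseteq> I"
  shows "(\<Sum>x\<in>Pow I. chi I x g) = (if g = {} then card (Pow I) else 0)"
proof (cases "g = {}")
  case True
  then show ?thesis by (simp add: chi_def)
next
  case False
  then obtain i where i: "i \<in> g" "i \<in> I" using g by blast
  have "symdiff (symdiff x {i}) {i} = x" for x by (auto simp: symdiff_def)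
  moreover have "symdiff x {i} \<subseteq> I" if "x \<subseteq> I" for x using that i by (auto simp: symdiff_def)
  ultimately have "(\<Sum>x\<in>Pow I. chi I x g) = (\<Sum>x\<in>Pow I. chi I (symdiff x {i}) g)"
    by (intro sum.reindex_bij_witness[of _ "\<lambda>x. symdiff x {i}" "\<lambda>x. symdiff x {i}"]) simp_all
  also have "\<dots> = (\<Sum>x\<in>Pow I. - chi I x g)"
    using chi_single[OF I i(2), of g] i
    by (intro sum.cong refl) (subst chi_commute, simp add: chi_symdiff, subst chi_commute, simp)
  finally show ?thesis using False by (simp add: sum_negf)
qed

lemma chi_parseval:
  fixes m :: "'a set \<Rightarrow> complex"
  assumes I: "finite I"
  shows "(\<Sum>x\<in>Pow I. (cmod (\<Sum>g\<in>Pow I. chi I x g * m g))\<^sup>2) = card (Pow I) * (\<Sum>g\<in>Pow I. (cmod (m g))\<^sup>2)"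
proof -
  have "complex_of_real (\<Sum>x\<in>Pow I. (cmod (\<Sum>g\<in>Pow I. chi I x g * m g))\<^sup>2)
      = (\<Sum>x\<in>Pow I. \<Sum>g\<in>Pow I. \<Sum>h\<in>Pow I. complex_of_real (chi I x (symdiff g h)) * (m g * cnj (m h)))"
    unfolding of_real_sum complex_norm_square cnj_sum sum_product
    by (intro sum.cong refl) (simp add: chi_symdiff mult_ac)
  also have "\<dots> = (\<Sum>g\<in>Pow I. \<Sum>h\<in>Pow I. complex_of_real (\<Sum>x\<in>Pow I. chi I x (symdiff g h)) * (m g * cnj (m h)))"
    unfolding of_real_sum sum_distrib_right
    by (rule trans[OF sum.swap], rule sum.cong[OF refl], rule sum.swap)
  also have "\<dots> = (\<Sum>g\<in>Pow I. \<Sum>h\<in>Pow I. if h = g then complex_of_real (card (Pow I)) * (m g * cnj (m g)) else 0)"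
  proof (intro sum.cong refl)
    fix g h assume gh: "g \<in> Pow I" "h \<in> Pow I"
    then have "symdiff g h \<subseteq> I" by (auto simp: symdiff_def)
    moreover have "symdiff g h = {} \<longleftrightarrow> h = g" by (auto simp: symdiff_def)
    ultimately show "complex_of_real (\<Sum>x\<in>Pow I. chi I x (symdiff g h)) * (m g * cnj (m h))
        = (if h = g then complex_of_real (card (Pow I)) * (m g * cnj (m g)) else 0)"
      using sum_chi[OF I, of "symdiff g h"] by simp
  qed
  also have "\<dots> = complex_of_real (card (Pow I) * (\<Sum>g\<in>Pow I. (cmod (m g))\<^sup>2))"
    using I by (simp add: complex_norm_square[unfolded of_real_power] sum_distrib_left)
  finally show ?thesis by (simp only: of_real_eq_iff)
qed

text \<open>Averages are defined entrywise because matrices of variable size form no additive monoid.\<close>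

definition mat_avg :: "nat \<Rightarrow> 'b set \<Rightarrow> ('b \<Rightarrow> complex mat) \<Rightarrow> complex mat" where
  "mat_avg d P F = mat d d (\<lambda>(i, j). (\<Sum>g\<in>P. F g $$ (i, j)) / card P)"

lemma mat_avg_carrier [simp]: "mat_avg d P F \<in> carrier_mat d d"
  by (simp add: mat_avg_def)

lemma mat_avg_dim [simp]: "dim_row (mat_avg d P F) = d" "dim_col (mat_avg d P F) = d"
  by (simp_all add: mat_avg_def)

lemma mat_avg_cong: "(\<And>g. g \<in> P \<Longrightarrow> F g = G g) \<Longrightarrow> mat_avg d P F = mat_avg d P G"
  by (simp add: mat_avg_def)

lemma mat_avg_mult_right:
  assumes B: "B \<in> carrier_mat d d" and F: "\<And>g. g \<in> P \<Longrightarrow> F g \<in> carrier_mat d d"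
  shows "mat_avg d P F * B = mat_avg d P (\<lambda>g. F g * B)"
proof (rule eq_matI)
  fix i j assume "i < dim_row (mat_avg d P (\<lambda>g. F g * B))" "j < dim_col (mat_avg d P (\<lambda>g. F g * B))"
  then have ij: "i < d" "j < d" by auto
  have "(mat_avg d P F * B) $$ (i, j) = (\<Sum>k<d. (\<Sum>g\<in>P. F g $$ (i, k)) / card P * B $$ (k, j))"
    using ij B by (simp add: mat_avg_def scalar_prod_def lessThan_atLeast0)
  also have "\<dots> = (\<Sum>k<d. \<Sum>g\<in>P. F g $$ (i, k) * B $$ (k, j)) / card P"
    by (simp add: sum_divide_distrib sum_distrib_right)
  also have "(\<Sum>k<d. \<Sum>g\<in>P. F g $$ (i, k) * B $$ (k, j)) = (\<Sum>g\<in>P. \<Sum>k<d. F g $$ (i, k) * B $$ (k, j))"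
    by (rule sum.swap)
  also have "\<dots> = (\<Sum>g\<in>P. (F g * B) $$ (i, j))"
    using ij B carrier_matD[OF F] by (intro sum.cong) (simp_all add: scalar_prod_def lessThan_atLeast0)
  finally show "(mat_avg d P F * B) $$ (i, j) = mat_avg d P (\<lambda>g. F g * B) $$ (i, j)"
    using ij by (simp add: mat_avg_def)
qed (use B in auto)

lemma mat_avg_mult_left:
  assumes B: "B \<in> carrier_mat d d" and F: "\<And>g. g \<in> P \<Longrightarrow> F g \<in> carrier_mat d d"
  shows "B * mat_avg d P F = mat_avg d P (\<lambda>g. B * F g)"
proof (rule eq_matI)
  fix i j assume "i < dim_row (mat_avg d P (\<lambda>g. B * F g))" "j < dim_col (mat_avg d P (\<lambda>g. B * F g))"
  then have ij: "i < d" "j < d" by auto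
  have "(B * mat_avg d P F) $$ (i, j) = (\<Sum>k<d. B $$ (i, k) * ((\<Sum>g\<in>P. F g $$ (k, j)) / card P))"
    using ij B by (simp add: mat_avg_def scalar_prod_def lessThan_atLeast0)
  also have "\<dots> = (\<Sum>k<d. \<Sum>g\<in>P. B $$ (i, k) * F g $$ (k, j)) / card P"
    by (simp add: sum_divide_distrib sum_distrib_left)
  also have "(\<Sum>k<d. \<Sum>g\<in>P. B $$ (i, k) * F g $$ (k, j)) = (\<Sum>g\<in>P. \<Sum>k<d. B $$ (i, k) * F g $$ (k, j))"
    by (rule sum.swap)
  also have "\<dots> = (\<Sum>g\<in>P. (B * F g) $$ (i, j))"
    using ij B carrier_matD[OF F] by (intro sum.cong) (simp_all add: scalar_prod_def lessThan_atLeast0)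
  finally show "(B * mat_avg d P F) $$ (i, j) = mat_avg d P (\<lambda>g. B * F g) $$ (i, j)"
    using ij by (simp add: mat_avg_def)
qed (use B in auto)

lemma mat_avg_diff:
  assumes "\<And>g. g \<in> P \<Longrightarrow> F g \<in> carrier_mat d d" "\<And>g. g \<in> P \<Longrightarrow> G g \<in> carrier_mat d d"
  shows "mat_avg d P F - mat_avg d P G = mat_avg d P (\<lambda>g. F g - G g)"
  using carrier_matD[OF assms(2)]
  by (intro eq_matI) (simp_all add: mat_avg_def diff_divide_distrib[symmetric] sum_subtractf[symmetric])

lemma mat_avg_const:
  assumes "finite P" "P \<noteq> {}" "B \<in> carrier_mat d d"
  shows "mat_avg d P (\<lambda>_. B) = B"
  using assms by (intro eq_matI) (simp_all add: mat_avg_def)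

lemma mat_avg_adjoint:
  assumes "\<And>g. g \<in> P \<Longrightarrow> F g \<in> carrier_mat d d"
  shows "mat_adjoint (mat_avg d P F) = mat_avg d P (\<lambda>g. mat_adjoint (F g))"
  using carrier_matD[OF assms] by (intro eq_matI) (simp_all add: mat_avg_def)

lemma mat_avg_smult:
  assumes "\<And>g. g \<in> P \<Longrightarrow> F g \<in> carrier_mat d d"
  shows "c \<cdot>\<^sub>m mat_avg d P F = mat_avg d P (\<lambda>g. c \<cdot>\<^sub>m F g)"
  using carrier_matD[OF assms] by (intro eq_matI) (simp_all add: mat_avg_def sum_distrib_left)

lemma sum_square_le:
  fixes f :: "'b \<Rightarrow> real"
  shows "(\<Sum>g\<in>P. \<bar>f g\<bar>)\<^sup>2 \<le> card P * (\<Sum>g\<in>P. (f g)\<^sup>2)"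
proof -
  have "(\<Sum>g\<in>P. \<bar>f g\<bar>) \<le> L2_set f P * L2_set (\<lambda>_. 1) P"
    using L2_set_mult_ineq[of f "\<lambda>_. 1" P] by simp
  then have "(\<Sum>g\<in>P. \<bar>f g\<bar>)\<^sup>2 \<le> (L2_set f P * L2_set (\<lambda>_. 1) P)\<^sup>2"
    by (intro power_mono sum_nonneg) auto
  also have "\<dots> = card P * (\<Sum>g\<in>P. (f g)\<^sup>2)"
    by (simp add: L2_set_def power_mult_distrib sum_nonneg)
  finally show ?thesis .
qed

lemma fro_mat_avg_le:
  assumes P: "finite P" and F: "\<And>g. g \<in> P \<Longrightarrow> F g \<in> carrier_mat d d"
  shows "fro (mat_avg d P F) \<le> (\<Sum>g\<in>P. fro (F g)) / card P"
proof -
  have e: "(cmod (mat_avg d P F $$ (i, j)))\<^sup>2 \<le> (\<Sum>g\<in>P. (cmod (F g $$ (i, j)))\<^sup>2) / card P"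
    if "i < d" "j < d" for i j
  proof (cases "P = {}")
    case True
    then show ?thesis using that by (simp add: mat_avg_def)
  next
    case False
    have "(cmod (\<Sum>g\<in>P. F g $$ (i, j)))\<^sup>2 \<le> (\<Sum>g\<in>P. \<bar>cmod (F g $$ (i, j))\<bar>)\<^sup>2"
      by (intro power_mono) (auto intro: norm_sum)
    also have "\<dots> \<le> card P * (\<Sum>g\<in>P. (cmod (F g $$ (i, j)))\<^sup>2)" by (rule sum_square_le)
    finally have "(cmod (\<Sum>g\<in>P. F g $$ (i, j)))\<^sup>2 / (card P)\<^sup>2
        \<le> card P * (\<Sum>g\<in>P. (cmod (F g $$ (i, j)))\<^sup>2) / (card P)\<^sup>2"
      by (intro divide_right_mono) auto
    also have "\<dots> = (\<Sum>g\<in>P. (cmod (F g $$ (i, j)))\<^sup>2) / card P"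
      using False P by (simp add: power2_eq_square)
    finally show ?thesis using that by (simp add: mat_avg_def norm_divide power_divide)
  qed
  have "fro (mat_avg d P F) \<le> (\<Sum>i<d. \<Sum>j<d. (\<Sum>g\<in>P. (cmod (F g $$ (i, j)))\<^sup>2) / card P)"
    unfolding fro_def mat_avg_dim by (intro sum_mono e) auto
  also have "\<dots> = (\<Sum>i<d. \<Sum>j<d. \<Sum>g\<in>P. (cmod (F g $$ (i, j)))\<^sup>2) / card P"
    by (simp add: sum_divide_distrib)
  also have "(\<Sum>i<d. \<Sum>j<d. \<Sum>g\<in>P. (cmod (F g $$ (i, j)))\<^sup>2) = (\<Sum>i<d. \<Sum>g\<in>P. \<Sum>j<d. (cmod (F g $$ (i, j)))\<^sup>2)"
    by (rule sum.cong[OF refl], rule sum.swap)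
  also have "\<dots> = (\<Sum>g\<in>P. fro (F g))"
    using F by (subst sum.swap) (auto simp: fro_def intro!: sum.cong)
  finally show ?thesis .
qed

lemma mat_avg_parseval:
  assumes I: "finite I" and F: "\<And>g. g \<in> Pow I \<Longrightarrow> F g \<in> carrier_mat d d"
  shows "(\<Sum>x\<in>Pow I. fro (mat_avg d (Pow I) (\<lambda>g. complex_of_real (chi I x g) \<cdot>\<^sub>m F g)))
    = (\<Sum>g\<in>Pow I. fro (F g)) / card (Pow I)"
proof -
  let ?P = "Pow I"
  have N: "real (card ?P) \<noteq> 0" using I by (simp add: card_Pow)
  have swap3: "(\<Sum>x\<in>?P. \<Sum>i<d. \<Sum>j<d. f x i j) = (\<Sum>i<d. \<Sum>j<d. \<Sum>x\<in>?P. f x i j)"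
    for f :: "'a set \<Rightarrow> nat \<Rightarrow> nat \<Rightarrow> real"
    by (rule trans[OF sum.swap], rule sum.cong[OF refl], rule sum.swap)
  have "(\<Sum>x\<in>?P. fro (mat_avg d ?P (\<lambda>g. complex_of_real (chi I x g) \<cdot>\<^sub>m F g)))
      = (\<Sum>x\<in>?P. \<Sum>i<d. \<Sum>j<d. (cmod (\<Sum>g\<in>?P. chi I x g * F g $$ (i, j)))\<^sup>2 / (card ?P)\<^sup>2)"
  proof (intro sum.cong refl)
    fix x
    have "(cmod (mat_avg d ?P (\<lambda>g. complex_of_real (chi I x g) \<cdot>\<^sub>m F g) $$ (i, j)))\<^sup>2
        = (cmod (\<Sum>g\<in>?P. chi I x g * F g $$ (i, j)))\<^sup>2 / (card ?P)\<^sup>2" if "i < d" "j < d" for i j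
    proof -
      have "(\<Sum>g\<in>?P. (complex_of_real (chi I x g) \<cdot>\<^sub>m F g) $$ (i, j)) = (\<Sum>g\<in>?P. chi I x g * F g $$ (i, j))"
        using that F by (intro sum.cong refl) (metis carrier_matD index_smult_mat(1))
      then show ?thesis using that by (simp add: mat_avg_def norm_divide power_divide)
    qed
    then show "fro (mat_avg d ?P (\<lambda>g. complex_of_real (chi I x g) \<cdot>\<^sub>m F g))
        = (\<Sum>i<d. \<Sum>j<d. (cmod (\<Sum>g\<in>?P. chi I x g * F g $$ (i, j)))\<^sup>2 / (card ?P)\<^sup>2)"
      unfolding fro_def mat_avg_dim by (intro sum.cong refl) auto
  qed
  also have "\<dots> = (\<Sum>i<d. \<Sum>j<d. (\<Sum>x\<in>?P. (cmod (\<Sum>g\<in>?P. chi I x g * F g $$ (i, j)))\<^sup>2) / (card ?P)\<^sup>2)"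
    unfolding swap3 by (simp only: sum_divide_distrib)
  also have "\<dots> = (\<Sum>i<d. \<Sum>j<d. (\<Sum>g\<in>?P. (cmod (F g $$ (i, j)))\<^sup>2) / card ?P)"
    unfolding chi_parseval[OF I] using N by (simp add: power2_eq_square)
  also have "\<dots> = (\<Sum>i<d. \<Sum>j<d. \<Sum>g\<in>?P. (cmod (F g $$ (i, j)))\<^sup>2) / card ?P"
    by (simp only: sum_divide_distrib)
  also have "\<dots> = (\<Sum>g\<in>?P. fro (F g)) / card ?P"
    unfolding swap3[symmetric] using F by (auto simp: fro_def intro!: sum.cong arg_cong2[of _ _ _ _ "(/)"])
  finally show ?thesis .
qed

lemma mat_avg_reindex:
  assumes "bij_betw f P P"
  shows "mat_avg d P F = mat_avg d P (\<lambda>g. F (f g))"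
  using sum.reindex_bij_betw[OF assms, of "\<lambda>g. F g $$ (i, j)" for i j]
  by (simp add: mat_avg_def cong: prod.case_cong)

lemma fro_minus_commute:
  assumes "A \<in> carrier_mat m n" "B \<in> carrier_mat m n"
  shows "fro (A - B) = fro (B - A)"
  using fnorm_minus_commute[OF assms] by (simp add: fnorm_def)

lemma fro_row_selection_le:
  fixes M :: "'b \<Rightarrow> complex mat"
  assumes P: "finite P" and M: "\<And>x. x \<in> P \<Longrightarrow> M x \<in> carrier_mat d d"
    and e: "inj_on e {..<d}" "e ` {..<d} \<subseteq> P \<times> {..<d}"
  shows "fro (mat d d (\<lambda>(i, j). M (fst (e i)) $$ (snd (e i), j))) \<le> (\<Sum>x\<in>P. fro (M x))"
proof -
  let ?f = "\<lambda>p. \<Sum>j<d. (cmod (M (fst p) $$ (snd p, j)))\<^sup>2"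
  have "fro (mat d d (\<lambda>(i, j). M (fst (e i)) $$ (snd (e i), j))) = (\<Sum>i<d. ?f (e i))"
    by (simp add: fro_def)
  also have "\<dots> = sum ?f (e ` {..<d})" using sum.reindex[OF e(1), of ?f] by (simp add: o_def)
  also have "\<dots> \<le> sum ?f (P \<times> {..<d})"
    by (rule sum_mono2) (use e(2) P in \<open>auto intro: sum_nonneg\<close>)
  also have "\<dots> = (\<Sum>x\<in>P. \<Sum>k<d. \<Sum>j<d. (cmod (M x $$ (k, j)))\<^sup>2)"
    by (simp only: sum.cartesian_product' fst_conv snd_conv)
  also have "\<dots> = (\<Sum>x\<in>P. fro (M x))"
    using carrier_matD[OF M] by (intro sum.cong refl) (simp add: fro_def)
  finally show ?thesis .
qed

text \<open>The coefficients \<open>K x\<close> imitate the projections onto the isotypic components. All three facts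
  are instances of Parseval's identity: the first expresses that \<open>x \<mapsto> K x B\<close> is isometric, the
  second that \<open>K x\<close> nearly intertwines \<open>\<Phi> h\<close> with the character value, and averaging the second over
  the group gives the third, that \<open>K x\<close> is nearly a projection.\<close>

lemma fourier_coefficients:
  fixes I :: "'a set" and \<Phi> :: "'a set \<Rightarrow> complex mat" and d :: nat
  defines "K \<equiv> \<lambda>x. mat_avg d (Pow I) (\<lambda>g. complex_of_real (chi I x g) \<cdot>\<^sub>m \<Phi> g)"
  assumes I: "finite I" and \<Phi>: "\<And>g. g \<subseteq> I \<Longrightarrow> \<Phi> g \<in> unitaries d"
    and mult: "\<And>g h. g \<subseteq> I \<Longrightarrow> h \<subseteq> I \<Longrightarrow> fnorm (\<Phi> (symdiff g h) - \<Phi> g * \<Phi> h) \<le> D" and D: "0 \<le> D"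
  shows "\<And>B. B \<in> carrier_mat d d \<Longrightarrow> (\<Sum>x\<in>Pow I. fro (K x * B)) = fro B"
    and "\<And>h. h \<subseteq> I \<Longrightarrow> (\<Sum>x\<in>Pow I. fro (K x * \<Phi> h - complex_of_real (chi I x h) \<cdot>\<^sub>m K x)) \<le> D\<^sup>2"
    and "(\<Sum>x\<in>Pow I. fro (K x * mat_adjoint (K x) - K x)) \<le> D\<^sup>2"
proof -
  let ?P = "Pow I"
  let ?c = "\<lambda>x g. complex_of_real (chi I x g)"
  have fP: "finite ?P" using I by simp
  have N: "real (card ?P) > 0" using I by (simp add: card_Pow)
  have \<Phi>c: "\<Phi> g \<in> carrier_mat d d" if "g \<in> ?P" for g using \<Phi>[of g] that by (simp add: unitaries_iff)
  have Kc: "K x \<in> carrier_mat d d" for x by (simp add: K_def)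
  have KB: "K x * B = mat_avg d ?P (\<lambda>g. ?c x g \<cdot>\<^sub>m (\<Phi> g * B))" if B: "B \<in> carrier_mat d d" for x B
  proof -
    have "K x * B = mat_avg d ?P (\<lambda>g. (?c x g \<cdot>\<^sub>m \<Phi> g) * B)"
      unfolding K_def using B \<Phi>c by (intro mat_avg_mult_right) simp_all
    also have "\<dots> = mat_avg d ?P (\<lambda>g. ?c x g \<cdot>\<^sub>m (\<Phi> g * B))"
      using B \<Phi>c by (intro mat_avg_cong mult_smult_assoc_mat[of _ d d _ d]) simp_all
    finally show ?thesis .
  qed
  show *: "(\<Sum>x\<in>?P. fro (K x * B)) = fro B" if B: "B \<in> carrier_mat d d" for B
  proof -
    have "(\<Sum>x\<in>?P. fro (K x * B)) = (\<Sum>g\<in>?P. fro (\<Phi> g * B)) / card ?P"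
      unfolding KB[OF B] using B \<Phi>c by (intro mat_avg_parseval I) simp
    also have "(\<Sum>g\<in>?P. fro (\<Phi> g * B)) = (\<Sum>g\<in>?P. fro B)"
      using B \<Phi> by (intro sum.cong refl fro_unitary_left[of _ d]) simp_all
    finally show ?thesis using N by simp
  qed
  show **: "(\<Sum>x\<in>?P. fro (K x * \<Phi> h - ?c x h \<cdot>\<^sub>m K x)) \<le> D\<^sup>2" if h: "h \<subseteq> I" for h
  proof -
    have sdP: "symdiff g h \<in> ?P" if "g \<in> ?P" for g using that h by (auto simp: symdiff_def)
    have ss: "symdiff (symdiff g h) h = g" for g by (auto simp: symdiff_def)
    have bij: "bij_betw (\<lambda>g. symdiff g h) ?P ?P"
      by (rule bij_betw_byWitness[of _ "\<lambda>g. symdiff g h"]) (use sdP ss in auto)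
    have eq: "K x * \<Phi> h - ?c x h \<cdot>\<^sub>m K x = mat_avg d ?P (\<lambda>g. ?c x g \<cdot>\<^sub>m (\<Phi> g * \<Phi> h - \<Phi> (symdiff g h)))" for x
    proof -
      have "?c x h \<cdot>\<^sub>m K x = mat_avg d ?P (\<lambda>g. ?c x h \<cdot>\<^sub>m (?c x g \<cdot>\<^sub>m \<Phi> g))"
        unfolding K_def using \<Phi>c by (intro mat_avg_smult) simp
      also have "\<dots> = mat_avg d ?P (\<lambda>g. ?c x h \<cdot>\<^sub>m (?c x (symdiff g h) \<cdot>\<^sub>m \<Phi> (symdiff g h)))"
        by (rule mat_avg_reindex[OF bij])
      also have "\<dots> = mat_avg d ?P (\<lambda>g. ?c x g \<cdot>\<^sub>m \<Phi> (symdiff g h))"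
      proof (rule mat_avg_cong)
        fix g
        have "chi I x h * chi I x (symdiff g h) = chi I x g" by (simp add: chi_symdiff mult.left_commute)
        then show "?c x h \<cdot>\<^sub>m (?c x (symdiff g h) \<cdot>\<^sub>m \<Phi> (symdiff g h)) = ?c x g \<cdot>\<^sub>m \<Phi> (symdiff g h)"
          by (intro eq_matI) (simp_all add: mult.assoc[symmetric] flip: of_real_mult)
      qed
      finally have "K x * \<Phi> h - ?c x h \<cdot>\<^sub>m K x
          = mat_avg d ?P (\<lambda>g. ?c x g \<cdot>\<^sub>m (\<Phi> g * \<Phi> h)) - mat_avg d ?P (\<lambda>g. ?c x g \<cdot>\<^sub>m \<Phi> (symdiff g h))"
        using KB[of "\<Phi> h" x] h \<Phi>c by simp
      also have "\<dots> = mat_avg d ?P (\<lambda>g. ?c x g \<cdot>\<^sub>m (\<Phi> g * \<Phi> h) - ?c x g \<cdot>\<^sub>m \<Phi> (symdiff g h))"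
        using h \<Phi>c sdP by (intro mat_avg_diff) simp_all
      also have "\<dots> = mat_avg d ?P (\<lambda>g. ?c x g \<cdot>\<^sub>m (\<Phi> g * \<Phi> h - \<Phi> (symdiff g h)))"
      proof (rule mat_avg_cong)
        fix g assume g: "g \<in> ?P"
        show "?c x g \<cdot>\<^sub>m (\<Phi> g * \<Phi> h) - ?c x g \<cdot>\<^sub>m \<Phi> (symdiff g h) = ?c x g \<cdot>\<^sub>m (\<Phi> g * \<Phi> h - \<Phi> (symdiff g h))"
          using carrier_matD[OF \<Phi>c[OF g]] carrier_matD[OF \<Phi>c[OF sdP[OF g]]] carrier_matD[OF \<Phi>c[of h]] h
          by (intro eq_matI) (simp_all add: right_diff_distrib)
      qed
      finally show ?thesis .
    qed
    have "(\<Sum>x\<in>?P. fro (K x * \<Phi> h - ?c x h \<cdot>\<^sub>m K x)) = (\<Sum>g\<in>?P. fro (\<Phi> g * \<Phi> h - \<Phi> (symdiff g h))) / card ?P"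
      unfolding eq using \<Phi>c sdP h by (intro mat_avg_parseval I minus_carrier_mat) simp
    also have "\<dots> \<le> (\<Sum>g\<in>?P. D\<^sup>2) / card ?P"
    proof (intro divide_right_mono sum_mono)
      fix g assume g: "g \<in> ?P"
      have "fro (\<Phi> g * \<Phi> h - \<Phi> (symdiff g h)) = fro (\<Phi> (symdiff g h) - \<Phi> g * \<Phi> h)"
        using \<Phi>c[OF g] \<Phi>c[of h] h \<Phi>c[OF sdP[OF g]] by (intro fro_minus_commute[of _ d d]) simp_all
      also have "\<dots> = (fnorm (\<Phi> (symdiff g h) - \<Phi> g * \<Phi> h))\<^sup>2" by simp
      also have "\<dots> \<le> D\<^sup>2" using mult[of g h] g h by (intro power_mono) simp_all
      finally show "fro (\<Phi> g * \<Phi> h - \<Phi> (symdiff g h)) \<le> D\<^sup>2" .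
    qed simp
    also have "\<dots> = D\<^sup>2" using N by simp
    finally show ?thesis .
  qed
  show "(\<Sum>x\<in>?P. fro (K x * mat_adjoint (K x) - K x)) \<le> D\<^sup>2"
  proof -
    have le: "fro (K x * mat_adjoint (K x) - K x) \<le> (\<Sum>g\<in>?P. fro (K x * \<Phi> g - ?c x g \<cdot>\<^sub>m K x)) / card ?P" for x
    proof -
      have ac: "mat_adjoint (\<Phi> g) \<in> carrier_mat d d" if "g \<in> ?P" for g using \<Phi>c[OF that] by simp
      have "mat_adjoint (K x) = mat_avg d ?P (\<lambda>g. mat_adjoint (?c x g \<cdot>\<^sub>m \<Phi> g))"
        unfolding K_def using \<Phi>c by (intro mat_avg_adjoint) simp
      then have "K x * mat_adjoint (K x) = mat_avg d ?P (\<lambda>g. K x * mat_adjoint (?c x g \<cdot>\<^sub>m \<Phi> g))"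
        using \<Phi>c by (simp only:) (intro mat_avg_mult_left Kc mat_adjoint_carrier, simp)
      moreover have "mat_avg d ?P (\<lambda>_. K x) = K x"
        using fP Kc by (intro mat_avg_const) auto
      ultimately have "K x * mat_adjoint (K x) - K x
          = mat_avg d ?P (\<lambda>g. K x * mat_adjoint (?c x g \<cdot>\<^sub>m \<Phi> g)) - mat_avg d ?P (\<lambda>_. K x)" by simp
      also have "\<dots> = mat_avg d ?P (\<lambda>g. K x * mat_adjoint (?c x g \<cdot>\<^sub>m \<Phi> g) - K x)"
        using Kc \<Phi>c by (intro mat_avg_diff mult_square_carrier mat_adjoint_carrier) simp_all
      finally have "fro (K x * mat_adjoint (K x) - K x)
          \<le> (\<Sum>g\<in>?P. fro (K x * mat_adjoint (?c x g \<cdot>\<^sub>m \<Phi> g) - K x)) / card ?P"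
        using fP Kc by (simp only:) (intro fro_mat_avg_le minus_carrier_mat, simp_all)
      also have "(\<Sum>g\<in>?P. fro (K x * mat_adjoint (?c x g \<cdot>\<^sub>m \<Phi> g) - K x))
          = (\<Sum>g\<in>?P. fro (K x * \<Phi> g - ?c x g \<cdot>\<^sub>m K x))"
      proof (intro sum.cong refl)
        fix g assume g: "g \<in> ?P"
        have U: "\<Phi> g \<in> unitaries d" using \<Phi>[of g] g by simp
        have "mat_adjoint (?c x g \<cdot>\<^sub>m \<Phi> g) = ?c x g \<cdot>\<^sub>m mat_adjoint (\<Phi> g)"
          using carrier_matD[OF \<Phi>c[OF g]] by (intro eq_matI) simp_all
        then have "K x * mat_adjoint (?c x g \<cdot>\<^sub>m \<Phi> g) = ?c x g \<cdot>\<^sub>m (K x * mat_adjoint (\<Phi> g))"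
          using Kc ac[OF g] by (simp add: mult_smult_distrib[of _ d d _ d])
        then have "(K x * mat_adjoint (?c x g \<cdot>\<^sub>m \<Phi> g) - K x) * \<Phi> g
            = ?c x g \<cdot>\<^sub>m (K x * mat_adjoint (\<Phi> g)) * \<Phi> g - K x * \<Phi> g"
          using Kc ac[OF g] \<Phi>c[OF g] by (simp add: minus_mult_distrib_mat[of _ d d _ _ d])
        also have "?c x g \<cdot>\<^sub>m (K x * mat_adjoint (\<Phi> g)) * \<Phi> g = ?c x g \<cdot>\<^sub>m K x"
          using Kc ac[OF g] \<Phi>c[OF g]
          by (simp add: mult_smult_assoc_mat[of _ d d _ d] adjoint_cancel_right(2)[OF U Kc])
        finally have eq: "(K x * mat_adjoint (?c x g \<cdot>\<^sub>m \<Phi> g) - K x) * \<Phi> g = ?c x g \<cdot>\<^sub>m K x - K x * \<Phi> g" .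
        have "fro (K x * mat_adjoint (?c x g \<cdot>\<^sub>m \<Phi> g) - K x)
            = fro ((K x * mat_adjoint (?c x g \<cdot>\<^sub>m \<Phi> g) - K x) * \<Phi> g)"
          by (rule fro_unitary_right[OF U minus_carrier_mat[OF Kc], symmetric])
        also have "\<dots> = fro (K x * \<Phi> g - ?c x g \<cdot>\<^sub>m K x)"
          unfolding eq using Kc \<Phi>c[OF g] by (intro fro_minus_commute[of _ d d]) simp_all
        finally show "fro (K x * mat_adjoint (?c x g \<cdot>\<^sub>m \<Phi> g) - K x) = fro (K x * \<Phi> g - ?c x g \<cdot>\<^sub>m K x)" .
      qed
      finally show ?thesis .
    qed
    have "(\<Sum>x\<in>?P. fro (K x * mat_adjoint (K x) - K x))
        \<le> (\<Sum>x\<in>?P. (\<Sum>g\<in>?P. fro (K x * \<Phi> g - ?c x g \<cdot>\<^sub>m K x)) / card ?P)"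
      by (intro sum_mono le)
    also have "\<dots> = (\<Sum>x\<in>?P. \<Sum>g\<in>?P. fro (K x * \<Phi> g - ?c x g \<cdot>\<^sub>m K x)) / card ?P"
      by (rule sum_divide_distrib[symmetric])
    also have "(\<Sum>x\<in>?P. \<Sum>g\<in>?P. fro (K x * \<Phi> g - ?c x g \<cdot>\<^sub>m K x))
        = (\<Sum>g\<in>?P. \<Sum>x\<in>?P. fro (K x * \<Phi> g - ?c x g \<cdot>\<^sub>m K x))" by (rule sum.swap)
    also have "\<dots> / card ?P \<le> (\<Sum>g\<in>?P. D\<^sup>2) / card ?P"
      using ** by (intro divide_right_mono sum_mono) simp_all
    also have "\<dots> = D\<^sup>2" using N by simp
    finally show ?thesis .
  qed
qed

text \<open>The map \<open>v \<mapsto> (K x v)\<^sub>x\<close> is an isometry into a direct sum of copies of \<open>\<complex>\<^sup>d\<close> that nearly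
  intertwines \<open>\<Phi>\<close> with the diagonal action by characters. Its range is close to a \<open>d\<close>-dimensional
  subspace spanned by eigenvectors of the operators \<open>K x (K x)\<^sup>*\<close>; projecting to that subspace gives
  a square contraction \<open>Y\<close> with \<open>fro Y\<close> nearly \<open>d\<close>, and \<open>U\<close> is a unitary near \<open>Y\<close>. Keeping the
  dimension exactly \<open>d\<close> is what the choice of the \<open>d\<close> largest eigenvalues achieves.\<close>

theorem elementary_abelian_rounding:
  fixes I :: "'a set" and \<Phi> :: "'a set \<Rightarrow> complex mat"
  assumes I: "finite I" and \<Phi>: "\<And>g. g \<subseteq> I \<Longrightarrow> \<Phi> g \<in> unitaries d"
    and mult: "\<And>g h. g \<subseteq> I \<Longrightarrow> h \<subseteq> I \<Longrightarrow> fnorm (\<Phi> (symdiff g h) - \<Phi> g * \<Phi> h) \<le> D" and D: "0 \<le> D"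
    and e: "0 < e"
  obtains U x where "U \<in> unitaries d"
    "\<And>g. g \<subseteq> I \<Longrightarrow> fnorm (U * \<Phi> g - diag d (\<lambda>i. complex_of_real (chi I (x i) g)) * U)
      \<le> 2 * sqrt (2 * D * sqrt d) + D + e"
proof -
  let ?P = "Pow I"
  let ?c = "\<lambda>x g. complex_of_real (chi I x g)"
  define K where "K x = mat_avg d ?P (\<lambda>g. ?c x g \<cdot>\<^sub>m \<Phi> g)" for x
  have K1: "K x * 1\<^sub>m d = K x" for x
    by (rule right_mult_one_mat[of _ d d]) (simp add: K_def)
  have fc1: "(\<Sum>x\<in>?P. fro (K x * B)) = fro B" if "B \<in> carrier_mat d d" for B
    unfolding K_def
    by (rule fourier_coefficients(1)[where \<Phi> = \<Phi> and D = D]) (use I \<Phi> mult D that in simp_all)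
  have fc2: "(\<Sum>x\<in>?P. fro (K x * \<Phi> h - ?c x h \<cdot>\<^sub>m K x)) \<le> D\<^sup>2" if "h \<subseteq> I" for h
    unfolding K_def
    by (rule fourier_coefficients(2)[where \<Phi> = \<Phi> and D = D]) (use I \<Phi> mult D that in simp_all)
  have fc3: "(\<Sum>x\<in>?P. fro (K x * mat_adjoint (K x) - K x)) \<le> D\<^sup>2"
    unfolding K_def
    by (rule fourier_coefficients(3)[where \<Phi> = \<Phi> and D = D]) (use I \<Phi> mult D in simp_all)
  have fP: "finite ?P" using I by simp
  have Kc: "K x \<in> carrier_mat d d" for x by (simp add: K_def)
  have "\<exists>W l. W \<in> unitaries d \<and> K x * mat_adjoint (K x)
      = W * diag d (\<lambda>i. complex_of_real (l i)) * mat_adjoint W" for x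
  proof -
    have "mat_adjoint (K x * mat_adjoint (K x)) = K x * mat_adjoint (K x)"
      using Kc[of x] by (simp add: mat_adjoint_mult[of _ d d _ d])
    then show ?thesis
      using hermitian_diagonalization[of "K x * mat_adjoint (K x)" d] Kc[of x]
      by (metis mult_square_carrier mat_adjoint_carrier)
  qed
  then obtain W l where W: "\<And>x. W x \<in> unitaries d"
    and KK: "\<And>x. K x * mat_adjoint (K x) = W x * diag d (\<lambda>i. complex_of_real (l x i)) * mat_adjoint (W x)"
    by metis
  have Wc: "W x \<in> carrier_mat d d" for x using W by auto
  define G where "G x = mat_adjoint (W x) * K x" for x
  have Gc: "G x \<in> carrier_mat d d" for x using Wc Kc by (simp add: G_def)
  have aW: "mat_adjoint (W x) \<in> unitaries d" for x by (rule unitaries_adjoint[OF W])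
  have GG: "mat_adjoint (mat_adjoint (G x)) * mat_adjoint (G x) = diag d (\<lambda>i. complex_of_real (l x i))" for x
  proof -
    have "G x * mat_adjoint (G x) = mat_adjoint (W x) * ((K x * mat_adjoint (K x)) * W x)"
      using Wc[of x] Kc[of x] by (simp add: G_def mat_adjoint_mult[of _ d d _ d] assoc_mult_mat[of _ d d _ d _ d])
    also have "\<dots> = diag d (\<lambda>i. complex_of_real (l x i))"
      unfolding KK using Wc[of x] W[of x]
      by (simp add: assoc_mult_mat[of _ d d _ d _ d] adjoint_cancel_left[OF W, where n = d])
        (simp add: unitaries_iff)
    finally show ?thesis by simp
  qed
  have froGd: "fro (mat_adjoint (G x) * diag d g) = (\<Sum>j<d. l x j * (cmod (g j))\<^sup>2)" for x g
    by (rule fro_mult_diag[OF _ GG]) (simp add: Gc)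
  have froGB: "fro (G x * B) = fro (K x * B)" if "B \<in> carrier_mat d d" for x B
    using that Wc[of x] Kc[of x] fro_unitary_left[OF aW, of "K x * B" d x]
    by (simp add: G_def assoc_mult_mat[of _ d d _ d _ d])
  have delta: "(\<Sum>j<d. f j * (cmod (if j = k then 1 else 0))\<^sup>2) = f k" if "k < d" for k and f :: "nat \<Rightarrow> real"
  proof -
    have "(\<Sum>j<d. f j * (cmod (if j = k then 1 else 0))\<^sup>2) = (\<Sum>j<d. if j = k then f k else 0)"
      by (intro sum.cong) auto
    then show ?thesis using that by simp
  qed
  have l01: "0 \<le> l x k \<and> l x k \<le> 1" if x: "x \<in> ?P" and k: "k < d" for x k
  proof -
    let ?E = "diag d (\<lambda>j. if j = k then 1 else 0)"
    let ?B = "mat_adjoint (G x) * ?E"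
    have Bc: "?B \<in> carrier_mat d d" using Gc by simp
    have B: "fro ?B = l x k" unfolding froGd by (rule delta[OF k])
    have "fro (G x * ?B) \<le> fro ?B"
    proof -
      have "fro (K x * ?B) \<le> (\<Sum>x\<in>?P. fro (K x * ?B))"
        by (rule member_le_sum[OF x]) (simp_all add: I)
      then show ?thesis using fc1[OF Bc] froGB[OF Bc] by simp
    qed
    moreover have "G x * ?B = diag d (\<lambda>j. complex_of_real (l x j) * (if j = k then 1 else 0))"
      using GG[of x] Gc[of x] by (simp add: diag_mult_diag flip: assoc_mult_mat[of _ d d _ d _ d])
    ultimately have "(\<Sum>j<d. (cmod (complex_of_real (l x j) * (if j = k then 1 else 0)))\<^sup>2) \<le> l x k"
      by (simp only: fro_diag B)
    moreover have "(\<Sum>j<d. (cmod (complex_of_real (l x j) * (if j = k then 1 else 0)))\<^sup>2)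
        = (\<Sum>j<d. (l x j)\<^sup>2 * (cmod (if j = k then 1 else 0))\<^sup>2)"
      by (intro sum.cong refl) (simp add: norm_mult power_mult_distrib)
    ultimately have sq: "(l x k)\<^sup>2 \<le> l x k" by (simp only: delta[OF k])
    have "0 \<le> l x k" by (simp flip: B)
    moreover have "l x k \<le> 1"
    proof (rule ccontr)
      assume "\<not> l x k \<le> 1"
      then have "1 * l x k < l x k * l x k" by (intro mult_strict_right_mono) auto
      then show False using sq by (simp add: power2_eq_square)
    qed
    ultimately show ?thesis ..
  qed
  let ?A = "?P \<times> {..<d}"
  let ?f = "\<lambda>(x, k). l x k"
  have one_sq: "(cmod 1)\<^sup>2 = 1" by simp
  have froG: "fro (mat_adjoint (G x)) = (\<Sum>k<d. l x k)" for x
    using froGd[of x "\<lambda>_. 1"] Gc[of x] by (simp add: diag_one)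
  have froGK: "fro (G x) = fro (K x)" for x
    unfolding G_def by (rule fro_unitary_left[OF aW Kc])
  have sumf: "sum ?f ?A = real d"
  proof -
    have "sum ?f ?A = (\<Sum>x\<in>?P. fro (K x))"
      unfolding sum.cartesian_product' using froG froGK by simp
    also have "\<dots> = (\<Sum>x\<in>?P. fro (K x * 1\<^sub>m d))" by (simp add: K1)
    finally show ?thesis using fc1[of "1\<^sub>m d"] by simp
  qed
  have sumf2: "real d - 2 * D * sqrt d \<le> (\<Sum>p\<in>?A. (?f p)\<^sup>2)"
  proof -
    have "fro (K x * mat_adjoint (K x)) = (\<Sum>k<d. (l x k)\<^sup>2)" for x
    proof -
      have "fro (K x * mat_adjoint (K x)) = fro (diag d (\<lambda>i. complex_of_real (l x i)))"
        unfolding KK using Wc[of x]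
        by (simp add: fro_unitary_right[OF aW, of _ d] fro_unitary_left[OF W, where n = d])
      then show ?thesis by (simp add: fro_diag)
    qed
    then have S: "(\<Sum>p\<in>?A. (?f p)\<^sup>2) = (\<Sum>x\<in>?P. fro (K x * mat_adjoint (K x)))"
      unfolding sum.cartesian_product' by simp
    have "L2_set (\<lambda>x. fnorm (K x)) ?P
        \<le> L2_set (\<lambda>x. fnorm (K x * mat_adjoint (K x)) + fnorm (K x * mat_adjoint (K x) - K x)) ?P"
    proof (rule L2_set_mono)
      fix x
      have "fnorm (K x) = fnorm (K x - 0\<^sub>m d d)"
        using Kc[of x] by (intro arg_cong[of _ _ fnorm] eq_matI) auto
      also have "\<dots> \<le> fnorm (K x - K x * mat_adjoint (K x)) + fnorm (K x * mat_adjoint (K x) - 0\<^sub>m d d)"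
        using Kc[of x] by (intro fnorm_diff_triangle[of _ d d]) simp_all
      also have "fnorm (K x - K x * mat_adjoint (K x)) = fnorm (K x * mat_adjoint (K x) - K x)"
        using Kc[of x] by (intro fnorm_minus_commute[of _ d d]) simp_all
      also have "K x * mat_adjoint (K x) - 0\<^sub>m d d = K x * mat_adjoint (K x)"
        using Kc[of x] by (intro eq_matI) auto
      finally show "fnorm (K x) \<le> fnorm (K x * mat_adjoint (K x)) + fnorm (K x * mat_adjoint (K x) - K x)"
        by simp
    qed simp
    also have "\<dots> \<le> L2_set (\<lambda>x. fnorm (K x * mat_adjoint (K x))) ?P
        + L2_set (\<lambda>x. fnorm (K x * mat_adjoint (K x) - K x)) ?P" by (rule L2_set_triangle_ineq)
    also have "L2_set (\<lambda>x. fnorm (K x * mat_adjoint (K x))) ?P = sqrt (\<Sum>p\<in>?A. (?f p)\<^sup>2)"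
      unfolding L2_set_def S by simp
    also have "L2_set (\<lambda>x. fnorm (K x * mat_adjoint (K x) - K x)) ?P \<le> sqrt (D\<^sup>2)"
      unfolding L2_set_def fnorm_power2 by (rule real_sqrt_le_mono[OF fc3])
    also have "L2_set (\<lambda>x. fnorm (K x)) ?P = sqrt d"
    proof -
      have "(\<Sum>x\<in>?P. fro (K x)) = real d" using fc1[of "1\<^sub>m d"] by (simp add: K1)
      then show ?thesis unfolding L2_set_def by simp
    qed
    finally have tri: "sqrt d \<le> sqrt (\<Sum>p\<in>?A. (?f p)\<^sup>2) + D" using D by simp
    have nn: "0 \<le> (\<Sum>p\<in>?A. (?f p)\<^sup>2)" by (rule sum_nonneg) simp
    show ?thesis
    proof (cases "D \<le> sqrt d")
      case True
      have "(sqrt d - D)\<^sup>2 \<le> (sqrt (\<Sum>p\<in>?A. (?f p)\<^sup>2))\<^sup>2"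
        using tri True by (intro power_mono) simp_all
      then have "(sqrt d - D)\<^sup>2 \<le> (\<Sum>p\<in>?A. (?f p)\<^sup>2)" using nn by simp
      then have "real d + D\<^sup>2 - 2 * sqrt d * D \<le> (\<Sum>p\<in>?A. (?f p)\<^sup>2)" by (simp add: power2_diff)
      moreover have "2 * D * sqrt d = 2 * sqrt d * D" by simp
      ultimately show ?thesis using zero_le_power2[of D] by linarith
    next
      case False
      then have "sqrt d * sqrt d \<le> D * sqrt d" by (intro mult_right_mono) auto
      then have "real d \<le> D * sqrt d" by simp
      moreover have "0 \<le> D * sqrt d" using D by simp
      ultimately show ?thesis using nn by linarith
    qed
  qed
  have fA: "finite ?A" using fP by simp
  have f01: "0 \<le> ?f p \<and> ?f p \<le> 1" if "p \<in> ?A" for p using that l01 by auto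
  obtain R where R: "R \<subseteq> ?A" "card R = d" "(\<Sum>p\<in>?A. (?f p)\<^sup>2) \<le> sum ?f R"
    by (rule sum_top_ge_sum_squares[OF fA f01 sumf])
  have fR: "finite R" using R(1) fA by (rule finite_subset)
  obtain r where r: "bij_betw r {0..<card R} R" using ex_bij_betw_nat_finite[OF fR] by blast
  then have r: "bij_betw r {..<d} R" using R(2) by (simp add: lessThan_atLeast0)
  then have rinj: "inj_on r {..<d}" and rim: "r ` {..<d} = R" by (auto simp: bij_betw_def)
  define sel where "sel M = mat d d (\<lambda>(i, j). M (fst (r i)) $$ (snd (r i), j))" for M :: "'a set \<Rightarrow> complex mat"
  have selc: "sel M \<in> carrier_mat d d" for M by (simp add: sel_def)
  have seld: "dim_row (sel M) = d" "dim_col (sel M) = d" for M by (simp_all add: sel_def)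
  have ri: "fst (r i) \<in> ?P" "snd (r i) < d" if "i < d" for i
  proof -
    have "r i \<in> ?A" using that rim R(1) by blast
    then show "fst (r i) \<in> ?P" "snd (r i) < d" by (auto simp: mem_Times_iff)
  qed
  have sel_le: "fro (sel M) \<le> (\<Sum>x\<in>?P. fro (M x))" if "\<And>x. x \<in> ?P \<Longrightarrow> M x \<in> carrier_mat d d" for M
    unfolding sel_def by (rule fro_row_selection_le[OF fP that rinj]) (use rim R(1) in simp_all)
  define Y where "Y = sel G"
  have Yc: "Y \<in> carrier_mat d d" by (simp add: Y_def selc)
  have YB: "Y * B = sel (\<lambda>x. G x * B)" if B: "B \<in> carrier_mat d d" for B
  proof (rule eq_matI)
    fix i j assume "i < dim_row (sel (\<lambda>x. G x * B))" "j < dim_col (sel (\<lambda>x. G x * B))"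
    then have ij: "i < d" "j < d" by (simp_all add: seld)
    show "(Y * B) $$ (i, j) = sel (\<lambda>x. G x * B) $$ (i, j)"
      using ij ri[OF ij(1)] B carrier_matD[OF Gc]
      by (simp add: Y_def sel_def scalar_prod_def)
  qed (use seld Yc B in auto)
  have contr: "fro (Y * B) \<le> fro B" if B: "B \<in> carrier_mat d d" for B
  proof -
    have "fro (Y * B) \<le> (\<Sum>x\<in>?P. fro (G x * B))"
      unfolding YB[OF B] using B Gc by (intro sel_le) simp
    then show ?thesis using froGB[OF B] fc1[OF B] by simp
  qed
  have froY: "fro Y = sum ?f R"
  proof -
    have row: "(\<Sum>j<d. (cmod (G x $$ (k, j)))\<^sup>2) = l x k" if "k < d" for x k
    proof -
      have "complex_of_real (\<Sum>j<d. (cmod (G x $$ (k, j)))\<^sup>2) = (G x * mat_adjoint (G x)) $$ (k, k)"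
        using that Gc[of x] by (simp add: scalar_prod_def lessThan_atLeast0 complex_norm_square[unfolded of_real_power])
      also have "\<dots> = complex_of_real (l x k)" using GG[of x] that by (simp del: index_mult_mat(1))
      finally show ?thesis by (simp only: of_real_eq_iff)
    qed
    have "fro Y = (\<Sum>i<d. l (fst (r i)) (snd (r i)))"
      using ri by (simp add: Y_def sel_def fro_def row)
    also have "\<dots> = sum ?f (r ` {..<d})" using rinj by (simp add: sum.reindex case_prod_unfold)
    finally show ?thesis using rim by simp
  qed
  have "0 < e / 2" using e by simp
  then obtain U where U: "U \<in> unitaries d" "fnorm (Y - U) \<le> sqrt (d - fro Y) + e / 2"
    using nearby_unitary[OF Yc contr, of "e / 2"] by metis
  have Uc: "U \<in> carrier_mat d d" using U by auto
  have "real d - fro Y \<le> 2 * D * sqrt d" using R(3) sumf2 froY by linarith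
  then have YU: "fnorm (Y - U) \<le> sqrt (2 * D * sqrt d) + e / 2"
    using U(2) real_sqrt_le_mono by (meson add_right_mono order_trans)
  define x where "x i = fst (r i)" for i
  have "fnorm (U * \<Phi> g - diag d (\<lambda>i. ?c (x i) g) * U) \<le> 2 * sqrt (2 * D * sqrt d) + D + e"
    if g: "g \<subseteq> I" for g
  proof -
    define \<Delta> where "\<Delta> = diag d (\<lambda>i. ?c (x i) g)"
    have \<Delta>: "\<Delta> \<in> unitaries d" unfolding \<Delta>_def by (rule diag_unitary) simp
    have \<Delta>c: "\<Delta> \<in> carrier_mat d d" by (simp add: \<Delta>_def)
    have \<Phi>g: "\<Phi> g \<in> unitaries d" by (rule \<Phi>[OF g])
    have \<Phi>c: "\<Phi> g \<in> carrier_mat d d" using \<Phi>g by auto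
    have "Y * \<Phi> g - \<Delta> * Y = sel (\<lambda>x. G x * \<Phi> g - ?c x g \<cdot>\<^sub>m G x)"
    proof (rule eq_matI)
      fix i j assume "i < dim_row (sel (\<lambda>x. G x * \<Phi> g - ?c x g \<cdot>\<^sub>m G x))"
        "j < dim_col (sel (\<lambda>x. G x * \<Phi> g - ?c x g \<cdot>\<^sub>m G x))"
      then have ij: "i < d" "j < d" by (simp_all add: seld)
      have "(\<Delta> * Y) $$ (i, j) = ?c (x i) g * Y $$ (i, j)"
        using ij Yc by (simp add: \<Delta>_def del: index_mult_mat(1))
      moreover have "(Y * \<Phi> g) $$ (i, j) = (G (x i) * \<Phi> g) $$ (snd (r i), j)"
        unfolding YB[OF \<Phi>c] using ij by (simp add: sel_def x_def del: index_mult_mat(1))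
      moreover have "Y $$ (i, j) = G (x i) $$ (snd (r i), j)"
        using ij by (simp add: Y_def sel_def x_def)
      moreover have "sel (\<lambda>x. G x * \<Phi> g - ?c x g \<cdot>\<^sub>m G x) $$ (i, j)
          = (G (x i) * \<Phi> g) $$ (snd (r i), j) - ?c (x i) g * G (x i) $$ (snd (r i), j)"
        using ij ri[OF ij(1)] \<Phi>c carrier_matD[OF Gc]
        by (simp add: sel_def x_def del: index_mult_mat(1))
      ultimately show "(Y * \<Phi> g - \<Delta> * Y) $$ (i, j) = sel (\<lambda>x. G x * \<Phi> g - ?c x g \<cdot>\<^sub>m G x) $$ (i, j)"
        using ij Yc \<Delta>c by (simp del: index_mult_mat(1))
    qed (use seld Yc \<Phi>c \<Delta>c in auto)
    then have "fro (Y * \<Phi> g - \<Delta> * Y) \<le> (\<Sum>x\<in>?P. fro (G x * \<Phi> g - ?c x g \<cdot>\<^sub>m G x))"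
      using Gc \<Phi>c by (simp only:) (intro sel_le minus_carrier_mat, simp)
    also have "\<dots> = (\<Sum>x\<in>?P. fro (K x * \<Phi> g - ?c x g \<cdot>\<^sub>m K x))"
    proof (intro sum.cong refl)
      fix x
      have "G x * \<Phi> g - ?c x g \<cdot>\<^sub>m G x = mat_adjoint (W x) * (K x * \<Phi> g - ?c x g \<cdot>\<^sub>m K x)"
        using Wc[of x] Kc[of x] \<Phi>c
        by (simp add: G_def mult_minus_distrib_mat[of _ d d _ d] assoc_mult_mat[of _ d d _ d _ d]
          mult_smult_distrib[of _ d d _ d])
      then show "fro (G x * \<Phi> g - ?c x g \<cdot>\<^sub>m G x) = fro (K x * \<Phi> g - ?c x g \<cdot>\<^sub>m K x)"
        using fro_unitary_left[OF aW, of "K x * \<Phi> g - ?c x g \<cdot>\<^sub>m K x" d x] Kc[of x]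
        by (simp add: minus_carrier_mat)
    qed
    also have "\<dots> \<le> D\<^sup>2" by (rule fc2[OF g])
    finally have Y\<Phi>: "fnorm (Y * \<Phi> g - \<Delta> * Y) \<le> D" unfolding fnorm_def using D by (intro real_le_lsqrt) auto
    have 1: "fnorm (U * \<Phi> g - Y * \<Phi> g) = fnorm (Y - U)"
    proof -
      have "fnorm (U * \<Phi> g - Y * \<Phi> g) = fnorm ((U - Y) * \<Phi> g)"
        using Uc Yc \<Phi>c by (simp add: minus_mult_distrib_mat[of _ d d _ _ d])
      also have "\<dots> = fnorm (U - Y)" by (rule fnorm_unitary_right[OF \<Phi>g minus_carrier_mat[OF Yc]])
      finally show ?thesis using fnorm_minus_commute[OF Uc Yc] by simp
    qed
    have 2: "fnorm (\<Delta> * Y - \<Delta> * U) = fnorm (Y - U)"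
    proof -
      have "fnorm (\<Delta> * Y - \<Delta> * U) = fnorm (\<Delta> * (Y - U))"
        using Uc Yc \<Delta>c by (simp add: mult_minus_distrib_mat[of _ d d _ d])
      then show ?thesis using fnorm_unitary_left[OF \<Delta> minus_carrier_mat[OF Uc, of Y]] by simp
    qed
    have "fnorm (U * \<Phi> g - \<Delta> * U) \<le> fnorm (U * \<Phi> g - Y * \<Phi> g) + fnorm (Y * \<Phi> g - \<Delta> * U)"
      using Uc Yc \<Phi>c \<Delta>c by (intro fnorm_diff_triangle[of _ d d]) simp_all
    moreover have "fnorm (Y * \<Phi> g - \<Delta> * U) \<le> fnorm (Y * \<Phi> g - \<Delta> * Y) + fnorm (\<Delta> * Y - \<Delta> * U)"
      using Uc Yc \<Phi>c \<Delta>c by (intro fnorm_diff_triangle[of _ d d]) simp_all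
    ultimately show ?thesis using Y\<Phi> 1 2 YU unfolding \<Delta>_def by linarith
  qed
  then show ?thesis by (rule that[OF U(1)])
qed

section \<open>Local periodicity of two-sided sequences\<close>

definition shift :: "int \<Rightarrow> (int \<Rightarrow> 'a) \<Rightarrow> int \<Rightarrow> 'a" where
  "shift k y = (\<lambda>n. y (n + k))"

lemma shift_shift [simp]: "shift a (shift b y) = shift (a + b) y"
  by (simp add: shift_def add.assoc)

lemma shift_0 [simp]: "shift 0 y = y"
  by (simp add: shift_def)

lemma shift_apply: "shift k y n = y (n + k)"
  by (simp add: shift_def)

definition periodic :: "int \<Rightarrow> (int \<Rightarrow> 'a) \<Rightarrow> bool" where
  "periodic p u \<longleftrightarrow> (\<forall>n. u (n + p) = u n)"

lemma periodic_mult: "periodic p u \<Longrightarrow> u (n + k * p) = u n"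
proof (induction k rule: int_induct[of _ 0])
  case (step1 i)
  then have "u (n + i * p + p) = u (n + i * p)" by (simp add: periodic_def)
  then show ?case using step1 by (simp add: algebra_simps)
next
  case (step2 i)
  then have "u (n + (i - 1) * p + p) = u (n + (i - 1) * p)" by (simp only: periodic_def)
  then show ?case using step2 by (simp add: algebra_simps)
qed simp

lemma periodic_mod:
  assumes "periodic p u"
  shows "u n = u (a + (n - a) mod p)"
proof -
  have "n = a + (n - a) mod p + (n - a) div p * p" by (simp add: add.assoc)
  then show ?thesis using periodic_mult[OF assms] by metis
qed

lemma periodic_shift: "periodic p u \<Longrightarrow> periodic p (shift k u)"
  unfolding periodic_def shift_def by (metis add.assoc add.commute)

text \<open>On the window the sequence \<open>v\<close> inherits the period \<open>p\<close> of \<open>u\<close> along a full \<open>q\<close>-period, hence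
  everywhere; two \<open>p\<close>-periodic sequences agreeing on a full period are equal.\<close>

lemma periodic_unique:
  assumes u: "periodic p u" "0 < p" "p \<le> M" and v: "periodic q v" "0 < q" "q \<le> M"
    and eq: "\<And>n. a \<le> n \<Longrightarrow> n < a + 2 * M \<Longrightarrow> u n = v n"
  shows "u = v"
proof -
  have vp: "v (n + p) = v n" for n
  proof -
    define n' where "n' = a + (n - a) mod q"
    have n': "a \<le> n'" "n' < a + q" using v(2) by (simp_all add: n'_def)
    have "v n = v n'" unfolding n'_def by (rule periodic_mod[OF v(1)])
    moreover have "v (n + p) = v (n' + p)"
      using periodic_mod[OF periodic_shift[OF v(1), of p], of n a] by (simp add: n'_def shift_def)
    moreover have "v n' = u n'" using n' v u by (intro eq[symmetric]) auto
    moreover have "v (n' + p) = u (n' + p)" using n' v u by (intro eq[symmetric]) auto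
    moreover have "u (n' + p) = u n'" using u(1) by (simp add: periodic_def)
    ultimately show ?thesis by simp
  qed
  show "u = v"
  proof
    fix n
    have r: "a \<le> a + (n - a) mod p" "a + (n - a) mod p < a + 2 * M"
      using u pos_mod_bound[of p "n - a"] by (simp, linarith)
    have "u n = u (a + (n - a) mod p)" by (rule periodic_mod[OF u(1)])
    also have "\<dots> = v (a + (n - a) mod p)" by (rule eq[OF r])
    also have "\<dots> = v n" using vp by (intro periodic_mod[symmetric]) (simp add: periodic_def)
    finally show "u n = v n" .
  qed
qed

text \<open>Being periodic with some period at most \<open>M\<close> on the window \<open>{-K..K}\<close>.\<close>

definition per :: "int \<Rightarrow> int \<Rightarrow> (int \<Rightarrow> 'a) \<Rightarrow> bool" where
  "per M K y \<longleftrightarrow> (\<exists>p. 0 < p \<and> p \<le> M \<and> (\<forall>n. - K \<le> n \<longrightarrow> n + p \<le> K \<longrightarrow> y (n + p) = y n))"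

text \<open>For \<open>M \<le> K\<close> such a sequence \<open>u\<close> is determined by the window, by \<open>periodic_unique\<close>.\<close>

definition is_per_ext :: "int \<Rightarrow> int \<Rightarrow> (int \<Rightarrow> 'a) \<Rightarrow> (int \<Rightarrow> 'a) \<Rightarrow> bool" where
  "is_per_ext M K y u \<longleftrightarrow> (\<exists>p. 0 < p \<and> p \<le> M \<and> periodic p u) \<and> (\<forall>n. - K \<le> n \<longrightarrow> n \<le> K \<longrightarrow> u n = y n)"

definition per_ext :: "int \<Rightarrow> int \<Rightarrow> (int \<Rightarrow> 'a) \<Rightarrow> int \<Rightarrow> 'a" where
  "per_ext M K y = (SOME u. is_per_ext M K y u)"

lemma is_per_ext_per_ext:
  assumes "per M K y"
  shows "is_per_ext M K y (per_ext M K y)"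
proof -
  obtain p where p: "0 < p" "p \<le> M" and y: "\<And>n. - K \<le> n \<Longrightarrow> n + p \<le> K \<Longrightarrow> y (n + p) = y n"
    using assms by (auto simp: per_def)
  define u where "u n = y (- K + (n + K) mod p)" for n
  have "periodic p u" by (simp add: periodic_def u_def) (metis add.assoc add.commute mod_add_self2)
  moreover have "u n = y n" if n: "- K \<le> n" "n \<le> K" for n
  proof -
    have *: "- K + r + int q * p \<le> K \<Longrightarrow> y (- K + r + int q * p) = y (- K + r)" if "0 \<le> r" for r q
    proof (induction q)
      case (Suc q)
      have "0 \<le> int q * p" using p by simp
      then have "y (- K + r + int q * p + p) = y (- K + r + int q * p)"
        using Suc.prems that by (intro y) (auto simp: algebra_simps)
      moreover have "- K + r + int q * p \<le> K" using Suc.prems p by (simp add: algebra_simps)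
      ultimately show ?case using Suc.IH by (simp add: algebra_simps)
    qed simp
    have q: "0 \<le> (n + K) div p" using n p by (simp add: pos_imp_zdiv_nonneg_iff)
    have n_eq: "n = - K + (n + K) mod p + int (nat ((n + K) div p)) * p"
    proof -
      have "int (nat ((n + K) div p)) = (n + K) div p" using q by simp
      moreover have "n = - K + (n + K) mod p + (n + K) div p * p"
        using mod_div_mult_eq[of "n + K" p] by linarith
      ultimately show ?thesis by simp
    qed
    have "y (- K + (n + K) mod p + int (nat ((n + K) div p)) * p) = y (- K + (n + K) mod p)"
      by (rule *) (use p n n_eq in simp_all)
    then show ?thesis using n_eq by (simp add: u_def)
  qed
  ultimately have "is_per_ext M K y u" using p by (auto simp: is_per_ext_def)
  then show ?thesis unfolding per_ext_def by (rule someI[where P = "is_per_ext M K y"])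
qed

lemma per_ext_shift:
  assumes y: "per M K y" "per M K (shift 1 y)" and MK: "M \<le> K"
  shows "per_ext M K (shift 1 y) = shift 1 (per_ext M K y)"
proof -
  obtain p where p: "0 < p" "p \<le> M" "periodic p (per_ext M K y)"
    and eq1: "\<And>n. - K \<le> n \<Longrightarrow> n \<le> K \<Longrightarrow> per_ext M K y n = y n"
    using is_per_ext_per_ext[OF y(1)] by (auto simp: is_per_ext_def)
  obtain q where q: "0 < q" "q \<le> M" "periodic q (per_ext M K (shift 1 y))"
    and eq2: "\<And>n. - K \<le> n \<Longrightarrow> n \<le> K \<Longrightarrow> per_ext M K (shift 1 y) n = y (n + 1)"
    using is_per_ext_per_ext[OF y(2)] by (auto simp: is_per_ext_def shift_def)
  show ?thesis
    by (rule periodic_unique[OF q(3,1,2) periodic_shift[OF p(3)] p(1,2), of "- K"])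
      (use MK in \<open>simp add: eq1 eq2 shift_apply\<close>)
qed

lemma per_shrink: "per M (K + 1) y \<Longrightarrow> per M K (shift a y)" if "\<bar>a\<bar> \<le> 1"
proof -
  assume "per M (K + 1) y"
  then obtain p where p: "0 < p" "p \<le> M"
    and *: "\<And>n. - (K + 1) \<le> n \<Longrightarrow> n + p \<le> K + 1 \<Longrightarrow> y (n + p) = y n"
    by (auto simp: per_def)
  show ?thesis unfolding per_def
  proof (intro exI[of _ p] conjI p allI impI)
    fix n assume "- K \<le> n" "n + p \<le> K"
    then have "y (n + a + p) = y (n + a)" using that by (intro *) auto
    then show "shift a y (n + p) = shift a y n" by (simp add: shift_def algebra_simps)
  qed
qed

lemma per_local:
  assumes "\<And>n. - K \<le> n \<Longrightarrow> n \<le> K \<Longrightarrow> y n = z n"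
  shows "per M K y = per M K z"
proof -
  have "y (n + p) = y n \<longleftrightarrow> z (n + p) = z n" if "- K \<le> n" "n + p \<le> K" "0 < p" for n p
    using assms[of n] assms[of "n + p"] that by simp
  then show ?thesis unfolding per_def by (metis (no_types, lifting))
qed

lemma per_ext_local:
  assumes "\<And>n. - K \<le> n \<Longrightarrow> n \<le> K \<Longrightarrow> y n = z n"
  shows "per_ext M K y = per_ext M K z"
proof -
  have "is_per_ext M K y = is_per_ext M K z" unfolding is_per_ext_def using assms by fastforce
  then show ?thesis by (simp add: per_ext_def)
qed

definition word :: "nat \<Rightarrow> (int \<Rightarrow> 'a) \<Rightarrow> 'a list" where
  "word k y = map (\<lambda>m. y (int m)) [0..<k]"

lemma word_eq_iff: "word k y = word k z \<longleftrightarrow> (\<forall>n. 0 \<le> n \<longrightarrow> n < int k \<longrightarrow> y n = z n)"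
proof -
  have "word k y = word k z \<longleftrightarrow> (\<forall>m<k. y (int m) = z (int m))"
    by (auto simp: word_def list_eq_iff_nth_eq)
  then show ?thesis by (metis nonneg_int_cases of_nat_0_le_iff of_nat_less_iff)
qed

text \<open>A long word that overlaps a translate of itself forces a period. This is how a lack of distinct
  words leads to local periodicity.\<close>

lemma repeated_word_periodic:
  assumes eq: "word k (shift i y) = word k (shift j y)" and ij: "i < j" "j \<le> i + M" and k: "2 * K < int k"
  shows "per M K (shift (i + K) y)"
  unfolding per_def
proof (intro exI[of _ "j - i"] conjI allI impI)
  fix n assume n: "- K \<le> n" "n + (j - i) \<le> K"
  have "shift i y (n + K) = shift j y (n + K)"
    using eq[unfolded word_eq_iff, rule_format, of "n + K"] n ij k by simp
  then show "shift (i + K) y (n + (j - i)) = shift (i + K) y n"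
    by (simp add: shift_def algebra_simps)
qed (use ij in auto)

section \<open>Cutting sequences into chains\<close>

text \<open>A cut lies between the positions \<open>-1\<close> and \<open>0\<close>. Besides the marker words, every change between the
  periodic and the aperiodic regime is a cut, so that a stretch without cuts lies in one regime.\<close>

definition is_cut :: "int \<Rightarrow> int \<Rightarrow> 'a list set \<Rightarrow> (int \<Rightarrow> 'a) \<Rightarrow> bool" where
  "is_cut M K Z y \<longleftrightarrow> word (nat (2 * K + 1)) y \<in> Z \<or> per M K y \<noteq> per M K (shift (- 1) y)"

lemma is_cut_local:
  assumes "\<And>n. - K - 1 \<le> n \<Longrightarrow> n \<le> 2 * K \<Longrightarrow> y n = z n" and "0 \<le> K"
  shows "is_cut M K Z y = is_cut M K Z z"
proof -
  have "word (nat (2 * K + 1)) y = word (nat (2 * K + 1)) z"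
    using assms by (simp add: word_eq_iff)
  moreover have "per M K y = per M K z" "per M K (shift (- 1) y) = per M K (shift (- 1) z)"
    by (rule per_local, use assms in \<open>simp add: shift_def\<close>)+
  ultimately show ?thesis by (simp add: is_cut_def)
qed

lemma not_is_cut_per:
  assumes "\<And>m. a < m \<Longrightarrow> m \<le> c \<Longrightarrow> \<not> is_cut M K Z (shift m y)" and "a \<le> c"
  shows "per M K (shift c y) = per M K (shift a y)"
proof -
  have "per M K (shift (a + int k) y) = per M K (shift a y)" if "a + int k \<le> c" for k
    using that
  proof (induction k)
    case (Suc k)
    have "\<not> is_cut M K Z (shift (a + int (Suc k)) y)" using Suc.prems by (intro assms) auto
    then show ?case using Suc by (simp add: is_cut_def add.commute add.left_commute)
  qed simp
  from this[of "nat (c - a)"] show ?thesis using assms(2) by simp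
qed

text \<open>Position \<open>0\<close> is the \<open>i\<close>-th place of a piece of length \<open>h\<close> between consecutive cuts.\<close>

definition chain :: "int \<Rightarrow> int \<Rightarrow> 'a list set \<Rightarrow> int \<Rightarrow> int \<Rightarrow> (int \<Rightarrow> 'a) \<Rightarrow> bool" where
  "chain M K Z h i y \<longleftrightarrow> 0 \<le> i \<and> i < h \<and> is_cut M K Z (shift (- i) y) \<and> is_cut M K Z (shift (h - i) y) \<and>
     (\<forall>m. - i < m \<longrightarrow> m < h - i \<longrightarrow> \<not> is_cut M K Z (shift m y))"

lemma chain_unique:
  assumes c: "chain M K Z h i y" "chain M K Z h' i' y"
  shows "h = h' \<and> i = i'"
proof -
  have nb: "\<not> is_cut M K Z (shift m y)" if "- i < m" "m < h - i" for m using c(1) that by (simp add: chain_def)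
  have nb': "\<not> is_cut M K Z (shift m y)" if "- i' < m" "m < h' - i'" for m using c(2) that by (simp add: chain_def)
  have r: "0 \<le> i" "i < h" "is_cut M K Z (shift (- i) y)" "is_cut M K Z (shift (h - i) y)"
    and r': "0 \<le> i'" "i' < h'" "is_cut M K Z (shift (- i') y)" "is_cut M K Z (shift (h' - i') y)"
    using c by (simp_all add: chain_def)
  have "\<not> i < i'" using nb'[of "- i"] r r' by auto
  moreover have "\<not> i' < i" using nb[of "- i'"] r r' by auto
  moreover have "\<not> h - i < h' - i'" using nb'[of "h - i"] r r' by auto
  moreover have "\<not> h' - i' < h - i" using nb[of "h' - i'"] r r' by auto
  ultimately show ?thesis by auto
qed

lemma chain_shift: "0 \<le> i \<Longrightarrow> i + 1 < h \<Longrightarrow> chain M K Z h (i + 1) (shift 1 y) \<longleftrightarrow> chain M K Z h i y"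
proof -
  assume i: "0 \<le> i" "i + 1 < h"
  have "(\<forall>m. - (i + 1) < m \<longrightarrow> m < h - (i + 1) \<longrightarrow> \<not> is_cut M K Z (shift m (shift 1 y)))
      \<longleftrightarrow> (\<forall>m. - i < m \<longrightarrow> m < h - i \<longrightarrow> \<not> is_cut M K Z (shift m y))" (is "?A = ?B")
  proof
    assume A: ?A
    show ?B
    proof (intro allI impI)
      fix m assume "- i < m" "m < h - i"
      then show "\<not> is_cut M K Z (shift m y)" using A[rule_format, of "m - 1"] by simp
    qed
  next
    assume B: ?B
    show ?A
    proof (intro allI impI)
      fix m assume "- (i + 1) < m" "m < h - (i + 1)"
      then show "\<not> is_cut M K Z (shift m (shift 1 y))" using B[rule_format, of "m + 1"] by simp
    qed
  qed
  then show ?thesis using i by (simp add: chain_def)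
qed

text \<open>A state \<open>(0, 0, u)\<close> is a periodic sequence; a state \<open>(h, i, v)\<close> with \<open>0 < h\<close> is the \<open>i\<close>-th place of a
  piece of length \<open>h\<close> with contents \<open>v\<close>.\<close>

type_synonym 'a state = "int \<times> int \<times> (int \<Rightarrow> 'a)"

text \<open>The value outside of the piece is a fixed default so that equal pieces give equal states.\<close>

definition chain_word :: "int \<Rightarrow> int \<Rightarrow> (int \<Rightarrow> 'a) \<Rightarrow> int \<Rightarrow> 'a" where
  "chain_word h i y = (\<lambda>n. if 0 \<le> n \<and> n < h then y (n - i) else undefined)"

definition state_of :: "int \<Rightarrow> int \<Rightarrow> 'a list set \<Rightarrow> int \<Rightarrow> (int \<Rightarrow> 'a) \<Rightarrow> 'a state option" where
  "state_of M K Z H y = (if per M K y then Some (0, 0, per_ext M K y)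
     else if \<exists>h i. h \<le> H \<and> chain M K Z h i y
     then Some (SOME s. \<exists>h i. h \<le> H \<and> chain M K Z h i y \<and> s = (h, i, chain_word h i y))
     else None)"

text \<open>The cyclic closure of the shift: the last place of a piece is followed by its first one.\<close>

definition advance :: "'a state \<Rightarrow> 'a state" where
  "advance s = (case s of (h, i, v) \<Rightarrow> if h = 0 then (0, 0, shift 1 v) else (h, (i + 1) mod h, v))"

lemma state_of_per: "per M K y \<Longrightarrow> state_of M K Z H y = Some (0, 0, per_ext M K y)"
  by (simp add: state_of_def)

lemma state_of_chain:
  assumes "\<not> per M K y" "h \<le> H" "chain M K Z h i y"
  shows "state_of M K Z H y = Some (h, i, chain_word h i y)"
proof -
  have "(SOME s. \<exists>h i. h \<le> H \<and> chain M K Z h i y \<and> s = (h, i, chain_word h i y)) = (h, i, chain_word h i y)"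
    by (rule some_equality) (use assms chain_unique in blast)+
  then show ?thesis using assms by (auto simp: state_of_def)
qed

lemma state_of_cases:
  assumes "state_of M K Z H y = Some s"
  obtains "per M K y" "s = (0, 0, per_ext M K y)"
    | h i where "\<not> per M K y" "h \<le> H" "chain M K Z h i y" "s = (h, i, chain_word h i y)" "0 \<le> i" "i < h"
proof (cases "per M K y")
  case True
  then show ?thesis using assms that(1) by (simp add: state_of_per)
next
  case False
  then obtain h i where hi: "h \<le> H" "chain M K Z h i y" using assms by (auto simp: state_of_def split: if_splits)
  then have "s = (h, i, chain_word h i y)" using state_of_chain[OF False hi] assms by simp
  then show ?thesis using that(2)[OF False hi] hi(2) by (simp add: chain_def)
qed

lemma chain_word_shift: "chain_word h (i + 1) (shift 1 y) = chain_word h i y"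
proof -
  have "n - (i + 1) + 1 = n - i" for n :: int by simp
  then show ?thesis by (simp only: chain_word_def shift_def)
qed

text \<open>Inside a piece the two cuts are visible from every place, so passing to the next place is exact.
  Together with the converse below this confines all errors to the ends of pieces and to the
  borders of the periodic regime.\<close>

lemma state_of_advance:
  assumes "state_of M K Z H y = Some (h, i, v)" "0 < h" "i + 1 < h"
  shows "state_of M K Z H (shift 1 y) = Some (h, i + 1, v)"
  using assms(1)
proof (cases rule: state_of_cases)
  case 1
  then show ?thesis using assms by simp
next
  case (2 h' i')
  then have eq: "h' = h" "i' = i" "v = chain_word h i y" by auto
  have "\<not> is_cut M K Z (shift 1 y)" using 2(3,5) assms(3) by (simp add: chain_def eq)
  then have "\<not> per M K (shift 1 y)" using 2(1) by (simp add: is_cut_def)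
  moreover have "chain M K Z h (i + 1) (shift 1 y)"
    using chain_shift[of i h M K Z y] 2 assms(3) by (simp add: eq)
  ultimately show ?thesis using 2(2) by (simp add: eq state_of_chain chain_word_shift)
qed

lemma state_of_retreat:
  assumes "state_of M K Z H (shift 1 y) = Some (h, i + 1, v)" "0 \<le> i"
  shows "state_of M K Z H y = Some (h, i, v) \<and> 0 < h \<and> i + 1 < h"
  using assms(1)
proof (cases rule: state_of_cases)
  case 1
  then show ?thesis using assms by simp
next
  case (2 h' i')
  then have eq: "h' = h" "i' = i + 1" "v = chain_word h (i + 1) (shift 1 y)" by auto
  have nb: "\<forall>m. - (i + 1) < m \<longrightarrow> m < h - (i + 1) \<longrightarrow> \<not> is_cut M K Z (shift m (shift 1 y))"
    using 2(3) unfolding chain_def eq by (elim conjE)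
  have "\<not> is_cut M K Z (shift 0 (shift 1 y))"
    using nb[rule_format, of 0] 2(6) assms(2) eq by (simp del: shift_shift)
  then have "\<not> per M K y" using 2(1) by (simp add: is_cut_def)
  moreover have "chain M K Z h i y"
    using chain_shift[of i h M K Z y] 2 assms(2) by (simp add: eq)
  ultimately show ?thesis using 2(2,6) assms(2) by (simp add: eq state_of_chain chain_word_shift)
qed

lemma state_of_None_cases:
  assumes "state_of M K Z (2 * L) y = None" "0 < L"
  shows "\<not> per M K y \<and> ((\<forall>j. 1 \<le> j \<longrightarrow> j \<le> L \<longrightarrow> \<not> is_cut M K Z (shift j y)) \<or>
    (\<forall>j. 0 \<le> j \<longrightarrow> j < L \<longrightarrow> \<not> is_cut M K Z (shift (- j) y)))"
proof (intro conjI)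
  show np: "\<not> per M K y" using assms by (auto simp: state_of_per)
  show "(\<forall>j. 1 \<le> j \<longrightarrow> j \<le> L \<longrightarrow> \<not> is_cut M K Z (shift j y)) \<or>
    (\<forall>j. 0 \<le> j \<longrightarrow> j < L \<longrightarrow> \<not> is_cut M K Z (shift (- j) y))"
  proof (rule ccontr)
    assume "\<not> ?thesis"
    then obtain j i where j: "1 \<le> j" "j \<le> L" "is_cut M K Z (shift j y)" and i: "0 \<le> i" "i < L" "is_cut M K Z (shift (- i) y)"
      by blast
    define j0 where "j0 = (LEAST m. is_cut M K Z (shift (int m + 1) y))"
    define i0 where "i0 = (LEAST m. is_cut M K Z (shift (- int m) y))"
    have jn: "is_cut M K Z (shift (int (nat (j - 1)) + 1) y)" using j by simp
    have in': "is_cut M K Z (shift (- int (nat i)) y)" using i by simp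
    have bj: "is_cut M K Z (shift (int j0 + 1) y)" unfolding j0_def by (rule LeastI[where P = "\<lambda>m. is_cut M K Z (shift (int m + 1) y)", OF jn])
    have bi: "is_cut M K Z (shift (- int i0) y)" unfolding i0_def by (rule LeastI[where P = "\<lambda>m. is_cut M K Z (shift (- int m) y)", OF in'])
    have jle: "int j0 + 1 \<le> L"
      using Least_le[where P = "\<lambda>m. is_cut M K Z (shift (int m + 1) y)", OF jn] j by (simp add: j0_def)
    have ile: "int i0 < L"
      using Least_le[where P = "\<lambda>m. is_cut M K Z (shift (- int m) y)", OF in'] i by (simp add: i0_def)
    have "chain M K Z (int i0 + int j0 + 1) (int i0) y"
      unfolding chain_def
    proof (intro conjI allI impI)
      fix m assume m: "- int i0 < m" "m < int i0 + int j0 + 1 - int i0"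
      show "\<not> is_cut M K Z (shift m y)"
      proof (cases "m \<le> 0")
        case True
        then have "nat (- m) < i0" using m by auto
        then show ?thesis using not_less_Least[of "nat (- m)" "\<lambda>m. is_cut M K Z (shift (- int m) y)"] True
          by (simp add: i0_def)
      next
        case False
        then have "nat (m - 1) < j0" using m by auto
        then show ?thesis using not_less_Least[of "nat (m - 1)" "\<lambda>m. is_cut M K Z (shift (int m + 1) y)"] False
          by (simp add: j0_def)
      qed
    qed (use bi bj in \<open>auto simp: add.commute\<close>)
    moreover have "int i0 + int j0 + 1 \<le> 2 * L" using jle ile by simp
    ultimately show False using state_of_chain[OF np] assms(1) by fastforce
  qed
qed

lemma state_of_local:
  assumes "\<And>n. - H - K - 1 \<le> n \<Longrightarrow> n \<le> H + 2 * K \<Longrightarrow> y n = z n" and "0 \<le> K" "0 \<le> H"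
  shows "state_of M K Z H y = state_of M K Z H z"
proof -
  have pereq: "per M K y = per M K z" by (rule per_local) (use assms in simp)
  have peeq: "per_ext M K y = per_ext M K z" by (rule per_ext_local) (use assms in simp)
  have bdeq: "is_cut M K Z (shift m y) = is_cut M K Z (shift m z)" if "- H \<le> m" "m \<le> H" for m
    by (rule is_cut_local) (use assms that in \<open>simp_all add: shift_def\<close>)
  have cheq: "chain M K Z h i y = chain M K Z h i z" if "h \<le> H" for h i
  proof (cases "0 \<le> i \<and> i < h")
    case True
    then show ?thesis unfolding chain_def using that bdeq by (smt (verit))
  qed (auto simp: chain_def)
  have cweq: "chain_word h i y = chain_word h i z" if "h \<le> H" "0 \<le> i" "i < h" for h i
    using that assms by (auto simp: chain_word_def)
  show ?thesis
  proof (cases "per M K y")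
    case True
    then show ?thesis using pereq peeq by (simp add: state_of_per)
  next
    case False
    show ?thesis
    proof (cases "\<exists>h i. h \<le> H \<and> chain M K Z h i y")
      case True
      then obtain h i where hi: "h \<le> H" "chain M K Z h i y" by blast
      then have "0 \<le> i" "i < h" by (auto simp: chain_def)
      then show ?thesis using state_of_chain[OF False hi] state_of_chain[of M K z h H Z i] False hi pereq cheq cweq by simp
    next
      case none: False
      then have "\<not> (\<exists>h i. h \<le> H \<and> chain M K Z h i z)" using cheq by blast
      then show ?thesis using False none pereq by (simp add: state_of_def)
    qed
  qed
qed

text \<open>An aperiodic stretch without cuts sees no repeated word: a repetition would make some position of
  the stretch locally periodic, and entering the periodic regime is a cut.\<close>

lemma uncut_distinct_words:
  assumes np: "\<not> per M K y" and uncut: "\<And>j. 1 \<le> j \<Longrightarrow> j \<le> M + K \<Longrightarrow> \<not> is_cut M K Z (shift j y)"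
    and K: "0 \<le> K"
  shows "inj_on (\<lambda>j. word (nat (2 * K + 1)) (shift j y)) {1..M}"
    and "\<And>j. 1 \<le> j \<Longrightarrow> j \<le> M \<Longrightarrow> word (nat (2 * K + 1)) (shift j y) \<notin> Z"
proof -
  show "word (nat (2 * K + 1)) (shift j y) \<notin> Z" if "1 \<le> j" "j \<le> M" for j
    using uncut[of j] that K by (simp add: is_cut_def)
  have *: False if ij: "i < j" "i \<in> {1..M}" "j \<in> {1..M}"
    and eq: "word (nat (2 * K + 1)) (shift i y) = word (nat (2 * K + 1)) (shift j y)" for i j
  proof -
    have "per M K (shift (i + K) y)"
      by (rule repeated_word_periodic[OF eq]) (use ij K in auto)
    moreover have "per M K (shift (i + K) y) = per M K (shift 0 y)"
      by (rule not_is_cut_per[where Z = Z]) (use uncut ij K in auto)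
    ultimately show False using np by simp
  qed
  show "inj_on (\<lambda>j. word (nat (2 * K + 1)) (shift j y)) {1..M}"
  proof (rule inj_onI)
    fix i j assume "i \<in> {1..M}" "j \<in> {1..M}"
      "word (nat (2 * K + 1)) (shift i y) = word (nat (2 * K + 1)) (shift j y)"
    then show "i = j" using *[of i j] *[of j i] by (metis linorder_neqE)
  qed
qed

section \<open>Equalising the multiplicities of labels\<close>

lemma funpow_telescope:
  fixes c :: "'s \<Rightarrow> real"
  shows "\<bar>c y - c ((\<tau> ^^ k) y)\<bar> \<le> (\<Sum>m<k. \<bar>c ((\<tau> ^^ m) y) - c (\<tau> ((\<tau> ^^ m) y))\<bar>)"
proof (induction k)
  case (Suc k)
  have "\<bar>c y - c ((\<tau> ^^ Suc k) y)\<bar>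
      \<le> \<bar>c y - c ((\<tau> ^^ k) y)\<bar> + \<bar>c ((\<tau> ^^ k) y) - c (\<tau> ((\<tau> ^^ k) y))\<bar>" by simp
  also have "\<dots> \<le> (\<Sum>m<Suc k. \<bar>c ((\<tau> ^^ m) y) - c (\<tau> ((\<tau> ^^ m) y))\<bar>)" using Suc.IH by simp
  finally show ?case .
qed simp

lemma sum_funpow_bij:
  fixes f :: "'s \<Rightarrow> real"
  assumes b: "bij_betw \<tau> Y Y"
  shows "(\<Sum>y\<in>Y. f ((\<tau> ^^ m) y)) = (\<Sum>y\<in>Y. f y)"
proof (induction m)
  case (Suc m)
  have "(\<Sum>y\<in>Y. f ((\<tau> ^^ Suc m) y)) = (\<Sum>y\<in>Y. f ((\<tau> ^^ m) (\<tau> y)))"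
    by (simp add: funpow_swap1)
  also have "\<dots> = (\<Sum>y\<in>Y. f ((\<tau> ^^ m) y))"
    by (rule sum.reindex_bij_betw[OF b])
  finally show ?case using Suc.IH by simp
qed simp

text \<open>The minimum over the orbit is invariant, and along an orbit of length at most \<open>L\<close> each value
  exceeds the minimum by at most the total variation.\<close>

lemma orbit_minimum:
  fixes c :: "'s \<Rightarrow> nat"
  assumes b: "bij_betw \<tau> Y Y"
    and per: "\<And>y. y \<in> Y \<Longrightarrow> \<exists>l>0. l \<le> L \<and> (\<tau> ^^ l) y = y"
  obtains r :: "'s \<Rightarrow> nat" where "\<And>y. y \<in> Y \<Longrightarrow> r y \<le> c y" "\<And>y. y \<in> Y \<Longrightarrow> r (\<tau> y) = r y"
    "(\<Sum>y\<in>Y. real (c y) - real (r y)) \<le> real L * (\<Sum>y\<in>Y. \<bar>real (c y) - real (c (\<tau> y))\<bar>)"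
proof -
  define r where "r y = Inf (range (\<lambda>k. c ((\<tau> ^^ k) y)))" for y
  have le: "r y \<le> c ((\<tau> ^^ k) y)" for y k
    unfolding r_def by (intro cInf_lower) auto
  have 1: "r y \<le> c y" for y using le[of y 0] by simp
  have inv: "r (\<tau> y) = r y" if y: "y \<in> Y" for y
  proof -
    obtain l where l: "0 < l" "(\<tau> ^^ l) y = y" using per[OF y] by blast
    have e1: "c ((\<tau> ^^ k) (\<tau> y)) = c ((\<tau> ^^ Suc k) y)" for k by (simp add: funpow_swap1)
    have e2: "c ((\<tau> ^^ k) y) = c ((\<tau> ^^ (k + l - 1)) (\<tau> y))" for k
    proof -
      have "(\<tau> ^^ (k + l - 1)) (\<tau> y) = (\<tau> ^^ Suc (k + l - 1)) y" by (simp add: funpow_swap1)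
      also have "Suc (k + l - 1) = k + l" using l by simp
      finally show ?thesis using l by (simp add: funpow_add)
    qed
    have "range (\<lambda>k. c ((\<tau> ^^ k) (\<tau> y))) = range (\<lambda>k. c ((\<tau> ^^ k) y))"
    proof (intro equalityI image_subsetI)
      show "c ((\<tau> ^^ k) (\<tau> y)) \<in> range (\<lambda>k. c ((\<tau> ^^ k) y))" for k
        by (subst e1) (rule rangeI)
      show "c ((\<tau> ^^ k) y) \<in> range (\<lambda>k. c ((\<tau> ^^ k) (\<tau> y)))" for k
        by (subst e2) (rule rangeI)
    qed
    then show ?thesis by (simp add: r_def)
  qed
  let ?\<Delta> = "\<lambda>y. \<bar>real (c y) - real (c (\<tau> y))\<bar>"
  have 2: "real (c y) - real (r y) \<le> (\<Sum>m<L. ?\<Delta> ((\<tau> ^^ m) y))" if y: "y \<in> Y" for y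
  proof -
    obtain l where l: "0 < l" "l \<le> L" "(\<tau> ^^ l) y = y" using per[OF y] by blast
    have "r y \<in> range (\<lambda>k. c ((\<tau> ^^ k) y))" unfolding r_def by (rule Inf_nat_def1) simp
    then obtain k where "r y = c ((\<tau> ^^ k) y)" by blast
    then have k: "r y = c ((\<tau> ^^ (k mod l)) y)" using funpow_mod_eq[OF l(3), of k] by simp
    have "real (c y) - real (r y) \<le> \<bar>real (c y) - real (c ((\<tau> ^^ (k mod l)) y))\<bar>" using k by simp
    also have "\<dots> \<le> (\<Sum>m<k mod l. ?\<Delta> ((\<tau> ^^ m) y))"
      by (rule funpow_telescope[where c = "\<lambda>y. real (c y)"])
    also have "\<dots> \<le> (\<Sum>m<L. ?\<Delta> ((\<tau> ^^ m) y))"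
    proof (rule sum_mono2)
      have "k mod l < l" using l by simp
      then have "k mod l \<le> L" using l by linarith
      then show "{..<k mod l} \<subseteq> {..<L}" by auto
    qed auto
    finally show ?thesis .
  qed
  have "(\<Sum>y\<in>Y. real (c y) - real (r y)) \<le> (\<Sum>y\<in>Y. \<Sum>m<L. ?\<Delta> ((\<tau> ^^ m) y))"
    by (intro sum_mono 2)
  also have "\<dots> = (\<Sum>m<L. \<Sum>y\<in>Y. ?\<Delta> ((\<tau> ^^ m) y))" by (rule sum.swap)
  also have "\<dots> = (\<Sum>m<L. \<Sum>y\<in>Y. ?\<Delta> y)" by (intro sum.cong refl sum_funpow_bij[OF b])
  also have "\<dots> = real L * (\<Sum>y\<in>Y. ?\<Delta> y)" by simp
  finally show ?thesis using 1 inv by (intro that)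
qed

text \<open>Labels are erased until each has the prescribed multiplicity.\<close>

lemma thin_labels:
  fixes s :: "nat \<Rightarrow> 's option"
  assumes Y: "finite Y" and sY: "\<And>i y. i < d \<Longrightarrow> s i = Some y \<Longrightarrow> y \<in> Y"
    and r: "\<And>y. y \<in> Y \<Longrightarrow> r y \<le> card {i. i < d \<and> s i = Some y}"
  obtains s' where "\<And>i. i < d \<Longrightarrow> s' i = None \<or> s' i = s i"
    "\<And>y. y \<in> Y \<Longrightarrow> card {i. i < d \<and> s' i = Some y} = r y"
    "\<And>i y. i < d \<Longrightarrow> s' i = Some y \<Longrightarrow> y \<in> Y"
    "real (card {i. i < d \<and> s' i \<noteq> s i}) \<le> (\<Sum>y\<in>Y. real (card {i. i < d \<and> s i = Some y}) - real (r y))"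
proof -
  define C where "C y = {i. i < d \<and> s i = Some y}" for y
  have fC: "finite (C y)" for y by (simp add: C_def)
  have "\<exists>A. A \<subseteq> C y \<and> card A = r y" if "y \<in> Y" for y
    using r[OF that] by (metis C_def obtain_subset_with_card_n)
  then obtain A where A: "\<And>y. y \<in> Y \<Longrightarrow> A y \<subseteq> C y \<and> card (A y) = r y" by metis
  define s' where "s' i = (case s i of None \<Rightarrow> None | Some y \<Rightarrow> if i \<in> A y then Some y else None)" for i
  have 1: "s' i = None \<or> s' i = s i" for i by (simp add: s'_def split: option.split)
  have 2: "card {i. i < d \<and> s' i = Some y} = r y" if y: "y \<in> Y" for y
  proof -
    have "{i. i < d \<and> s' i = Some y} = A y"
      using A[OF y] by (auto simp: s'_def C_def split: option.splits if_splits)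
    then show ?thesis using A[OF y] by simp
  qed
  have 3: "y \<in> Y" if "i < d" "s' i = Some y" for i y
    using sY[of i y] that 1[of i] by auto
  have "{i. i < d \<and> s' i \<noteq> s i} \<subseteq> (\<Union>y\<in>Y. C y - A y)"
    using sY by (auto simp: s'_def C_def split: option.splits)
  then have "card {i. i < d \<and> s' i \<noteq> s i} \<le> card (\<Union>y\<in>Y. C y - A y)"
    by (intro card_mono) (use Y fC in auto)
  also have "\<dots> \<le> (\<Sum>y\<in>Y. card (C y - A y))" by (rule card_UN_le[OF Y])
  finally have "real (card {i. i < d \<and> s' i \<noteq> s i}) \<le> (\<Sum>y\<in>Y. real (card (C y - A y)))"
    by (simp flip: of_nat_sum)
  also have "\<dots> = (\<Sum>y\<in>Y. real (card (C y)) - real (r y))"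
  proof (rule sum.cong[OF refl])
    fix y assume y: "y \<in> Y"
    have "A y \<subseteq> C y" using A[OF y] by simp
    moreover from this have "finite (A y)" using fC by (rule finite_subset)
    ultimately have "card (C y - A y) = card (C y) - r y"
      using A[OF y] by (simp add: card_Diff_subset)
    moreover have "r y \<le> card (C y)" using r[OF y] by (simp add: C_def)
    ultimately show "real (card (C y - A y)) = real (card (C y)) - real (r y)" by simp
  qed
  finally show ?thesis using 1 2 3 by (intro that[of s']) (simp_all add: C_def)
qed

section \<open>Doubly stochastic matrices as couplings\<close>

text \<open>The entry \<open>p i j\<close> is the mass moved from the source \<open>j\<close> to the target \<open>i\<close>. Both marginals being the
  counting measure, a relation between the labels of sources and targets that holds up to small
  mass compares cardinalities.\<close>

locale doubly_stochastic =
  fixes d :: nat and p :: "nat \<Rightarrow> nat \<Rightarrow> real"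
  assumes nonneg: "\<And>i j. 0 \<le> p i j"
    and rows: "\<And>i. i < d \<Longrightarrow> (\<Sum>j<d. p i j) = 1"
    and cols: "\<And>j. j < d \<Longrightarrow> (\<Sum>i<d. p i j) = 1"
begin

definition mass :: "(nat \<Rightarrow> nat \<Rightarrow> bool) \<Rightarrow> real" where
  "mass Q = (\<Sum>i<d. \<Sum>j<d. if Q i j then p i j else 0)"

lemma mass_nonneg: "0 \<le> mass Q"
  by (auto simp: mass_def nonneg intro!: sum_nonneg)

lemma mass_mono:
  assumes "\<And>i j. i < d \<Longrightarrow> j < d \<Longrightarrow> Q i j \<Longrightarrow> R i j"
  shows "mass Q \<le> mass R"
  unfolding mass_def using assms by (intro sum_mono) (auto simp: nonneg)

lemma mass_disj: "mass (\<lambda>i j. Q i j \<or> R i j) \<le> mass Q + mass R"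
  unfolding mass_def sum.distrib[symmetric] by (intro sum_mono) (auto simp: nonneg)

lemma mass_target: "mass (\<lambda>i j. A i) = card {i. i < d \<and> A i}"
proof -
  have "mass (\<lambda>i j. A i) = (\<Sum>i<d. if A i then 1 else 0)"
    unfolding mass_def using rows by (intro sum.cong) auto
  also have "\<dots> = real (card ({..<d} \<inter> {i. A i}))" by (simp add: sum.If_cases)
  also have "{..<d} \<inter> {i. A i} = {i. i < d \<and> A i}" by auto
  finally show ?thesis .
qed

lemma mass_source: "mass (\<lambda>i j. A j) = card {j. j < d \<and> A j}"
proof -
  have "mass (\<lambda>i j. A j) = (\<Sum>j<d. if A j then 1 else 0)"
    unfolding mass_def by (subst sum.swap) (use cols in \<open>auto intro!: sum.cong\<close>)
  also have "\<dots> = real (card ({..<d} \<inter> {i. A i}))" by (simp add: sum.If_cases)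
  also have "{..<d} \<inter> {i. A i} = {i. i < d \<and> A i}" by auto
  finally show ?thesis .
qed

lemma count_source_le:
  assumes "\<And>i j. i < d \<Longrightarrow> j < d \<Longrightarrow> A j \<Longrightarrow> B i \<or> R i j"
  shows "real (card {j. j < d \<and> A j}) \<le> real (card {i. i < d \<and> B i}) + mass R"
proof -
  have "mass (\<lambda>i j. A j) \<le> mass (\<lambda>i j. B i \<or> R i j)" using assms by (intro mass_mono)
  also have "\<dots> \<le> mass (\<lambda>i j. B i) + mass R" by (rule mass_disj)
  finally show ?thesis by (simp only: mass_source mass_target)
qed

lemma count_target_le:
  assumes "\<And>i j. i < d \<Longrightarrow> j < d \<Longrightarrow> A i \<Longrightarrow> B j \<or> R i j"
  shows "real (card {i. i < d \<and> A i}) \<le> real (card {j. j < d \<and> B j}) + mass R"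
proof -
  have "mass (\<lambda>i j. A i) \<le> mass (\<lambda>i j. B j \<or> R i j)" using assms by (intro mass_mono)
  also have "\<dots> \<le> mass (\<lambda>i j. B j) + mass R" by (rule mass_disj)
  finally show ?thesis by (simp only: mass_source mass_target)
qed

lemma sum_mass_le:
  assumes "\<And>y i j. y \<in> Y \<Longrightarrow> i < d \<Longrightarrow> j < d \<Longrightarrow> Q y i j \<Longrightarrow> R i j \<and> y = f i j" and Y: "finite Y"
  shows "(\<Sum>y\<in>Y. mass (Q y)) \<le> mass R"
proof -
  have "(\<Sum>y\<in>Y. mass (Q y)) = (\<Sum>i<d. \<Sum>y\<in>Y. \<Sum>j<d. if Q y i j then p i j else 0)"
    unfolding mass_def by (rule sum.swap)
  also have "\<dots> = (\<Sum>i<d. \<Sum>j<d. \<Sum>y\<in>Y. if Q y i j then p i j else 0)"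
    by (rule sum.cong[OF refl], rule sum.swap)
  also have "\<dots> \<le> mass R"
    unfolding mass_def
  proof (intro sum_mono)
    fix i j assume ij: "i \<in> {..<d}" "j \<in> {..<d}"
    have "(\<Sum>y\<in>Y. if Q y i j then p i j else 0) \<le> (\<Sum>y\<in>Y. if y = f i j then (if R i j then p i j else 0) else 0)"
      by (rule sum_mono) (use assms(1) ij nonneg in auto)
    also have "\<dots> \<le> (if R i j then p i j else 0)" using Y nonneg by simp
    finally show "(\<Sum>y\<in>Y. if Q y i j then p i j else 0) \<le> (if R i j then p i j else 0)" .
  qed
  finally show ?thesis .
qed

text \<open>If mass leaves a label only towards its successor, up to the error sets, then consecutive
  multiplicities agree up to the mass of these sets; summing over labels costs nothing since the
  errors of different labels are disjoint.\<close>

lemma count_defect: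
  fixes s :: "nat \<Rightarrow> 's option"
  assumes fwd: "\<And>y i j. y \<in> Y \<Longrightarrow> i < d \<Longrightarrow> j < d \<Longrightarrow> s j = Some y \<Longrightarrow> s i = Some (\<tau> y) \<or> R1 i j"
    and bwd: "\<And>y i j. y \<in> Y \<Longrightarrow> i < d \<Longrightarrow> j < d \<Longrightarrow> s i = Some (\<tau> y) \<Longrightarrow> s j = Some y \<or> R2 i j"
    and inj: "inj_on \<tau> Y" and Y: "finite Y"
  defines "c \<equiv> \<lambda>y. real (card {i. i < d \<and> s i = Some y})"
  shows "(\<Sum>y\<in>Y. \<bar>c y - c (\<tau> y)\<bar>) \<le> mass R1 + mass R2"
proof -
  have "\<bar>c y - c (\<tau> y)\<bar> \<le> mass (\<lambda>i j. s j = Some y \<and> R1 i j) + mass (\<lambda>i j. s i = Some (\<tau> y) \<and> R2 i j)"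
    if y: "y \<in> Y" for y
  proof -
    have "c y \<le> c (\<tau> y) + mass (\<lambda>i j. s j = Some y \<and> R1 i j)"
      unfolding c_def using fwd[OF y] by (intro count_source_le) auto
    moreover have "c (\<tau> y) \<le> c y + mass (\<lambda>i j. s i = Some (\<tau> y) \<and> R2 i j)"
      unfolding c_def using bwd[OF y] by (intro count_target_le) auto
    moreover note mass_nonneg[of "\<lambda>i j. s j = Some y \<and> R1 i j"] mass_nonneg[of "\<lambda>i j. s i = Some (\<tau> y) \<and> R2 i j"]
    ultimately show ?thesis by (simp only: abs_le_iff) linarith
  qed
  then have "(\<Sum>y\<in>Y. \<bar>c y - c (\<tau> y)\<bar>) \<le> (\<Sum>y\<in>Y. mass (\<lambda>i j. s j = Some y \<and> R1 i j))
      + (\<Sum>y\<in>Y. mass (\<lambda>i j. s i = Some (\<tau> y) \<and> R2 i j))"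
    unfolding sum.distrib[symmetric] by (rule sum_mono)
  also have "(\<Sum>y\<in>Y. mass (\<lambda>i j. s j = Some y \<and> R1 i j)) \<le> mass R1"
    by (rule sum_mass_le[where f = "\<lambda>i j. the (s j)", OF _ Y]) auto
  also have "(\<Sum>y\<in>Y. mass (\<lambda>i j. s i = Some (\<tau> y) \<and> R2 i j)) \<le> mass R2"
    by (rule sum_mass_le[where f = "\<lambda>i j. the_inv_into Y \<tau> (the (s i))", OF _ Y])
      (auto simp: the_inv_into_f_f[OF inj])
  finally show ?thesis by simp
qed

end

lemma relabelled_fibers:
  fixes s' :: "nat \<Rightarrow> 's option"
  assumes sY: "\<And>i y. i < d \<Longrightarrow> s' i = Some y \<Longrightarrow> y \<in> Y"
    and b: "bij_betw \<tau> Y Y"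
    and eq: "\<And>y. y \<in> Y \<Longrightarrow> card {i. i < d \<and> s' i = Some (\<tau> y)} = card {i. i < d \<and> s' i = Some y}"
  shows "card {i. i < d \<and> s' i = z} = card {j. j < d \<and> map_option \<tau> (s' j) = z}"
proof (cases z)
  case None
  then show ?thesis by simp
next
  case (Some w)
  show ?thesis
  proof (cases "w \<in> Y")
    case True
    then obtain y where y: "y \<in> Y" "w = \<tau> y" using b by (auto simp: bij_betw_def)
    have "{j. j < d \<and> map_option \<tau> (s' j) = z} = {j. j < d \<and> s' j = Some y}"
      using sY b y Some by (auto simp: bij_betw_def inj_on_def)
    then show ?thesis using eq[OF y(1)] y Some by simp
  next
    case False
    have "{i. i < d \<and> s' i = z} = {}" using sY False Some by auto
    moreover have "{j. j < d \<and> map_option \<tau> (s' j) = z} = {}"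
      using sY False Some b by (auto simp: bij_betw_def)
    ultimately show ?thesis by (simp only:)
  qed
qed

section \<open>Markers and cyclic states\<close>

lemma exists_slow_scale:
  fixes m :: "nat \<Rightarrow> nat"
  assumes dec: "\<And>r. m (Suc r) \<le> m r" and m0: "m 0 \<le> d" and R: "0 < R"
  shows "\<exists>r<R. R * (m r - m (Suc r)) \<le> d"
proof (rule ccontr)
  assume "\<not> ?thesis"
  then have *: "d < R * (m r - m (Suc r))" if "r < R" for r using that by (meson not_le)
  have "(\<Sum>r<k. m r - m (Suc r)) + m k = m 0" for k
  proof (induction k)
    case (Suc k)
    then show ?case using dec[of k] by simp
  qed simp
  from this[of R] have "(\<Sum>r<R. m r - m (Suc r)) \<le> d" using m0 by simp
  then have "R * (\<Sum>r<R. m r - m (Suc r)) \<le> R * d" by (rule mult_le_mono2)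
  moreover have "(\<Sum>r<R. d) < (\<Sum>r<R. R * (m r - m (Suc r)))"
    using R * by (intro sum_strict_mono) auto
  ultimately show False by (simp add: sum_distrib_left)
qed

text \<open>The set \<open>Z\<close> minimises \<open>F Z = n * cuts + uncovered\<close>. Comparison with the empty set bounds the cuts
  by \<open>d / n\<close>. Comparison with \<open>insert w Z\<close> shows that the number of uncovered sequences in which \<open>w\<close>
  occurs is at most \<open>n\<close> times the number of occurrences of \<open>w\<close> at \<open>0\<close>; summing over all words \<open>w\<close>,
  every uncovered sequence is counted \<open>n\<^sup>2\<close> times, because its \<open>n\<^sup>2\<close> words are distinct.\<close>

lemma exists_marker_words:
  fixes x :: "nat \<Rightarrow> int \<Rightarrow> 'a :: finite"
  assumes n: "0 < n"
  shows "\<exists>Z. n * card {i. i < d \<and> word k (x i) \<in> Z} \<le> d \<and>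
    n * card {i. i < d \<and> inj_on (\<lambda>j. word k (shift j (x i))) {1..int (n\<^sup>2)} \<and>
      (\<forall>j\<in>{1..int (n\<^sup>2)}. word k (shift j (x i)) \<notin> Z)} \<le> d"
proof -
  define W where "W = {w :: 'a list. length w = k}"
  have fW: "finite W" using finite_lists_length_eq[of "UNIV :: 'a set" k] by (simp add: W_def)
  have wdW: "word k y \<in> W" for y :: "int \<Rightarrow> 'a" by (simp add: W_def word_def)
  define J where "J = {1..int (n\<^sup>2)}"
  have J: "finite J" "card J = n\<^sup>2"
    unfolding J_def by (simp, simp only: card_atLeastAtMost_int add_diff_cancel_right' nat_int)
  define cut where "cut Z = {i. i < d \<and> word k (x i) \<in> Z}" for Z
  define unc where "unc Z = {i. i < d \<and> inj_on (\<lambda>j. word k (shift j (x i))) J \<and> (\<forall>j\<in>J. word k (shift j (x i)) \<notin> Z)}" for Z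
  have fin: "finite (cut Z)" "finite (unc Z)" for Z by (simp_all add: cut_def unc_def)
  define F where "F Z = n * card (cut Z) + card (unc Z)" for Z
  obtain Z where Z: "Z \<in> Pow W" "\<And>Z'. Z' \<in> Pow W \<Longrightarrow> F Z \<le> F Z'"
  proof -
    have ne: "F ` Pow W \<noteq> {}" "finite (F ` Pow W)" using fW by auto
    then have "Min (F ` Pow W) \<in> F ` Pow W" by (intro Min_in)
    then obtain Z where ZW: "Z \<in> Pow W" and Zmin: "F Z = Min (F ` Pow W)" by force
    have "F Z \<le> F Z'" if "Z' \<in> Pow W" for Z'
      unfolding Zmin using ne that by (intro Min_le) auto
    then show ?thesis by (rule that[OF ZW])
  qed
  have "F Z \<le> F {}" by (rule Z) simp
  also have "F {} \<le> d"
  proof -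
    have "card (unc {}) \<le> card {..<d}" by (rule card_mono) (auto simp: unc_def)
    then show ?thesis by (simp add: F_def cut_def)
  qed
  finally have "F Z \<le> d" .
  then have 1: "n * card (cut Z) \<le> d" by (simp add: F_def)
  define hit where "hit w = {i \<in> unc Z. \<exists>j\<in>J. word k (shift j (x i)) = w}" for w
  define occ where "occ w = {i. i < d \<and> word k (x i) = w}" for w
  have hit_le: "card (hit w) \<le> n * card (occ w)" if w: "w \<in> W" for w
  proof -
    have "F Z \<le> F (insert w Z)" using Z(1) w by (intro Z) auto
    also have "\<dots> \<le> n * (card (cut Z) + card (occ w)) + (card (unc Z) - card (hit w))"
      unfolding F_def
    proof (intro add_mono mult_le_mono2)
      have "cut (insert w Z) = cut Z \<union> occ w" by (auto simp: cut_def occ_def)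
      then show "card (cut (insert w Z)) \<le> card (cut Z) + card (occ w)" by (simp add: card_Un_le)
      have "unc (insert w Z) = unc Z - hit w" by (auto simp: unc_def hit_def)
      then show "card (unc (insert w Z)) \<le> card (unc Z) - card (hit w)"
        using fin by (subst card_Diff_subset[symmetric]) (auto simp: hit_def)
    qed
    finally have "F Z \<le> n * (card (cut Z) + card (occ w)) + (card (unc Z) - card (hit w))" .
    moreover have "card (hit w) \<le> card (unc Z)" using fin by (intro card_mono) (auto simp: hit_def)
    ultimately show ?thesis by (simp add: F_def algebra_simps)
  qed
  have "(\<Sum>w\<in>W. card (occ w)) = d"
  proof -
    have "(\<Sum>w\<in>W. card (occ w)) = card (\<Union>w\<in>W. occ w)"
      using fW by (intro card_UN_disjoint[symmetric]) (auto simp: occ_def)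
    also have "(\<Union>w\<in>W. occ w) = {..<d}" using wdW by (auto simp: occ_def)
    finally show ?thesis by simp
  qed
  moreover have "(\<Sum>w\<in>W. card (hit w)) = n\<^sup>2 * card (unc Z)"
  proof -
    have "(\<Sum>w\<in>W. card (hit w)) = (\<Sum>w\<in>W. \<Sum>i\<in>unc Z. if \<exists>j\<in>J. word k (shift j (x i)) = w then 1 else 0)"
      using fin by (simp add: hit_def sum.If_cases Int_def)
    also have "\<dots> = (\<Sum>i\<in>unc Z. \<Sum>w\<in>W. if \<exists>j\<in>J. word k (shift j (x i)) = w then 1 else 0)"
      by (rule sum.swap)
    also have "\<dots> = (\<Sum>i\<in>unc Z. n\<^sup>2)"
    proof (rule sum.cong[OF refl])
      fix i assume i: "i \<in> unc Z"
      have "(\<Sum>w\<in>W. if \<exists>j\<in>J. word k (shift j (x i)) = w then 1 else 0 :: nat)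
          = card (W \<inter> {w. \<exists>j\<in>J. word k (shift j (x i)) = w})"
        using fW by (simp add: sum.If_cases)
      also have "W \<inter> {w. \<exists>j\<in>J. word k (shift j (x i)) = w} = (\<lambda>j. word k (shift j (x i))) ` J"
        using wdW by auto
      also have "card \<dots> = card J" using i by (intro card_image) (simp add: unc_def)
      finally show "(\<Sum>w\<in>W. if \<exists>j\<in>J. word k (shift j (x i)) = w then 1 else 0 :: nat) = n\<^sup>2"
        using J by simp
    qed
    finally show ?thesis by simp
  qed
  moreover have "(\<Sum>w\<in>W. card (hit w)) \<le> n * (\<Sum>w\<in>W. card (occ w))"
    unfolding sum_distrib_left by (intro sum_mono hit_le)
  ultimately have "n * (n * card (unc Z)) \<le> n * d" by (simp add: power2_eq_square mult.assoc)
  then have "n * card (unc Z) \<le> d" using n by simp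
  with 1 show ?thesis by (intro exI[of _ Z]) (simp add: cut_def unc_def J_def)
qed

lemma advance_simps [simp]:
  "advance (0, i, v) = (0, 0, shift 1 v)"
  "h \<noteq> 0 \<Longrightarrow> advance (h, i, v) = (h, (i + 1) mod h, v)"
  by (simp_all add: advance_def)

lemma advance_funpow_per: "(advance ^^ k) (0, 0, v) = (0, 0, shift (int k) v)"
  by (induction k) simp_all

lemma advance_funpow_chain:
  assumes "0 < h" "0 \<le> i" "i < h"
  shows "(advance ^^ k) (h, i, v) = (h, (i + int k) mod h, v)"
proof (induction k)
  case 0
  then show ?case using assms by simp
next
  case (Suc k)
  have "(advance ^^ Suc k) (h, i, v) = advance (h, (i + int k) mod h, v)" using Suc by simp
  also have "\<dots> = (h, ((i + int k) mod h + 1) mod h, v)" using assms by (intro advance_simps) simp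
  also have "((i + int k) mod h + 1) mod h = (i + int k + 1) mod h" by (rule mod_add_left_eq)
  also have "i + int k + 1 = i + int (Suc k)" by simp
  finally show ?case .
qed

text \<open>No dynamics relates the last place of a piece to the first one, but the multiplicities at the
  two ends differ by at most the total variation along the piece.\<close>

lemma chain_defect_wrap:
  fixes c :: "'a state \<Rightarrow> real"
  assumes Y: "finite Y" "\<And>h i v. (h, i, v) \<in> Y \<Longrightarrow> 0 \<le> i \<and> i < h"
    and cl: "\<And>h i i' v. (h, i, v) \<in> Y \<Longrightarrow> 0 \<le> i' \<Longrightarrow> i' < h \<Longrightarrow> (h, i', v) \<in> Y"
  shows "(\<Sum>y\<in>Y. \<bar>c y - c (advance y)\<bar>) \<le> 2 * (\<Sum>y\<in>{y \<in> Y. fst (snd y) + 1 < fst y}. \<bar>c y - c (advance y)\<bar>)"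
proof -
  let ?\<Delta> = "\<lambda>y. \<bar>c y - c (advance y)\<bar>"
  define Nw where "Nw = {y \<in> Y. fst (snd y) + 1 < fst y}"
  define Wp where "Wp = {y \<in> Y. fst (snd y) + 1 = fst y}"
  define G where "G y = {z \<in> Nw. fst z = fst y \<and> snd (snd z) = snd (snd y)}" for y :: "'a state"
  have fin: "finite Nw" "finite Wp" "\<And>y. finite (G y)" using Y by (auto simp: Nw_def Wp_def G_def)
  have wrap: "?\<Delta> y \<le> sum ?\<Delta> (G y)" if "y \<in> Wp" for y
  proof -
    obtain h i v where y: "y = (h, i, v)" by (cases y)
    have yi: "(h, i, v) \<in> Y" "i + 1 = h" using that y by (auto simp: Wp_def)
    then have h: "0 < h" using Y(2) by fastforce
    have "advance y = (h, 0, v)" using yi h by (simp add: y)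
    moreover have "(advance ^^ nat i) (h, 0, v) = y"
      using h yi advance_funpow_chain[of h 0 "nat i" v] by (simp add: y)
    ultimately have "?\<Delta> y = \<bar>c (h, 0, v) - c ((advance ^^ nat i) (h, 0, v))\<bar>" by (simp add: abs_minus_commute)
    also have "\<dots> \<le> (\<Sum>m<nat i. ?\<Delta> ((advance ^^ m) (h, 0, v)))" by (rule funpow_telescope)
    also have "\<dots> = (\<Sum>m<nat i. ?\<Delta> (h, int m, v))"
      using h yi advance_funpow_chain[of h 0 _ v] by (intro sum.cong) auto
    also have "\<dots> = sum ?\<Delta> ((\<lambda>m. (h, int m, v)) ` {..<nat i})"
      by (subst sum.reindex) (auto simp: inj_on_def)
    also have "\<dots> \<le> sum ?\<Delta> (G y)"
    proof (rule sum_mono2[OF fin(3)])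
      show "(\<lambda>m. (h, int m, v)) ` {..<nat i} \<subseteq> G y"
        using yi cl[OF yi(1)] by (auto simp: G_def Nw_def y)
    qed simp
    finally show ?thesis .
  qed
  have "sum ?\<Delta> Wp \<le> (\<Sum>y\<in>Wp. sum ?\<Delta> (G y))" by (intro sum_mono wrap)
  also have "\<dots> = sum ?\<Delta> (\<Union>y\<in>Wp. G y)"
  proof (rule sum.UNION_disjoint[symmetric])
    show "\<forall>y\<in>Wp. \<forall>z\<in>Wp. y \<noteq> z \<longrightarrow> G y \<inter> G z = {}"
      by (auto simp: Wp_def G_def)
  qed (use fin in auto)
  also have "\<dots> \<le> sum ?\<Delta> Nw"
    by (rule sum_mono2) (use fin in \<open>auto simp: G_def\<close>)
  finally have "sum ?\<Delta> Wp \<le> sum ?\<Delta> Nw" .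
  moreover have "sum ?\<Delta> Y = sum ?\<Delta> Nw + sum ?\<Delta> Wp"
  proof -
    have "Y = Nw \<union> Wp" using Y(2) by (force simp: Nw_def Wp_def)
    moreover have "Nw \<inter> Wp = {}" by (auto simp: Nw_def Wp_def)
    ultimately show ?thesis using fin by (simp add: sum.union_disjoint)
  qed
  ultimately show ?thesis by (simp add: Nw_def)
qed

text \<open>The two-sided periodic sequence read off along the cycle through a state.\<close>

definition label_seq :: "'a state \<Rightarrow> int \<Rightarrow> 'a" where
  "label_seq s = (case s of (h, i, v) \<Rightarrow> \<lambda>n. if h = 0 then v n else v ((i + n) mod h))"

lemma label_seq_state_of:
  assumes "state_of M K Z H y = Some s" "0 \<le> K"
  shows "label_seq s 0 = y 0"
  using assms(1)
proof (cases rule: state_of_cases)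
  case 1
  then show ?thesis using is_per_ext_per_ext[OF 1(1)] assms(2) by (simp add: label_seq_def is_per_ext_def)
next
  case (2 h i)
  then show ?thesis by (simp add: label_seq_def chain_word_def)
qed

lemma label_seq_advance: "label_seq (advance s) = shift 1 (label_seq s)"
proof (cases s)
  case (fields h i v)
  show ?thesis
  proof (cases "h = 0")
    case False
    have "((i + 1) mod h + n) mod h = (i + (n + 1)) mod h" for n
      using mod_add_left_eq[of "i + 1" h n] by (simp only: add.assoc add.commute[of 1 n])
    then show ?thesis using False by (simp add: fields label_seq_def shift_def)
  qed (simp add: fields label_seq_def shift_def)
qed

section \<open>Periodic labelling of an approximate shift\<close>

text \<open>Up to the mass \<open>E\<close>, targets carry the shifted label of their sources on the window \<open>{-N..<N}\<close>.\<close>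

locale shift_coupling = doubly_stochastic d p for d p +
  fixes x :: "nat \<Rightarrow> int \<Rightarrow> 'a :: finite" and N :: int and E :: real
  assumes mismatch: "mass (\<lambda>i j. \<not> (\<forall>n. - N \<le> n \<longrightarrow> n < N \<longrightarrow> x i n = shift 1 (x j) n)) \<le> E"
begin

definition bad :: "nat \<Rightarrow> nat \<Rightarrow> bool" where
  "bad i j \<longleftrightarrow> \<not> (\<forall>n. - N \<le> n \<longrightarrow> n < N \<longrightarrow> x i n = shift 1 (x j) n)"

text \<open>Only such properties are transported by the coupling.\<close>

definition windowed :: "((int \<Rightarrow> 'a) \<Rightarrow> 'b) \<Rightarrow> bool" where
  "windowed P \<longleftrightarrow> (\<forall>y z. (\<forall>n. - N \<le> n \<longrightarrow> n < N \<longrightarrow> y n = z n) \<longrightarrow> P y = P z)"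

definition cnt :: "((int \<Rightarrow> 'a) \<Rightarrow> bool) \<Rightarrow> real" where
  "cnt P = real (card {i. i < d \<and> P (x i)})"

lemma mass_bad: "mass bad \<le> E"
  using mismatch by (simp add: bad_def[abs_def])

lemma E_nonneg: "0 \<le> E"
  using mass_nonneg[of bad] mass_bad by simp

lemma windowedD: "windowed P \<Longrightarrow> \<not> bad i j \<Longrightarrow> P (x i) = P (shift 1 (x j))"
  by (auto simp: windowed_def bad_def)

lemma cnt_le_shift:
  assumes "windowed P"
  shows "cnt P \<le> cnt (\<lambda>y. P (shift 1 y)) + E"
proof -
  have "cnt P \<le> cnt (\<lambda>y. P (shift 1 y)) + mass bad"
    unfolding cnt_def by (rule count_target_le) (use windowedD[OF assms] in blast)
  then show ?thesis using mass_bad by linarith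
qed

lemma cnt_shift_le:
  assumes "windowed P"
  shows "cnt (\<lambda>y. P (shift 1 y)) \<le> cnt P + E"
proof -
  have "cnt (\<lambda>y. P (shift 1 y)) \<le> cnt P + mass bad"
    unfolding cnt_def by (rule count_source_le) (use windowedD[OF assms] in blast)
  then show ?thesis using mass_bad by linarith
qed

lemma cnt_le_shifts:
  assumes "\<And>m. m < k \<Longrightarrow> windowed (\<lambda>y. P (shift (int m) y))"
  shows "cnt P \<le> cnt (\<lambda>y. P (shift (int k) y)) + real k * E"
  using assms
proof (induction k)
  case (Suc k)
  have "cnt (\<lambda>y. P (shift (int k) y)) \<le> cnt (\<lambda>y. P (shift (int k) (shift 1 y))) + E"
    by (rule cnt_le_shift) (rule Suc.prems, simp)
  also have "(\<lambda>y. P (shift (int k) (shift 1 y))) = (\<lambda>y. P (shift (int (Suc k)) y))"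
    by (simp add: add.commute)
  finally show ?case using Suc by (simp add: algebra_simps)
qed simp

lemma cnt_mono: "(\<And>y. P y \<Longrightarrow> Q y) \<Longrightarrow> cnt P \<le> cnt Q"
  unfolding cnt_def by (intro of_nat_mono card_mono) auto

lemma cnt_disj: "cnt (\<lambda>y. P y \<or> Q y) \<le> cnt P + cnt Q"
proof -
  have "{i. i < d \<and> (P (x i) \<or> Q (x i))} = {i. i < d \<and> P (x i)} \<union> {i. i < d \<and> Q (x i)}" by auto
  then show ?thesis unfolding cnt_def by (simp only: of_nat_add[symmetric] of_nat_le_iff card_Un_le)
qed

lemma cnt_split: "cnt P = cnt (\<lambda>y. P y \<and> Q y) + cnt (\<lambda>y. P y \<and> \<not> Q y)"
proof -
  have "{i. i < d \<and> P (x i)} = {i. i < d \<and> P (x i) \<and> Q (x i)} \<union> {i. i < d \<and> P (x i) \<and> \<not> Q (x i)}" by auto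
  then have "card {i. i < d \<and> P (x i)}
      = card {i. i < d \<and> P (x i) \<and> Q (x i)} + card {i. i < d \<and> P (x i) \<and> \<not> Q (x i)}"
    by (simp only:) (intro card_Un_disjoint, auto)
  then show ?thesis by (simp add: cnt_def)
qed

text \<open>Being periodic on the larger window \<open>{-(K+1)..K+1}\<close> survives a shift by one as periodicity on
  \<open>{-K..K}\<close>. A slow decrease in \<open>K\<close> therefore makes transitions between the regimes rare.\<close>

lemma per_transitions:
  assumes K: "0 \<le> K" "K < N" and slow: "cnt (per M K) - cnt (per M (K + 1)) \<le> \<beta>"
  shows "cnt (\<lambda>y. per M K y \<and> \<not> per M K (shift 1 y)) \<le> \<beta>"
    and "cnt (\<lambda>y. \<not> per M K y \<and> per M K (shift 1 y)) \<le> \<beta> + E"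
proof -
  have both: "per M K y \<and> per M K (shift 1 y)" if "per M (K + 1) y" for y :: "int \<Rightarrow> 'a"
    using per_shrink[OF _ that, of 0] per_shrink[OF _ that, of 1] by simp
  have le: "cnt (per M (K + 1)) \<le> cnt (\<lambda>y. per M K y \<and> per M K (shift 1 y))"
    by (rule cnt_mono) (rule both)
  show "cnt (\<lambda>y. per M K y \<and> \<not> per M K (shift 1 y)) \<le> \<beta>"
    using cnt_split[of "per M K" "\<lambda>y. per M K (shift 1 y)"] le slow by linarith
  have "windowed (per M K)"
    unfolding windowed_def using K by (intro allI impI per_local) auto
  then have "cnt (\<lambda>y. per M K (shift 1 y)) \<le> cnt (per M K) + E" by (rule cnt_shift_le)
  moreover have "cnt (\<lambda>y. per M K (shift 1 y))
      = cnt (\<lambda>y. per M K y \<and> per M K (shift 1 y)) + cnt (\<lambda>y. \<not> per M K y \<and> per M K (shift 1 y))"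
    using cnt_split[of "\<lambda>y. per M K (shift 1 y)" "per M K"] by (simp add: conj_commute)
  ultimately show "cnt (\<lambda>y. \<not> per M K y \<and> per M K (shift 1 y)) \<le> \<beta> + E"
    using le slow by linarith
qed

lemma is_cut_count:
  assumes K: "0 \<le> K" "2 * K < N"
    and cut: "cnt (\<lambda>y. word (nat (2 * K + 1)) y \<in> Z) \<le> \<gamma>"
    and slow: "cnt (per M K) - cnt (per M (K + 1)) \<le> \<beta>"
  shows "cnt (\<lambda>y. is_cut M K Z (shift 1 y)) \<le> \<gamma> + 2 * \<beta> + 2 * E"
proof -
  have "cnt (\<lambda>y. is_cut M K Z (shift 1 y)) \<le> cnt (\<lambda>y. word (nat (2 * K + 1)) (shift 1 y) \<in> Z \<or>
      (per M K y \<and> \<not> per M K (shift 1 y) \<or> \<not> per M K y \<and> per M K (shift 1 y)))"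
    by (rule cnt_mono) (auto simp: is_cut_def)
  also have "\<dots> \<le> cnt (\<lambda>y. word (nat (2 * K + 1)) (shift 1 y) \<in> Z) +
      cnt (\<lambda>y. per M K y \<and> \<not> per M K (shift 1 y) \<or> \<not> per M K y \<and> per M K (shift 1 y))"
    by (rule cnt_disj)
  also have "cnt (\<lambda>y. per M K y \<and> \<not> per M K (shift 1 y) \<or> \<not> per M K y \<and> per M K (shift 1 y))
      \<le> cnt (\<lambda>y. per M K y \<and> \<not> per M K (shift 1 y)) + cnt (\<lambda>y. \<not> per M K y \<and> per M K (shift 1 y))"
    by (rule cnt_disj)
  also have "\<dots> \<le> \<beta> + (\<beta> + E)"
    using K by (intro add_mono per_transitions[OF _ _ slow]) auto
  also have "cnt (\<lambda>y. word (nat (2 * K + 1)) (shift 1 y) \<in> Z) \<le> cnt (\<lambda>y. word (nat (2 * K + 1)) y \<in> Z) + E"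
  proof (rule cnt_shift_le)
    have "word (nat (2 * K + 1)) y = word (nat (2 * K + 1)) z"
      if "\<forall>n. - N \<le> n \<longrightarrow> n < N \<longrightarrow> y n = z n" for y z :: "int \<Rightarrow> 'a"
      using that K by (auto simp: word_eq_iff)
    then show "windowed (\<lambda>y. word (nat (2 * K + 1)) y \<in> Z)"
      unfolding windowed_def by metis
  qed
  finally show ?thesis using cut by linarith
qed

text \<open>A sequence without a state has no cut for a long time ahead or for a long time back. In the first
  case it avoids the markers along distinct words; the second case is a translate of the first.\<close>

lemma unlabelled_count:
  assumes M: "0 < M" "M \<le> K" and N: "2 * (M + K) + 2 * K + 2 \<le> N"
    and U: "cnt (\<lambda>y. inj_on (\<lambda>j. word (nat (2 * K + 1)) (shift j y)) {1..M} \<and>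
      (\<forall>j\<in>{1..M}. word (nat (2 * K + 1)) (shift j y) \<notin> Z)) \<le> \<gamma>"
  shows "cnt (\<lambda>y. state_of M K Z (2 * (M + K)) y = None) \<le> 2 * \<gamma> + real_of_int (M + K) * E"
proof -
  define L where "L = M + K"
  have L: "0 < L" using M by (simp add: L_def)
  define F where "F y \<longleftrightarrow> \<not> per M K y \<and> (\<forall>j. 1 \<le> j \<longrightarrow> j \<le> L \<longrightarrow> \<not> is_cut M K Z (shift j y))" for y :: "int \<Rightarrow> 'a"
  define B where "B y \<longleftrightarrow> \<not> per M K y \<and> (\<forall>j. 0 \<le> j \<longrightarrow> j < L \<longrightarrow> \<not> is_cut M K Z (shift (- j) y))" for y :: "int \<Rightarrow> 'a"
  have F: "cnt F \<le> \<gamma>"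
  proof -
    have "cnt F \<le> cnt (\<lambda>y. inj_on (\<lambda>j. word (nat (2 * K + 1)) (shift j y)) {1..M} \<and>
      (\<forall>j\<in>{1..M}. word (nat (2 * K + 1)) (shift j y) \<notin> Z))"
    proof (rule cnt_mono)
      fix y assume "F y"
      then have np: "\<not> per M K y" and nb: "\<And>j. 1 \<le> j \<Longrightarrow> j \<le> M + K \<Longrightarrow> \<not> is_cut M K Z (shift j y)"
        by (auto simp: F_def L_def)
      have "0 \<le> K" using M by simp
      from uncut_distinct_words[OF np nb this]
      show "inj_on (\<lambda>j. word (nat (2 * K + 1)) (shift j y)) {1..M} \<and>
        (\<forall>j\<in>{1..M}. word (nat (2 * K + 1)) (shift j y) \<notin> Z)" by auto
    qed
    then show ?thesis using U by linarith
  qed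
  have BF: "F y" if B: "B (shift L y)" for y
  proof -
    have nb: "\<not> is_cut M K Z (shift j y)" if "0 < j" "j \<le> L" for j
    proof -
      have "\<not> is_cut M K Z (shift (- (L - j)) (shift L y))" using B that unfolding B_def by (metis diff_ge_0_iff_ge diff_less_eq less_add_same_cancel1)
      then show ?thesis by simp
    qed
    have "per M K (shift L y) = per M K (shift 0 y)"
      by (rule not_is_cut_per[where Z = Z]) (use nb L in auto)
    moreover have "\<not> per M K (shift L y)" using B by (simp add: B_def)
    ultimately show ?thesis using nb by (simp add: F_def)
  qed
  have win: "windowed (\<lambda>y. B (shift (int m) y))" if m: "m < nat L" for m
    unfolding windowed_def
  proof (intro allI impI)
    fix y z :: "int \<Rightarrow> 'a" assume yz: "\<forall>n. - N \<le> n \<longrightarrow> n < N \<longrightarrow> y n = z n"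
    have mL: "int m < L" using m by simp
    have "per M K (shift (int m) y) = per M K (shift (int m) z)"
      by (rule per_local) (use yz N mL M L_def in \<open>auto simp: shift_def\<close>)
    moreover have "is_cut M K Z (shift (- j) (shift (int m) y)) = is_cut M K Z (shift (- j) (shift (int m) z))"
      if "0 \<le> j" "j < L" for j
      by (rule is_cut_local) (use yz N mL M L_def that in \<open>auto simp: shift_def\<close>)
    ultimately show "B (shift (int m) y) = B (shift (int m) z)" unfolding B_def by (metis (no_types, lifting))
  qed
  have "cnt B \<le> cnt (\<lambda>y. B (shift (int (nat L)) y)) + real (nat L) * E"
    by (rule cnt_le_shifts) (rule win)
  also have "cnt (\<lambda>y. B (shift (int (nat L)) y)) \<le> cnt F"
    by (rule cnt_mono) (use BF L in simp)
  finally have B: "cnt B \<le> \<gamma> + real_of_int L * E" using F L by simp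
  have "cnt (\<lambda>y. state_of M K Z (2 * (M + K)) y = None) \<le> cnt (\<lambda>y. F y \<or> B y)"
    by (rule cnt_mono) (use state_of_None_cases[of M K Z L] L in \<open>auto simp: F_def B_def L_def\<close>)
  also have "\<dots> \<le> cnt F + cnt B" by (rule cnt_disj)
  finally show ?thesis using F B by (simp add: L_def)
qed

end

lemma shift_inject: "shift k u = shift k v \<longleftrightarrow> u = v"
proof
  assume "shift k u = shift k v"
  then have "shift (- k) (shift k u) = shift (- k) (shift k v)" by (simp only:)
  then show "u = v" by simp
qed simp

lemma shift_periodic: "periodic p u \<Longrightarrow> shift p u = u"
  by (simp add: shift_def periodic_def)

lemma shift_periodic_mod:
  assumes "periodic p u"
  shows "shift k u = shift (k mod p) u"
proof
  fix n
  have "n + k = n + k mod p + k div p * p" by simp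
  then show "shift k u n = shift (k mod p) u n"
    using periodic_mult[OF assms, of "n + k mod p" "k div p"] by (metis shift_apply)
qed

context shift_coupling
begin

text \<open>The parameters are \<open>M = n\<^sup>2\<close>, a scale \<open>K\<close> between \<open>n\<^sup>2\<close> and \<open>2n\<^sup>3\<close> at which the periodic regime is
  stable up to \<open>d / n\<^sup>3\<close>, and pieces of length at most \<open>6n\<^sup>3\<close>. Periodic orbits have length at most \<open>n\<^sup>2\<close>,
  so their transition error \<open>d / n\<^sup>3\<close> may be multiplied by \<open>n\<^sup>2\<close> during the equalisation; pieces are
  much longer, but inside them the only error is \<open>E \<le> d / n\<^sup>4\<close>. All contributions are then of order
  \<open>d / n\<close>.\<close>

theorem periodic_labelling:
  assumes n: "0 < n" and N: "12 * int n ^ 3 \<le> N" and En: "E * real n ^ 4 \<le> real d"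
  obtains s' :: "nat \<Rightarrow> 'a state option" where
    "\<And>z. card {i. i < d \<and> s' i = z} = card {j. j < d \<and> map_option advance (s' j) = z}"
    "mass (\<lambda>i j. s' i \<noteq> map_option advance (s' j)) \<le> 70 * real d / real n"
    "real (card {i. i < d \<and> s' i = None}) \<le> 34 * real d / real n"
    "\<And>i w. i < d \<Longrightarrow> s' i = Some w \<Longrightarrow> label_seq w 0 = x i 0"
proof -
  define M where "M = int (n\<^sup>2)"
  have M1: "0 < M" using n by (simp add: M_def)
  define m where "m r = card {i. i < d \<and> per M (M + int r) (x i)}" for r
  have "m (Suc r) \<le> m r" for r
  proof -
    have "per M (M + int r) y" if "per M (M + int (Suc r)) y" for y :: "int \<Rightarrow> 'a"
      using per_shrink[of 0 M "M + int r" y] that by (simp add: add.commute add.left_commute)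
    then show ?thesis unfolding m_def by (intro card_mono) auto
  qed
  moreover have "m 0 \<le> d"
  proof -
    have "m 0 \<le> card {..<d}" unfolding m_def by (rule card_mono) auto
    then show ?thesis by simp
  qed
  moreover have "0 < n ^ 3" using n by simp
  ultimately obtain r where r: "r < n ^ 3" "n ^ 3 * (m r - m (Suc r)) \<le> d"
    using exists_slow_scale[of m d "n ^ 3"] by blast
  define K where "K = M + int r"
  have MK: "M \<le> K" by (simp add: K_def)
  \<comment> \<open>This length makes a repeated word contain a whole window \<open>{-K..K}\<close>.\<close>
  define k where "k = nat (2 * K + 1)"
  define D where "D = real d / real n"
  have n0: "0 < real n" using n by simp
  have D0: "0 \<le> D" by (simp add: D_def)
  have M3: "M \<le> int n ^ 3"
  proof -
    have "n\<^sup>2 \<le> n ^ 3" using n by (intro power_increasing) auto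
    then show ?thesis unfolding M_def by (metis of_nat_le_iff of_nat_power)
  qed
  have K3: "K \<le> 2 * int n ^ 3"
  proof -
    have "int r \<le> int n ^ 3" using r(1) by (metis less_imp_le of_nat_le_iff of_nat_power)
    then show ?thesis using M3 unfolding K_def by linarith
  qed
  have n3: "1 \<le> int n ^ 3" using n by simp
  define H where "H = 2 * (M + K)"
  have H3: "H \<le> 6 * int n ^ 3" using M3 K3 by (simp add: H_def)
  have H0: "0 \<le> H" using M1 MK by (simp add: H_def)
  have win: "H + 2 * K + 2 \<le> N" using H3 K3 N n3 by linarith
  have K0: "0 \<le> K" "2 * K < N" "K < N" using M1 MK win H0 by auto
  define \<beta> where "\<beta> = real d / real n ^ 3"
  \<comment> \<open>Among \<open>n\<^sup>3\<close> scales, some step of the decreasing count is at most \<open>d / n\<^sup>3\<close>.\<close>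
  have slow: "cnt (per M K) - cnt (per M (K + 1)) \<le> \<beta>"
  proof -
    have "cnt (per M K) - cnt (per M (K + 1)) = real (m r) - real (m (Suc r))"
      by (simp add: cnt_def m_def K_def add.commute add.left_commute)
    also have "\<dots> \<le> real (m r - m (Suc r))" by simp
    also have "\<dots> \<le> \<beta>"
    proof -
      have "real (n ^ 3 * (m r - m (Suc r))) \<le> real d" using r(2) by (simp only: of_nat_le_iff)
      then show ?thesis unfolding \<beta>_def using n0 by (simp add: pos_le_divide_eq mult.commute)
    qed
    finally show ?thesis .
  qed
  obtain Z where Z1: "n * card {i. i < d \<and> word k (x i) \<in> Z} \<le> d"
    and Z2: "n * card {i. i < d \<and> inj_on (\<lambda>j. word k (shift j (x i))) {1..int (n\<^sup>2)} \<and>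
      (\<forall>j\<in>{1..int (n\<^sup>2)}. word k (shift j (x i)) \<notin> Z)} \<le> d"
    using exists_marker_words[OF n, of d k x] by blast
  have divn: "real c \<le> D" if "n * c \<le> d" for c
  proof -
    have "real (n * c) \<le> real d" using that by (simp only: of_nat_le_iff)
    then show ?thesis unfolding D_def using n0 by (simp add: pos_le_divide_eq mult.commute)
  qed
  have cut: "cnt (\<lambda>y. word (nat (2 * K + 1)) y \<in> Z) \<le> D"
    unfolding cnt_def using divn[OF Z1] by (simp add: k_def)
  have unc: "cnt (\<lambda>y. inj_on (\<lambda>j. word (nat (2 * K + 1)) (shift j y)) {1..M} \<and>
      (\<forall>j\<in>{1..M}. word (nat (2 * K + 1)) (shift j y) \<notin> Z)) \<le> D"
    unfolding cnt_def using divn[OF Z2] by (simp add: k_def M_def)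
  \<comment> \<open>From here on all errors are compared with \<open>D = d / n\<close>.\<close>
  have pw: "real n ^ 4 = real n * real n ^ 3" by (simp add: eval_nat_numeral)
  have E3: "real n ^ 3 * E \<le> D"
    unfolding D_def using En n0 by (simp add: pos_le_divide_eq pw mult_ac)
  have E1: "E \<le> D"
  proof -
    have "1 \<le> real n ^ 3" using n by simp
    then have "1 * E \<le> real n ^ 3 * E" using E_nonneg by (intro mult_right_mono)
    then show ?thesis using E3 by simp
  qed
  have n2E: "(real n)\<^sup>2 * E \<le> D"
  proof -
    have "(real n)\<^sup>2 \<le> real n ^ 3" using n by (intro power_increasing) auto
    then have "(real n)\<^sup>2 * E \<le> real n ^ 3 * E" using E_nonneg by (intro mult_right_mono)
    then show ?thesis using E3 by linarith
  qed
  have n2b: "(real n)\<^sup>2 * \<beta> = D" using n0 by (simp add: \<beta>_def D_def power2_eq_square power3_eq_cube)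
  have b0: "0 \<le> \<beta>" by (simp add: \<beta>_def)
  have bD: "\<beta> \<le> D"
  proof -
    have "1 \<le> (real n)\<^sup>2" using n by simp
    then have "1 * \<beta> \<le> (real n)\<^sup>2 * \<beta>" using b0 by (intro mult_right_mono)
    then show ?thesis using n2b by simp
  qed
  have HE: "real_of_int (M + K) * E \<le> 3 * D"
  proof -
    have "real_of_int (M + K) \<le> real_of_int (3 * int n ^ 3)" using M3 K3 by (intro of_int_le_iff[THEN iffD2]) simp
    then have "real_of_int (M + K) \<le> 3 * real n ^ 3" by simp
    then have "real_of_int (M + K) * E \<le> 3 * real n ^ 3 * E" using E_nonneg by (intro mult_right_mono)
    then show ?thesis using E3 by simp
  qed
  have HE2: "real (nat H) * E \<le> 6 * D" 
  proof -
    have "real (nat H) = 2 * real_of_int (M + K)" using H0 by (simp add: H_def)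
    then have "real (nat H) * E = 2 * (real_of_int (M + K) * E)" by simp
    then show ?thesis using HE by linarith
  qed
  define s where "s i = state_of M K Z H (x i)" for i
  have swin: "windowed (state_of M K Z H)"
    unfolding windowed_def using win K0 H0 by (intro allI impI state_of_local) auto
  have s_good: "s i = state_of M K Z H (shift 1 (x j))" if "\<not> bad i j" for i j
    unfolding s_def by (rule windowedD[OF swin that])
  define ex where "ex j \<longleftrightarrow> per M K (x j) \<and> \<not> per M K (shift 1 (x j))" for j
  define en where "en j \<longleftrightarrow> \<not> per M K (x j) \<and> per M K (shift 1 (x j))" for j
  have ex_cnt: "real (card {j. j < d \<and> ex j}) \<le> \<beta>"
    using per_transitions(1)[OF K0(1,3) slow] by (simp add: cnt_def ex_def)
  have en_cnt: "real (card {j. j < d \<and> en j}) \<le> \<beta> + E"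
    using per_transitions(2)[OF K0(1,3) slow] by (simp add: cnt_def en_def)
  have end_cnt: "real (card {j. j < d \<and> is_cut M K Z (shift 1 (x j))}) \<le> D + 2 * \<beta> + 2 * E"
    using is_cut_count[OF K0(1,2) cut slow] by (simp add: cnt_def)
  have none_cnt: "real (card {j. j < d \<and> s j = None}) \<le> 5 * D"
    using unlabelled_count[OF M1 MK _ unc] win HE by (simp add: cnt_def s_def H_def)
  have s0: "s j = Some (0, i, u) \<longleftrightarrow> per M K (x j) \<and> i = 0 \<and> u = per_ext M K (x j)" for j i u
  proof
    assume "s j = Some (0, i, u)"
    then show "per M K (x j) \<and> i = 0 \<and> u = per_ext M K (x j)"
      unfolding s_def by (cases rule: state_of_cases) auto
  qed (auto simp: s_def state_of_per)
  have st0: "state_of M K Z H y = Some (0, 0, u) \<longleftrightarrow> per M K y \<and> u = per_ext M K y" for y u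
  proof
    assume "state_of M K Z H y = Some (0, 0, u)"
    then show "per M K y \<and> u = per_ext M K y" by (cases rule: state_of_cases) auto
  qed (auto simp: state_of_per)
  have s_ch: "0 \<le> i \<and> i < h \<and> h \<le> H \<and> chain M K Z h i (x j)" if "s j = Some (h, i, v)" "h \<noteq> 0" for j h i v
    using that(1)[unfolded s_def] by (cases rule: state_of_cases) (use that(2) in auto)
  \<comment> \<open>Both sets of states are closed under \<open>advance\<close>, also through states that label no basis vector.\<close>
  define Y1 where "Y1 = {(0 :: int, 0 :: int, shift k (per_ext M K (x j))) | k j. j < d \<and> per M K (x j)}"
  have per_ext_per: "\<exists>p. 0 < p \<and> p \<le> M \<and> periodic p (shift k (per_ext M K (x j)))" if "per M K (x j)" for k j
    using is_per_ext_per_ext[OF that] periodic_shift by (fastforce simp: is_per_ext_def)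
  have Y1_fin: "finite Y1"
  proof (rule finite_subset)
    show "Y1 \<subseteq> (\<Union>j<d. (\<lambda>k. (0, 0, shift k (per_ext M K (x j)))) ` {0..<M})"
    proof
      fix y assume "y \<in> Y1"
      then obtain k j where y: "y = (0, 0, shift k (per_ext M K (x j)))" and j: "j < d" "per M K (x j)"
        by (auto simp: Y1_def)
      obtain p where p: "0 < p" "p \<le> M" "periodic p (per_ext M K (x j))" using per_ext_per[OF j(2), of 0] by auto
      have "y = (0, 0, shift (k mod p) (per_ext M K (x j)))" using shift_periodic_mod[OF p(3)] y by simp
      moreover have "k mod p \<in> {0..<M}" using p pos_mod_bound[of p k] by (simp, linarith)
      ultimately show "y \<in> (\<Union>j<d. (\<lambda>k. (0, 0, shift k (per_ext M K (x j)))) ` {0..<M})" using j by blast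
    qed
  qed simp
  have Y1_img: "advance ` Y1 = Y1"
  proof (intro equalityI subsetI)
    fix y assume "y \<in> advance ` Y1"
    then obtain k j where "y = (0, 0, shift (1 + k) (per_ext M K (x j)))" "j < d" "per M K (x j)"
      by (auto simp: Y1_def)
    then show "y \<in> Y1" unfolding Y1_def by blast
  next
    fix y assume "y \<in> Y1"
    then obtain k j where y: "y = (0, 0, shift k (per_ext M K (x j)))" and j: "j < d" "per M K (x j)"
      by (auto simp: Y1_def)
    have "y = advance (0, 0, shift (k - 1) (per_ext M K (x j)))" by (simp add: y)
    moreover have "(0, 0, shift (k - 1) (per_ext M K (x j))) \<in> Y1" unfolding Y1_def using j by blast
    ultimately show "y \<in> advance ` Y1" by blast
  qed
  have Y1_bij: "bij_betw advance Y1 Y1"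
    using Y1_img Y1_fin by (simp add: bij_betw_def eq_card_imp_inj_on)
  have Y1_per: "\<exists>l>0. l \<le> n\<^sup>2 \<and> (advance ^^ l) y = y" if yY: "y \<in> Y1" for y
  proof -
    obtain k j where y: "y = (0, 0, shift k (per_ext M K (x j)))" and j: "j < d" "per M K (x j)"
      using yY by (auto simp: Y1_def)
    obtain p where p: "0 < p" "p \<le> M" "periodic p (shift k (per_ext M K (x j)))" using per_ext_per[OF j(2)] by auto
    have "(advance ^^ nat p) y = y"
      using advance_funpow_per[of "nat p" "shift k (per_ext M K (x j))"] shift_periodic[OF p(3)] p(1) by (simp add: y)
    moreover have "nat p \<le> n\<^sup>2" using p(1,2) unfolding M_def by linarith
    ultimately show ?thesis using p(1) by (intro exI[of _ "nat p"]) simp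
  qed
  define Y2 where "Y2 = {(h, i, v). 0 \<le> i \<and> i < h \<and> (\<exists>j<d. \<exists>i'. s j = Some (h, i', v))}"
  have Y2_fin: "finite Y2"
  proof (rule finite_subset)
    show "Y2 \<subseteq> (\<Union>j<d. (\<lambda>i. (fst (the (s j)), i, snd (snd (the (s j))))) ` {0..<fst (the (s j))})"
      by (force simp: Y2_def)
  qed simp
  have Y2_img: "advance ` Y2 = Y2"
  proof (intro equalityI subsetI)
    fix y assume "y \<in> advance ` Y2"
    then show "y \<in> Y2" by (auto simp: Y2_def)
  next
    fix y assume yY: "y \<in> Y2"
    obtain h i v where y: "y = (h, i, v)" by (cases y)
    have hi: "0 \<le> i" "i < h" and j: "\<exists>j<d. \<exists>i'. s j = Some (h, i', v)"
      using yY by (simp_all add: Y2_def y)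
    have "((i - 1) mod h + 1) mod h = i"
      using mod_add_left_eq[of "i - 1" h 1] hi by simp
    then have "y = advance (h, (i - 1) mod h, v)" using hi by (simp add: y)
    moreover have "(h, (i - 1) mod h, v) \<in> Y2" using j hi by (simp add: Y2_def)
    ultimately show "y \<in> advance ` Y2" by blast
  qed
  have Y2_bij: "bij_betw advance Y2 Y2"
    using Y2_img Y2_fin by (simp add: bij_betw_def eq_card_imp_inj_on)
  have Y2_per: "\<exists>l>0. l \<le> nat H \<and> (advance ^^ l) y = y" if yY: "y \<in> Y2" for y
  proof -
    obtain h i v where y: "y = (h, i, v)" by (cases y)
    have hi: "0 \<le> i" "i < h" and "\<exists>j<d. \<exists>i'. s j = Some (h, i', v)" using yY by (simp_all add: Y2_def y)
    then obtain j i' where j: "s j = Some (h, i', v)" by blast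
    have "h \<le> H" using s_ch[OF j] hi by simp
    moreover have "(advance ^^ nat h) y = y" using advance_funpow_chain[of h i "nat h" v] hi by (simp add: y)
    ultimately show ?thesis using hi by (intro exI[of _ "nat h"]) auto
  qed
  define c where "c y = card {i. i < d \<and> s i = Some y}" for y
  let ?\<Delta> = "\<lambda>y. \<bar>real (c y) - real (c (advance y))\<bar>"
  have sum1: "sum ?\<Delta> Y1 \<le> 2 * \<beta> + 3 * E"
  proof -
    have "sum ?\<Delta> Y1 \<le> mass (\<lambda>i j. bad i j \<or> ex j) + mass (\<lambda>i j. bad i j \<or> en j)"
      unfolding c_def
    proof (rule count_defect)
      fix y i j assume y: "y \<in> Y1" and sj: "s j = Some y"
      obtain u where u: "y = (0, 0, u)" using y by (auto simp: Y1_def)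
      show "s i = Some (advance y) \<or> bad i j \<or> ex j"
      proof (cases "bad i j \<or> ex j")
        case False
        have pj: "per M K (x j)" "u = per_ext M K (x j)" using sj s0[of j 0 u] by (simp_all add: u)
        then have pj': "per M K (shift 1 (x j))" using False by (simp add: ex_def)
        have "s i = Some (0, 0, shift 1 u)"
          using s_good[of i j] False state_of_per[OF pj', of Z H] per_ext_shift[OF pj(1) pj' MK] pj(2) by simp
        then show ?thesis by (simp add: u)
      qed simp
    next
      fix y i j assume y: "y \<in> Y1" and si: "s i = Some (advance y)"
      obtain u where u: "y = (0, 0, u)" using y by (auto simp: Y1_def)
      show "s j = Some y \<or> bad i j \<or> en j"
      proof (cases "bad i j \<or> en j")
        case False
        then have "per M K (shift 1 (x j))" "shift 1 u = per_ext M K (shift 1 (x j))"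
          using si s_good[of i j] st0[of "shift 1 (x j)" "shift 1 u"] by (simp_all add: u)
        moreover have "per M K (x j)" using False calculation by (simp add: en_def)
        ultimately have "u = per_ext M K (x j)" using per_ext_shift[OF _ _ MK, of "x j"] shift_inject by metis
        then show ?thesis using \<open>per M K (x j)\<close> by (simp add: u s0)
      qed simp
    qed (use Y1_bij Y1_fin in \<open>auto simp: bij_betw_def\<close>)
    also have "\<dots> \<le> (mass bad + mass (\<lambda>i j. ex j)) + (mass bad + mass (\<lambda>i j. en j))"
      by (intro add_mono mass_disj)
    also have "\<dots> \<le> (E + \<beta>) + (E + (\<beta> + E))"
      unfolding mass_source using mass_bad ex_cnt en_cnt by linarith
    finally show ?thesis by linarith
  qed
  have sum2: "sum ?\<Delta> Y2 \<le> 4 * E"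
  proof -
    let ?N = "{y \<in> Y2. fst (snd y) + 1 < fst y}"
    have "sum ?\<Delta> ?N \<le> mass bad + mass bad"
      unfolding c_def
    proof (rule count_defect)
      fix y i j assume y: "y \<in> ?N" and sj: "s j = Some y"
      obtain h k v where hk: "y = (h, k, v)" by (cases y)
      have hk': "0 \<le> k" "k + 1 < h" using y by (auto simp: hk Y2_def)
      show "s i = Some (advance y) \<or> bad i j"
        using sj state_of_advance[of M K Z H "x j" h k v] hk' s_good[of i j] by (auto simp: hk s_def)
    next
      fix y i j assume y: "y \<in> ?N" and si: "s i = Some (advance y)"
      obtain h k v where hk: "y = (h, k, v)" by (cases y)
      have hk': "0 \<le> k" "k + 1 < h" using y by (auto simp: hk Y2_def)
      show "s j = Some y \<or> bad i j"
        using si state_of_retreat[of M K Z H "x j" h k v] hk' s_good[of i j] by (auto simp: hk s_def)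
    next
      show "inj_on advance ?N" using Y2_bij by (auto simp: bij_betw_def inj_on_def)
      show "finite ?N" using Y2_fin by simp
    qed
    moreover have "sum ?\<Delta> Y2 \<le> 2 * sum ?\<Delta> ?N"
      by (rule chain_defect_wrap[where c = "\<lambda>y. real (c y)"]) (use Y2_fin in \<open>auto simp: Y2_def\<close>)
    ultimately show ?thesis using mass_bad by linarith
  qed
  obtain r1 where r1: "\<And>y. y \<in> Y1 \<Longrightarrow> r1 y \<le> c y" "\<And>y. y \<in> Y1 \<Longrightarrow> r1 (advance y) = r1 y"
    "(\<Sum>y\<in>Y1. real (c y) - real (r1 y)) \<le> real (n\<^sup>2) * sum ?\<Delta> Y1"
    using orbit_minimum[OF Y1_bij Y1_per, of c] by blast
  obtain r2 where r2: "\<And>y. y \<in> Y2 \<Longrightarrow> r2 y \<le> c y" "\<And>y. y \<in> Y2 \<Longrightarrow> r2 (advance y) = r2 y"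
    "(\<Sum>y\<in>Y2. real (c y) - real (r2 y)) \<le> real (nat H) * sum ?\<Delta> Y2"
    using orbit_minimum[OF Y2_bij Y2_per, of c] by blast
  define rr where "rr y = (if y \<in> Y1 then r1 y else r2 y)" for y
  have disj: "Y1 \<inter> Y2 = {}" by (auto simp: Y1_def Y2_def)
  let ?Y = "Y1 \<union> Y2"
  have Yfin: "finite ?Y" using Y1_fin Y2_fin by simp
  have advY1: "advance y \<in> Y1" if "y \<in> Y1" for y using Y1_img that by blast
  have advY2: "advance y \<in> Y2" if "y \<in> Y2" for y using Y2_img that by blast
  have Ybij: "bij_betw advance ?Y ?Y" by (rule bij_betw_combine[OF Y1_bij Y2_bij disj])
  have rr_le: "rr y \<le> card {i. i < d \<and> s i = Some y}" if "y \<in> ?Y" for y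
    using that r1(1)[of y] r2(1)[of y] by (auto simp: rr_def c_def)
  have rr_advance: "rr (advance y) = rr y" if "y \<in> ?Y" for y
  proof (cases "y \<in> Y1")
    case True
    then show ?thesis using r1(2) advY1 by (simp add: rr_def)
  next
    case False
    then have "y \<in> Y2" using that by simp
    moreover from this have "advance y \<notin> Y1" using advY2 disj by blast
    ultimately show ?thesis using r2(2) False by (simp add: rr_def)
  qed
  have sY: "y \<in> ?Y" if i: "i < d" and si: "s i = Some y" for i y
  proof (cases y)
    case (fields h k v)
    show ?thesis
    proof (cases "h = 0")
      case True
      then have "per M K (x i)" "k = 0" "v = shift 0 (per_ext M K (x i))" using si s0[of i k v] by (simp_all add: fields)
      then have "y \<in> Y1" using i True unfolding Y1_def fields by blast
      then show ?thesis by simp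
    next
      case False
      then show ?thesis using s_ch[of i h k v] si i by (auto simp: Y2_def fields)
    qed
  qed
  obtain s' where s'1: "\<And>i. i < d \<Longrightarrow> s' i = None \<or> s' i = s i"
    and s'2: "\<And>y. y \<in> ?Y \<Longrightarrow> card {i. i < d \<and> s' i = Some y} = rr y"
    and s'3: "\<And>i y. i < d \<Longrightarrow> s' i = Some y \<Longrightarrow> y \<in> ?Y"
    and s'4: "real (card {i. i < d \<and> s' i \<noteq> s i}) \<le> (\<Sum>y\<in>?Y. real (card {i. i < d \<and> s i = Some y}) - real (rr y))"
    by (rule thin_labels[OF Yfin sY rr_le], (assumption | rule sY)+) (rule that; assumption)
  have changed: "real (card {i. i < d \<and> s' i \<noteq> s i}) \<le> 29 * D"
  proof -
    have "(\<Sum>y\<in>?Y. real (card {i. i < d \<and> s i = Some y}) - real (rr y))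
        = (\<Sum>y\<in>Y1. real (c y) - real (rr y)) + (\<Sum>y\<in>Y2. real (c y) - real (rr y))"
      unfolding c_def[symmetric] by (rule sum.union_disjoint[OF Y1_fin Y2_fin disj])
    also have "(\<Sum>y\<in>Y1. real (c y) - real (rr y)) = (\<Sum>y\<in>Y1. real (c y) - real (r1 y))"
      by (intro sum.cong refl) (simp add: rr_def)
    also have "(\<Sum>y\<in>Y2. real (c y) - real (rr y)) = (\<Sum>y\<in>Y2. real (c y) - real (r2 y))"
      using disj by (intro sum.cong refl) (auto simp: rr_def)
    also have "(\<Sum>y\<in>Y1. real (c y) - real (r1 y)) \<le> real (n\<^sup>2) * (2 * \<beta> + 3 * E)"
      using r1(3) mult_left_mono[OF sum1, of "real (n\<^sup>2)"] by simp
    also have "\<dots> \<le> 5 * D" using n2b n2E by (simp add: distrib_left)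
    also have "(\<Sum>y\<in>Y2. real (c y) - real (r2 y)) \<le> real (nat H) * (4 * E)"
      using r2(3) mult_left_mono[OF sum2, of "real (nat H)"] by linarith
    also have "\<dots> \<le> 24 * D" using HE2 by linarith
    finally show ?thesis using s'4 by linarith
  qed
  have fib: "card {i. i < d \<and> s' i = z} = card {j. j < d \<and> map_option advance (s' j) = z}" for z
  proof (rule relabelled_fibers[OF s'3 Ybij])
    fix y assume y: "y \<in> ?Y"
    then have "advance y \<in> ?Y" using advY1 advY2 by blast
    then show "card {i. i < d \<and> s' i = Some (advance y)} = card {i. i < d \<and> s' i = Some y}"
      using s'2 y rr_advance by simp
  qed
  have "mass (\<lambda>i j. s' i \<noteq> map_option advance (s' j))
      \<le> mass (\<lambda>i j. bad i j \<or> ((ex j \<or> is_cut M K Z (shift 1 (x j))) \<or> (s j = None \<or> s' j \<noteq> s j)) \<or> s' i \<noteq> s i)"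
  proof (rule mass_mono)
    fix i j assume ij: "i < d" "j < d" and ne: "s' i \<noteq> map_option advance (s' j)"
    show "bad i j \<or> ((ex j \<or> is_cut M K Z (shift 1 (x j))) \<or> (s j = None \<or> s' j \<noteq> s j)) \<or> s' i \<noteq> s i"
    proof (rule ccontr)
      assume a: "\<not> ?thesis"
      then obtain h k v where sj: "s j = Some (h, k, v)" by (cases "s j") auto
      have si: "s i = state_of M K Z H (shift 1 (x j))" using a by (intro s_good) simp
      have "s i = Some (advance (h, k, v))"
      proof (cases "h = 0")
        case True
        then have pj: "per M K (x j)" "v = per_ext M K (x j)" using sj s0[of j k v] by simp_all
        then have pj': "per M K (shift 1 (x j))" using a by (simp add: ex_def)
        have "s i = Some (0, 0, shift 1 v)"
          using si state_of_per[OF pj', of Z H] per_ext_shift[OF pj(1) pj' MK] pj(2) by simp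
        then show ?thesis using True by simp
      next
        case False
        then have ch: "0 \<le> k" "k < h" "chain M K Z h k (x j)" using s_ch[OF sj] by auto
        have "k + 1 \<noteq> h"
        proof
          assume "k + 1 = h"
          then have "is_cut M K Z (shift 1 (x j))" using ch(3) by (auto simp: chain_def)
          then show False using a by simp
        qed
        then show ?thesis using state_of_advance[of M K Z H "x j" h k v] sj ch si by (simp add: s_def)
      qed
      then show False using a ne sj by auto
    qed
  qed
  also have "\<dots> \<le> mass bad + mass (\<lambda>i j. ((ex j \<or> is_cut M K Z (shift 1 (x j))) \<or> (s j = None \<or> s' j \<noteq> s j)) \<or> s' i \<noteq> s i)"
    by (rule mass_disj)
  also have "mass (\<lambda>i j. ((ex j \<or> is_cut M K Z (shift 1 (x j))) \<or> (s j = None \<or> s' j \<noteq> s j)) \<or> s' i \<noteq> s i)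
      \<le> mass (\<lambda>i j. (ex j \<or> is_cut M K Z (shift 1 (x j))) \<or> (s j = None \<or> s' j \<noteq> s j)) + mass (\<lambda>i j. s' i \<noteq> s i)"
    by (rule mass_disj)
  also have "mass (\<lambda>i j. (ex j \<or> is_cut M K Z (shift 1 (x j))) \<or> (s j = None \<or> s' j \<noteq> s j))
      \<le> mass (\<lambda>i j. ex j \<or> is_cut M K Z (shift 1 (x j))) + mass (\<lambda>i j. s j = None \<or> s' j \<noteq> s j)"
    by (rule mass_disj)
  also have "mass (\<lambda>i j. ex j \<or> is_cut M K Z (shift 1 (x j))) \<le> mass (\<lambda>i j. ex j) + mass (\<lambda>i j. is_cut M K Z (shift 1 (x j)))"
    by (rule mass_disj)
  also have "mass (\<lambda>i j. s j = None \<or> s' j \<noteq> s j) \<le> mass (\<lambda>i j. s j = None) + mass (\<lambda>i j. s' j \<noteq> s j)"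
    by (rule mass_disj)
  finally have "mass (\<lambda>i j. s' i \<noteq> map_option advance (s' j))
      \<le> mass bad + (real (card {j. j < d \<and> ex j}) + real (card {j. j < d \<and> is_cut M K Z (shift 1 (x j))})
        + (real (card {j. j < d \<and> s j = None}) + real (card {j. j < d \<and> s' j \<noteq> s j}))
        + real (card {i. i < d \<and> s' i \<noteq> s i}))"
    unfolding mass_source mass_target by linarith
  then have bound: "mass (\<lambda>i j. s' i \<noteq> map_option advance (s' j)) \<le> 70 * D"
    using mass_bad ex_cnt end_cnt none_cnt changed bD E1 by linarith
  have none: "real (card {i. i < d \<and> s' i = None}) \<le> 34 * D"
  proof -
    have "card {i. i < d \<and> s' i = None} \<le> card ({i. i < d \<and> s i = None} \<union> {i. i < d \<and> s' i \<noteq> s i})"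
      by (rule card_mono) auto
    also have "\<dots> \<le> card {i. i < d \<and> s i = None} + card {i. i < d \<and> s' i \<noteq> s i}" by (rule card_Un_le)
    finally show ?thesis using none_cnt changed by linarith
  qed
  have lab: "label_seq w 0 = x i 0" if i: "i < d" "s' i = Some w" for i w
  proof -
    have si: "state_of M K Z H (x i) = Some w" using s'1[OF i(1)] i(2) by (simp add: s_def)
    then show ?thesis by (rule label_seq_state_of) (rule K0(1))
  qed
  show ?thesis
  proof (rule that[of s'])
    show "mass (\<lambda>i j. s' i \<noteq> map_option advance (s' j)) \<le> 70 * real d / real n"
      using bound by (simp only: D_def times_divide_eq_right)
    show "real (card {i. i < d \<and> s' i = None}) \<le> 34 * real d / real n"
      using none by (simp only: D_def times_divide_eq_right)
  qed (rule fib, rule lab)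
qed

end

section \<open>Almost lamplighter matrices\<close>

lemma doubly_stochastic_unitary:
  assumes "T \<in> unitaries d"
  shows "doubly_stochastic d (\<lambda>i j. (cmod (T $$ (i, j)))\<^sup>2)"
proof
  have T: "T \<in> carrier_mat d d" "mat_adjoint T * T = 1\<^sub>m d" "T * mat_adjoint T = 1\<^sub>m d"
    using assms by (simp_all add: unitaries_iff)
  show "(\<Sum>j<d. (cmod (T $$ (i, j)))\<^sup>2) = 1" if i: "i < d" for i
  proof -
    have "complex_of_real (\<Sum>j<d. (cmod (T $$ (i, j)))\<^sup>2) = (T * mat_adjoint T) $$ (i, i)"
      using i T(1) by (simp add: scalar_prod_def lessThan_atLeast0 complex_norm_square[unfolded of_real_power])
    also have "\<dots> = complex_of_real 1" using T(3) i by simp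
    finally show ?thesis by (simp only: of_real_eq_iff)
  qed
  show "(\<Sum>i<d. (cmod (T $$ (i, j)))\<^sup>2) = 1" if j: "j < d" for j
  proof -
    have "complex_of_real (\<Sum>i<d. (cmod (T $$ (i, j)))\<^sup>2) = (mat_adjoint T * T) $$ (j, j)"
      using j T(1) by (simp add: scalar_prod_def lessThan_atLeast0 complex_norm_square[unfolded of_real_power] mult.commute)
    also have "\<dots> = complex_of_real 1" using T(2) j by simp
    finally show ?thesis by (simp only: of_real_eq_iff)
  qed
qed simp

definition sgn_of :: "bool \<Rightarrow> complex" where
  "sgn_of b = (if b then -1 else 1)"

lemma sgn_of_square [simp]: "sgn_of b * sgn_of b = 1"
  by (simp add: sgn_of_def)

lemma cmod_sgn_of [simp]: "cmod (sgn_of b) = 1"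
  by (simp add: sgn_of_def)

text \<open>The failure of \<open>T\<close> to conjugate one sign matrix into another is four times the mass of the entries
  that connect differing signs.\<close>

lemma fro_conjugation_defect:
  assumes T: "T \<in> carrier_mat d d"
  shows "fro (T * diag d (\<lambda>i. sgn_of (P i)) - diag d (\<lambda>i. sgn_of (Q i)) * T)
    = 4 * (\<Sum>i<d. \<Sum>j<d. if Q i \<noteq> P j then (cmod (T $$ (i, j)))\<^sup>2 else 0)"
proof -
  have "fro (T * diag d (\<lambda>i. sgn_of (P i)) - diag d (\<lambda>i. sgn_of (Q i)) * T)
      = (\<Sum>i<d. \<Sum>j<d. (cmod (T $$ (i, j) * sgn_of (P j) - sgn_of (Q i) * T $$ (i, j)))\<^sup>2)"
    using T by (simp add: fro_def del: index_mult_mat(1))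
  also have "\<dots> = (\<Sum>i<d. \<Sum>j<d. 4 * (if Q i \<noteq> P j then (cmod (T $$ (i, j)))\<^sup>2 else 0))"
  proof (intro sum.cong refl)
    fix i j
    have "cmod (- t - t) = 2 * cmod t" "cmod (t + t) = 2 * cmod t" for t :: complex
      by (simp_all flip: mult_2 minus_add_distrib add: norm_mult)
    then show "(cmod (T $$ (i, j) * sgn_of (P j) - sgn_of (Q i) * T $$ (i, j)))\<^sup>2
        = 4 * (if Q i \<noteq> P j then (cmod (T $$ (i, j)))\<^sup>2 else 0)"
      by (auto simp: sgn_of_def power_mult_distrib)
  qed
  finally show ?thesis by (simp add: sum_distrib_left)
qed

text \<open>In the basis that diagonalises the lamps, \<open>T\<close> becomes \<open>T1\<close>, and the relations between \<open>T\<close> and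
  neighbouring lamps say that the coupling \<open>\<bar>T1 i j\<bar>\<^sup>2\<close> shifts labels up to small mass; a union bound over
  the window suffices since the defect \<open>\<delta>\<close> beats every power of \<open>n\<close> up to the seventh.\<close>

theorem approximate_lamplighter_matrices:
  fixes \<Phi> :: "int set \<Rightarrow> complex mat" and T :: "complex mat"
  defines "N \<equiv> \<lambda>n. 12 * int n ^ 3"
  assumes n: "0 < n" and d: "0 < d" and T: "T \<in> unitaries d"
    and \<Phi>: "\<And>g. g \<subseteq> {- N n..N n} \<Longrightarrow> \<Phi> g \<in> unitaries d"
    and \<delta>: "0 < \<delta>" "\<delta> * (1000 * real n ^ 7) \<le> 1"
    and mult: "\<And>g h. g \<subseteq> {- N n..N n} \<Longrightarrow> h \<subseteq> {- N n..N n} \<Longrightarrow>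
      fnorm (\<Phi> (symdiff g h) - \<Phi> g * \<Phi> h) \<le> \<delta> * sqrt d"
    and shift: "\<And>k. - N n \<le> k \<Longrightarrow> k < N n \<Longrightarrow> fnorm (T * \<Phi> {k} - \<Phi> {k + 1} * T) \<le> 2 * \<delta> * sqrt d"
  obtains U T' w where "U \<in> unitaries d" "T' \<in> unitaries d"
    "\<And>i j. i < d \<Longrightarrow> j < d \<Longrightarrow> T' $$ (i, j) \<noteq> 0 \<Longrightarrow> w i = shift 1 (w j)"
    "fnorm (U * T - T' * U) \<le> 18 * sqrt (d / n)"
    "fnorm (U * \<Phi> {0} - diag d (\<lambda>i. sgn_of (w i 0)) * U) \<le> 18 * sqrt (d / n)"
proof -
  let ?N = "N n"
  let ?I = "{- ?N..?N}"
  have N1: "0 < ?N" using n by (simp add: N_def)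
  have Tc: "T \<in> carrier_mat d d" using T by auto
  have sd0: "0 < sqrt (real d)" using d by simp
  have \<delta>1: "\<delta> \<le> 1"
  proof -
    have "1 \<le> real n ^ 7" using n by simp
    then have "\<delta> * 1 \<le> \<delta> * (1000 * real n ^ 7)" using \<delta>(1) by (intro mult_left_mono) auto
    then show ?thesis using \<delta>(2) by simp
  qed
  have \<delta>n: "\<delta> \<le> 1 / real n"
  proof -
    have "real n ^ 1 \<le> real n ^ 7" using n by (intro power_increasing) auto
    moreover have "0 \<le> real n ^ 7" by simp
    ultimately have "real n \<le> 1000 * real n ^ 7" unfolding power_one_right by linarith
    then have "\<delta> * real n \<le> \<delta> * (1000 * real n ^ 7)" using \<delta>(1) by (intro mult_left_mono) simp_all
    then have "\<delta> * real n \<le> 1" using \<delta>(2) by simp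
    then show ?thesis using n by (simp add: pos_le_divide_eq)
  qed
  define D where "D = \<delta> * sqrt d"
  have D0: "0 < D" using \<delta>(1) sd0 by (simp add: D_def)
  obtain U xs where U: "U \<in> unitaries d"
    and Ux: "\<And>g. g \<subseteq> ?I \<Longrightarrow> fnorm (U * \<Phi> g - diag d (\<lambda>i. complex_of_real (chi ?I (xs i) g)) * U)
      \<le> 2 * sqrt (2 * D * sqrt d) + D + D"
    using elementary_abelian_rounding[of ?I \<Phi> d D D] \<Phi> mult D0 by (auto simp: D_def)
  have Uc: "U \<in> carrier_mat d d" and Uac: "mat_adjoint U \<in> carrier_mat d d"
    and Ua: "mat_adjoint U \<in> unitaries d" using unitaries_carrier[OF U] unitaries_adjoint[OF U] by simp_all
  \<comment> \<open>The labels read the signs backwards, so that \<open>T\<close> acts on them as the left shift.\<close>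
  define x where "x i n = (- n \<in> xs i)" for i and n :: int
  define \<Delta> where "\<Delta> k = diag d (\<lambda>i. sgn_of (x i (- k)))" for k
  have \<Delta>U: "\<Delta> k \<in> unitaries d" for k unfolding \<Delta>_def by (rule diag_unitary) simp
  have \<Delta>c: "\<Delta> k \<in> carrier_mat d d" for k by (simp add: \<Delta>_def)
  define e1 where "e1 = 5 * sqrt (\<delta> * d)"
  have sq\<delta>: "\<delta> \<le> sqrt \<delta>" using \<delta>(1) \<delta>1 by (intro real_le_rsqrt) (simp add: power2_eq_square mult_left_le)
  have D_le: "D \<le> sqrt (\<delta> * d)"
    unfolding D_def real_sqrt_mult using sq\<delta> by (intro mult_right_mono) auto
  have e1: "fnorm (U * \<Phi> {k} - \<Delta> k * U) \<le> e1" if k: "k \<in> ?I" for k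
  proof -
    have "diag d (\<lambda>i. complex_of_real (chi ?I (xs i) {k})) = \<Delta> k"
      unfolding \<Delta>_def by (rule diag_cong) (use k in \<open>simp add: chi_single x_def sgn_of_def\<close>)
    then have "fnorm (U * \<Phi> {k} - \<Delta> k * U) \<le> 2 * sqrt (2 * D * sqrt d) + D + D"
      using Ux[of "{k}"] k by simp
    also have "2 * D * sqrt d = 2 * (\<delta> * d)" by (simp add: D_def)
    also have "sqrt (2 * (\<delta> * d)) = sqrt 2 * sqrt (\<delta> * d)" by (rule real_sqrt_mult)
    also have "sqrt 2 * sqrt (\<delta> * d) \<le> 1.5 * sqrt (\<delta> * d)"
      using \<delta>(1) by (intro mult_right_mono real_le_lsqrt) (auto simp: power2_eq_square)
    finally show ?thesis using D_le by (simp add: e1_def)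
  qed
  define T1 where "T1 = U * T * mat_adjoint U"
  have T1: "T1 \<in> unitaries d" unfolding T1_def by (intro unitaries_mult U T Ua)
  have T1c: "T1 \<in> carrier_mat d d" using T1 by auto
  have T1U: "T1 * U = U * T"
    unfolding T1_def using adjoint_cancel_right(2)[OF U, of "U * T" d] Uc Tc by simp
  note assoc = assoc_mult_mat[of _ d d _ d _ d]
  have conj: "fnorm (T1 * \<Delta> k - \<Delta> (k + 1) * T1) \<le> 12 * sqrt (\<delta> * d)" if k: "- ?N \<le> k" "k < ?N" for k
  proof -
    have \<Phi>k: "\<Phi> {k} \<in> carrier_mat d d" "\<Phi> {k + 1} \<in> carrier_mat d d"
      using \<Phi>[of "{k}"] \<Phi>[of "{k + 1}"] k by auto
    have "fnorm (T1 * \<Delta> k - \<Delta> (k + 1) * T1) = fnorm ((T1 * \<Delta> k - \<Delta> (k + 1) * T1) * U)"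
      by (rule fnorm_unitary_right[OF U, where n = d, symmetric]) (use T1c \<Delta>c in \<open>simp add: minus_carrier_mat\<close>)
    also have "(T1 * \<Delta> k - \<Delta> (k + 1) * T1) * U = T1 * (\<Delta> k * U) - \<Delta> (k + 1) * (U * T)"
      using T1c \<Delta>c[of k] \<Delta>c[of "k + 1"] Uc by (simp add: minus_mult_distrib_mat[of _ d d _ _ d] assoc T1U)
    also have "fnorm \<dots> \<le> fnorm (T1 * (\<Delta> k * U) - T1 * (U * \<Phi> {k})) + fnorm (T1 * (U * \<Phi> {k}) - \<Delta> (k + 1) * (U * T))"
      using T1c \<Delta>c[of k] \<Delta>c[of "k + 1"] Uc \<Phi>k Tc by (intro fnorm_diff_triangle[of _ d d]) simp_all
    also have "fnorm (T1 * (\<Delta> k * U) - T1 * (U * \<Phi> {k})) \<le> e1"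
    proof -
      have "T1 * (\<Delta> k * U) - T1 * (U * \<Phi> {k}) = T1 * (\<Delta> k * U - U * \<Phi> {k})"
        using T1c \<Delta>c[of k] Uc \<Phi>k by (simp add: mult_minus_distrib_mat[of _ d d _ d])
      then have "fnorm (T1 * (\<Delta> k * U) - T1 * (U * \<Phi> {k})) = fnorm (\<Delta> k * U - U * \<Phi> {k})"
        using fnorm_unitary_left[OF T1, of "\<Delta> k * U - U * \<Phi> {k}" d] Uc \<Phi>k by (simp add: minus_carrier_mat)
      also have "\<dots> = fnorm (U * \<Phi> {k} - \<Delta> k * U)"
        using Uc \<Phi>k \<Delta>c[of k] by (intro fnorm_minus_commute[of _ d d]) simp_all
      finally show ?thesis using e1[of k] k by simp
    qed
    also have "T1 * (U * \<Phi> {k}) = U * (T * \<Phi> {k})"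
    proof -
      have "T1 * (U * \<Phi> {k}) = T1 * U * \<Phi> {k}" by (rule assoc[OF T1c Uc \<Phi>k(1), symmetric])
      also have "\<dots> = U * (T * \<Phi> {k})" unfolding T1U by (rule assoc[OF Uc Tc \<Phi>k(1)])
      finally show ?thesis .
    qed
    also have "fnorm (U * (T * \<Phi> {k}) - \<Delta> (k + 1) * (U * T)) \<le> fnorm (U * (T * \<Phi> {k}) - U * (\<Phi> {k + 1} * T))
        + fnorm (U * (\<Phi> {k + 1} * T) - \<Delta> (k + 1) * (U * T))"
      using \<Delta>c[of "k + 1"] Uc \<Phi>k Tc by (intro fnorm_diff_triangle[of _ d d]) simp_all
    also have "fnorm (U * (T * \<Phi> {k}) - U * (\<Phi> {k + 1} * T)) \<le> 2 * D"
    proof -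
      have "U * (T * \<Phi> {k}) - U * (\<Phi> {k + 1} * T) = U * (T * \<Phi> {k} - \<Phi> {k + 1} * T)"
        using Uc \<Phi>k Tc by (simp add: mult_minus_distrib_mat[of _ d d _ d])
      then have "fnorm (U * (T * \<Phi> {k}) - U * (\<Phi> {k + 1} * T)) = fnorm (T * \<Phi> {k} - \<Phi> {k + 1} * T)"
        using fnorm_unitary_left[OF U, of "T * \<Phi> {k} - \<Phi> {k + 1} * T" d] \<Phi>k Tc by (simp add: minus_carrier_mat)
      then show ?thesis using shift[OF k] by (simp add: D_def)
    qed
    also have "fnorm (U * (\<Phi> {k + 1} * T) - \<Delta> (k + 1) * (U * T)) \<le> e1"
    proof -
      have "U * (\<Phi> {k + 1} * T) - \<Delta> (k + 1) * (U * T) = (U * \<Phi> {k + 1} - \<Delta> (k + 1) * U) * T"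
        using Uc \<Phi>k Tc \<Delta>c[of "k + 1"] by (simp add: minus_mult_distrib_mat[of _ d d _ _ d] assoc)
      then have "fnorm (U * (\<Phi> {k + 1} * T) - \<Delta> (k + 1) * (U * T)) = fnorm (U * \<Phi> {k + 1} - \<Delta> (k + 1) * U)"
        using fnorm_unitary_right[OF T, of "U * \<Phi> {k + 1} - \<Delta> (k + 1) * U" d] Uc \<Delta>c[of "k + 1"]
        by (simp add: minus_carrier_mat)
      then show ?thesis using e1[of "k + 1"] k by simp
    qed
    finally show ?thesis using D_le by (simp add: e1_def)
  qed
  define p where "p i j = (cmod (T1 $$ (i, j)))\<^sup>2" for i j
  interpret ds: doubly_stochastic d p
    unfolding p_def by (rule doubly_stochastic_unitary[OF T1])
  have one: "ds.mass (\<lambda>i j. x i m \<noteq> shift 1 (x j) m) \<le> 36 * (\<delta> * d)" if m: "- ?N \<le> m" "m < ?N" for m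
  proof -
    define k where "k = - m - 1"
    have k: "- ?N \<le> k" "k < ?N" using m by (auto simp: k_def)
    have "4 * ds.mass (\<lambda>i j. x i m \<noteq> shift 1 (x j) m) = fro (T1 * \<Delta> k - \<Delta> (k + 1) * T1)"
      unfolding \<Delta>_def fro_conjugation_defect[OF T1c] ds.mass_def p_def
      by (simp add: k_def shift_def add.commute)
    also have "\<dots> = (fnorm (T1 * \<Delta> k - \<Delta> (k + 1) * T1))\<^sup>2" by simp
    also have "\<dots> \<le> (12 * sqrt (\<delta> * d))\<^sup>2" by (intro power_mono conj k) simp
    also have "\<dots> = 144 * (\<delta> * d)" using \<delta>(1) by (simp add: power_mult_distrib)
    finally show ?thesis by simp
  qed
  define E where "E = 72 * real_of_int ?N * (\<delta> * d)"
  have "ds.mass (\<lambda>i j. \<not> (\<forall>m. - ?N \<le> m \<longrightarrow> m < ?N \<longrightarrow> x i m = shift 1 (x j) m)) \<le> E"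
  proof -
    have "ds.mass (\<lambda>i j. \<not> (\<forall>m. - ?N \<le> m \<longrightarrow> m < ?N \<longrightarrow> x i m = shift 1 (x j) m))
        \<le> (\<Sum>m\<in>{- ?N..<?N}. ds.mass (\<lambda>i j. x i m \<noteq> shift 1 (x j) m))"
    proof -
      have "ds.mass (\<lambda>i j. \<exists>m\<in>F. x i m \<noteq> shift 1 (x j) m) \<le> (\<Sum>m\<in>F. ds.mass (\<lambda>i j. x i m \<noteq> shift 1 (x j) m))"
        if "finite F" for F
        using that
      proof (induction F rule: finite_induct)
        case (insert m F)
        have "ds.mass (\<lambda>i j. \<exists>m\<in>insert m F. x i m \<noteq> shift 1 (x j) m)
            \<le> ds.mass (\<lambda>i j. x i m \<noteq> shift 1 (x j) m \<or> (\<exists>m\<in>F. x i m \<noteq> shift 1 (x j) m))"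
          by (rule ds.mass_mono) blast
        also have "\<dots> \<le> ds.mass (\<lambda>i j. x i m \<noteq> shift 1 (x j) m) + ds.mass (\<lambda>i j. \<exists>m\<in>F. x i m \<noteq> shift 1 (x j) m)"
          by (rule ds.mass_disj)
        finally show ?case using insert by simp
      qed (simp add: ds.mass_def)
      from this[of "{- ?N..<?N}"] have "ds.mass (\<lambda>i j. \<exists>m\<in>{- ?N..<?N}. x i m \<noteq> shift 1 (x j) m)
        \<le> (\<Sum>m\<in>{- ?N..<?N}. ds.mass (\<lambda>i j. x i m \<noteq> shift 1 (x j) m))" by simp
      moreover have "ds.mass (\<lambda>i j. \<not> (\<forall>m. - ?N \<le> m \<longrightarrow> m < ?N \<longrightarrow> x i m = shift 1 (x j) m))
          \<le> ds.mass (\<lambda>i j. \<exists>m\<in>{- ?N..<?N}. x i m \<noteq> shift 1 (x j) m)"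
        by (rule ds.mass_mono) auto
      ultimately show ?thesis by linarith
    qed
    also have "\<dots> \<le> (\<Sum>m\<in>{- ?N..<?N}. 36 * (\<delta> * d))" by (intro sum_mono one) auto
    also have "\<dots> = E" using N1 by (simp add: E_def)
    finally show ?thesis .
  qed
  then interpret sc: shift_coupling d p x ?N E by unfold_locales
  have En: "E * real n ^ 4 \<le> real d"
  proof -
    have "E * real n ^ 4 = 864 * \<delta> * (real n ^ 3 * real n ^ 4) * d" by (simp add: E_def N_def)
    also have "real n ^ 3 * real n ^ 4 = real n ^ 7" by (simp flip: power_add)
    also have "864 * \<delta> * real n ^ 7 * d \<le> 1 * real d"
    proof (intro mult_right_mono)
      have "864 * \<delta> * real n ^ 7 \<le> 1000 * \<delta> * real n ^ 7" using \<delta>(1) by (intro mult_right_mono) auto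
      then show "864 * \<delta> * real n ^ 7 \<le> 1" using \<delta>(2) by (simp add: mult_ac)
    qed simp
    finally show ?thesis by simp
  qed
  have NN: "12 * int n ^ 3 \<le> ?N" by (simp add: N_def)
  obtain s :: "nat \<Rightarrow> bool state option" where
    fib: "\<And>z. card {i. i < d \<and> s i = z} = card {j. j < d \<and> map_option advance (s j) = z}"
    and sm: "ds.mass (\<lambda>i j. s i \<noteq> map_option advance (s j)) \<le> 70 * real d / real n"
    and none: "real (card {i. i < d \<and> s i = None}) \<le> 34 * real d / real n"
    and lab: "\<And>i w. i < d \<Longrightarrow> s i = Some w \<Longrightarrow> label_seq w 0 = x i 0"
    by (rule sc.periodic_labelling[OF n NN En]) (rule that; assumption)
  define q where "q = real d / real n"
  have q0: "0 < q" using d n by (simp add: q_def)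
  have sq0: "0 < sqrt q" using q0 by simp
  obtain T' where T': "T' \<in> unitaries d"
    and TT': "fnorm (T1 - T') \<le> 2 * sqrt (\<Sum>i<d. \<Sum>j<d. if s i = map_option advance (s j) then 0 else (cmod (T1 $$ (i, j)))\<^sup>2) + sqrt q"
    and T'b: "\<And>i j. i < d \<Longrightarrow> j < d \<Longrightarrow> T' $$ (i, j) \<noteq> 0 \<Longrightarrow> s i = map_option advance (s j)"
    by (rule block_rounding[OF T1 fib sq0]) (rule that; assumption)
  have T'c: "T' \<in> carrier_mat d d" using T' by auto
  define w where "w i = (case s i of None \<Rightarrow> (\<lambda>_. False) | Some v \<Rightarrow> label_seq v)" for i
  have w1: "w i = shift 1 (w j)" if "i < d" "j < d" "T' $$ (i, j) \<noteq> 0" for i j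
    using T'b[OF that] by (cases "s j") (simp_all add: w_def label_seq_advance, simp add: shift_def)
  have dist1: "fnorm (U * T - T' * U) \<le> 18 * sqrt q"
  proof -
    have "(\<Sum>i<d. \<Sum>j<d. if s i = map_option advance (s j) then 0 else (cmod (T1 $$ (i, j)))\<^sup>2)
        = ds.mass (\<lambda>i j. s i \<noteq> map_option advance (s j))"
      unfolding ds.mass_def p_def by (intro sum.cong refl) simp
    also have "\<dots> \<le> 8.5\<^sup>2 * q" using sm q0 by (simp add: q_def power2_eq_square)
    finally have "sqrt (\<Sum>i<d. \<Sum>j<d. if s i = map_option advance (s j) then 0 else (cmod (T1 $$ (i, j)))\<^sup>2)
        \<le> sqrt (8.5\<^sup>2 * q)" by (rule real_sqrt_le_mono)
    also have "sqrt (8.5\<^sup>2 * q) = 8.5 * sqrt q" by (simp add: real_sqrt_mult)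
    finally have "fnorm (T1 - T') \<le> 18 * sqrt q" using TT' by simp
    moreover have "U * T - T' * U = (T1 - T') * U"
      using T1c T'c Uc T1U by (simp add: minus_mult_distrib_mat[of _ d d _ _ d])
    ultimately show ?thesis
      using fnorm_unitary_right[OF U, of "T1 - T'" d] T'c by (simp add: minus_carrier_mat)
  qed
  have dist2: "fnorm (U * \<Phi> {0} - diag d (\<lambda>i. sgn_of (w i 0)) * U) \<le> 18 * sqrt q"
  proof -
    define A where "A = diag d (\<lambda>i. sgn_of (w i 0))"
    have Ac: "A \<in> carrier_mat d d" by (simp add: A_def)
    have \<Phi>0: "\<Phi> {0} \<in> carrier_mat d d" using \<Phi>[of "{0}"] N1 by auto
    have "\<Delta> 0 - A = diag d (\<lambda>i. sgn_of (x i 0) - sgn_of (w i 0))"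
      by (intro eq_matI) (auto simp: \<Delta>_def A_def)
    then have "fro (\<Delta> 0 - A) = (\<Sum>i<d. (cmod (sgn_of (x i 0) - sgn_of (w i 0)))\<^sup>2)"
      by (simp add: fro_diag)
    also have "\<dots> \<le> (\<Sum>i<d. if s i = None then 4 else 0)"
    proof (rule sum_mono)
      fix i assume "i \<in> {..<d}"
      then have i: "i < d" by simp
      show "(cmod (sgn_of (x i 0) - sgn_of (w i 0)))\<^sup>2 \<le> (if s i = None then 4 else 0)"
      proof (cases "s i")
        case None
        then show ?thesis by (simp add: sgn_of_def)
      next
        case (Some v)
        then show ?thesis using lab[OF i Some] by (simp add: w_def)
      qed
    qed
    also have "\<dots> = 4 * real (card {i. i < d \<and> s i = None})"
    proof -
      have "{..<d} \<inter> {i. s i = None} = {i. i < d \<and> s i = None}" by auto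
      then show ?thesis by (simp add: sum.If_cases)
    qed
    also have "\<dots> \<le> 12\<^sup>2 * q" using none q0 by (simp add: q_def)
    finally have "fnorm (\<Delta> 0 - A) \<le> sqrt (12\<^sup>2 * q)" unfolding fnorm_def by (rule real_sqrt_le_mono)
    also have "sqrt (12\<^sup>2 * q) = 12 * sqrt q" by (simp add: real_sqrt_mult)
    finally have DA: "fnorm (\<Delta> 0 - A) \<le> 12 * sqrt q" .
    have "e1 \<le> 5 * sqrt q"
    proof -
      have "\<delta> * d \<le> (1 / real n) * d" using \<delta>n by (intro mult_right_mono) auto
      then have "\<delta> * d \<le> q" by (simp add: q_def)
      then show ?thesis by (simp add: e1_def)
    qed
    moreover have "fnorm (U * \<Phi> {0} - \<Delta> 0 * U) \<le> e1" using e1[of 0] N1 by simp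
    moreover have "fnorm (\<Delta> 0 * U - A * U) = fnorm (\<Delta> 0 - A)"
    proof -
      have "\<Delta> 0 * U - A * U = (\<Delta> 0 - A) * U"
        using \<Delta>c[of 0] Ac Uc by (simp add: minus_mult_distrib_mat[of _ d d _ _ d])
      then show ?thesis using fnorm_unitary_right[OF U, of "\<Delta> 0 - A" d] Ac by (simp add: minus_carrier_mat)
    qed
    moreover have "fnorm (U * \<Phi> {0} - A * U) \<le> fnorm (U * \<Phi> {0} - \<Delta> 0 * U) + fnorm (\<Delta> 0 * U - A * U)"
      using Uc \<Phi>0 Ac \<Delta>c[of 0] by (intro fnorm_diff_triangle[of _ d d]) simp_all
    ultimately show ?thesis using DA sq0 unfolding A_def by linarith
  qed
  show ?thesis by (rule that[OF U T' w1 dist1[unfolded q_def] dist2[unfolded q_def]])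
qed

section \<open>Word balls\<close>

lemma word_ball_one: "\<one>\<^bsub>G\<^esub> \<in> word_ball G S r"
  unfolding word_ball_def by (auto intro!: exI[of _ "[]"])

lemma word_ball_Cons:
  assumes "s \<in> S \<union> m_inv G ` S" "g \<in> word_ball G S r"
  shows "s \<otimes>\<^bsub>G\<^esub> g \<in> word_ball G S (Suc r)"
proof -
  obtain ws where ws: "g = foldr (\<lambda>s g. s \<otimes>\<^bsub>G\<^esub> g) ws \<one>\<^bsub>G\<^esub>" "set ws \<subseteq> S \<union> m_inv G ` S" "length ws \<le> r"
    using assms(2) by (auto simp: word_ball_def)
  then have "s \<otimes>\<^bsub>G\<^esub> g = foldr (\<lambda>s g. s \<otimes>\<^bsub>G\<^esub> g) (s # ws) \<one>\<^bsub>G\<^esub>" "set (s # ws) \<subseteq> S \<union> m_inv G ` S"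
    "length (s # ws) \<le> Suc r"
    using assms(1) by auto
  then show ?thesis unfolding word_ball_def by blast
qed

lemma word_ball_mono: "r \<le> r' \<Longrightarrow> word_ball G S r \<subseteq> word_ball G S r'"
  unfolding word_ball_def by fastforce

text \<open>The length \<open>k\<close> is existentially quantified in the conclusion so that quantities growing with the
  word length can be tracked.\<close>

lemma word_ball_induct [consumes 1, case_names one mult]:
  assumes g: "g \<in> word_ball G S r"
    and one: "P 0 \<one>\<^bsub>G\<^esub>"
    and mult: "\<And>k s h. k < r \<Longrightarrow> s \<in> S \<union> m_inv G ` S \<Longrightarrow> h \<in> word_ball G S k \<Longrightarrow> P k h \<Longrightarrow> P (Suc k) (s \<otimes>\<^bsub>G\<^esub> h)"
  shows "\<exists>k\<le>r. P k g"
proof -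
  have "P (length ws) (foldr (\<lambda>s g. s \<otimes>\<^bsub>G\<^esub> g) ws \<one>\<^bsub>G\<^esub>)"
    if "set ws \<subseteq> S \<union> m_inv G ` S" "length ws \<le> r" for ws
    using that
  proof (induction ws)
    case (Cons s ws)
    have "foldr (\<lambda>s g. s \<otimes>\<^bsub>G\<^esub> g) ws \<one>\<^bsub>G\<^esub> \<in> word_ball G S (length ws)"
      using Cons.prems unfolding word_ball_def by auto
    then show ?case using Cons by (simp add: mult)
  qed (simp add: one)
  then show ?thesis using g unfolding word_ball_def by blast
qed

context group
begin

lemma word_ball_carrier:
  assumes S: "S \<subseteq> carrier G" and g: "g \<in> word_ball G S r"
  shows "g \<in> carrier G"
proof -
  have "\<exists>k\<le>r. g \<in> carrier G"
    using g by (induction rule: word_ball_induct) (use S in auto)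
  then show ?thesis by simp
qed

lemma word_ball_mult:
  assumes S: "S \<subseteq> carrier G" and g: "g \<in> word_ball G S r" and h: "h \<in> word_ball G S r'"
  shows "g \<otimes> h \<in> word_ball G S (r + r')"
proof -
  have hc: "h \<in> carrier G" by (rule word_ball_carrier[OF S h])
  have "\<exists>k\<le>r. g \<otimes> h \<in> word_ball G S (k + r')"
    using g
  proof (induction rule: word_ball_induct)
    case one
    then show ?case using h hc by simp
  next
    case (mult k s g)
    have "s \<in> carrier G" using mult(2) S by auto
    moreover have "g \<in> carrier G" by (rule word_ball_carrier[OF S mult(3)])
    ultimately have "s \<otimes> g \<otimes> h = s \<otimes> (g \<otimes> h)" using hc by (simp add: m_assoc)
    then show ?case using word_ball_Cons[OF mult(2,4)] by simp
  qed
  then obtain k where "k \<le> r" "g \<otimes> h \<in> word_ball G S (k + r')" by blast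
  then show ?thesis using word_ball_mono[of "k + r'" "r + r'" G S] by auto
qed

lemma word_ball_generator:
  assumes "S \<subseteq> carrier G" "s \<in> S \<union> m_inv G ` S"
  shows "s \<in> word_ball G S (Suc 0)"
  using word_ball_Cons[OF assms(2) word_ball_one, of 0] assms by auto

lemma word_ball_mult_generator:
  assumes "S \<subseteq> carrier G" "g \<in> word_ball G S r" "s \<in> S \<union> m_inv G ` S"
  shows "g \<otimes> s \<in> word_ball G S (Suc r)"
  using word_ball_mult[OF assms(1,2) word_ball_generator[OF assms(1,3)]] by simp

lemma word_ball_finite: "finite S \<Longrightarrow> finite (word_ball G S r)"
proof -
  assume S: "finite S"
  have "word_ball G S r = (\<lambda>ws. foldr (\<lambda>s g. s \<otimes> g) ws \<one>) ` {ws. set ws \<subseteq> S \<union> m_inv G ` S \<and> length ws \<le> r}"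
    unfolding word_ball_def by auto
  then show ?thesis using S by (simp add: finite_lists_length_le)
qed

lemma word_ball_inv:
  assumes S: "S \<subseteq> carrier G" and g: "g \<in> word_ball G S r"
  shows "inv g \<in> word_ball G S r"
proof -
  have "\<exists>k\<le>r. inv g \<in> word_ball G S k"
    using g
  proof (induction rule: word_ball_induct)
    case one
    then show ?case by (simp add: word_ball_one)
  next
    case (mult k s g)
    have s: "s \<in> carrier G" using mult(2) S by auto
    have "g \<in> carrier G" by (rule word_ball_carrier[OF S mult(3)])
    then have "inv (s \<otimes> g) = inv g \<otimes> inv s" using s by (simp add: inv_mult_group)
    moreover have "inv s \<in> S \<union> m_inv G ` S" using mult(2) S by auto
    ultimately show ?case using word_ball_mult_generator[OF S mult(4)] by simp
  qed
  then show ?thesis using word_ball_mono[of _ r G S] by auto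
qed

lemma word_ball_exhausts:
  assumes S: "S \<subseteq> carrier G" and g: "g \<in> generate G S"
  shows "\<exists>r. g \<in> word_ball G S r"
  using g
proof induction
  case one
  then show ?case using word_ball_one by blast
next
  case (incl h)
  then show ?case using word_ball_generator[OF S, of h] by blast
next
  case (inv h)
  then show ?case using word_ball_generator[OF S, of "inv h"] by blast
next
  case (eng h1 h2)
  then show ?case using word_ball_mult[OF S] by blast
qed

lemma word_ball_rescale:
  assumes S: "S \<subseteq> carrier G" and T: "T \<subseteq> carrier G" and l: "\<And>s. s \<in> S \<Longrightarrow> s \<in> word_ball G T l"
  shows "word_ball G S r \<subseteq> word_ball G T (l * r)"
proof
  fix g assume "g \<in> word_ball G S r"
  then have "\<exists>k\<le>r. g \<in> word_ball G T (l * k)"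
  proof (induction rule: word_ball_induct)
    case one
    then show ?case by (simp add: word_ball_one)
  next
    case (mult k s g)
    have "s \<in> word_ball G T l" using mult(2) l word_ball_inv[OF T] by auto
    from word_ball_mult[OF T this mult(4)] show ?case by simp
  qed
  then obtain k where k: "k \<le> r" "g \<in> word_ball G T (l * k)" by blast
  have "l * k \<le> l * r" using k(1) by simp
  then show "g \<in> word_ball G T (l * r)" using k(2) word_ball_mono[of "l * k" "l * r" G T] by blast
qed

end

section \<open>The lamps inside word balls\<close>

text \<open>The configuration with exactly the lamps in \<open>g\<close> switched on, the lamplighter being at the origin.\<close>

definition lamps :: "int set \<Rightarrow> (int \<Rightarrow> int) \<times> int" where
  "lamps g = (\<lambda>i. if i \<in> g then 1 else 0, 0)"

abbreviation "std_gens \<equiv> {lamp_a, lamp_t}"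

lemma std_gens_carrier: "std_gens \<subseteq> carrier lamplighter"
  by (simp add: lamp_a_in lamp_t_in)

lemma lamps_mult: "lamps g \<otimes>\<^bsub>lamplighter\<^esub> lamps h = lamps (symdiff g h)"
  by (auto simp: lamps_def mult_lamplighter symdiff_def)

lemma lamp_a_lamps: "lamp_a = lamps {0}"
  by (auto simp: lamp_a_def lamps_def)

lemma lamp_t_lamps: "lamp_t \<otimes>\<^bsub>lamplighter\<^esub> lamps {k} = lamps {k + 1} \<otimes>\<^bsub>lamplighter\<^esub> lamp_t"
  by (auto simp: lamps_def lamp_t_def mult_lamplighter)

lemma inv_lamp_t: "inv\<^bsub>lamplighter\<^esub> lamp_t = ((\<lambda>_. 0), - 1)"
proof -
  interpret group lamplighter by (rule group_lamplighter)
  show ?thesis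
    by (rule inv_equality) (simp_all add: carrier_lamplighter mult_lamplighter one_lamplighter lamp_t_def)
qed

lemma shift_in_word_ball:
  "((\<lambda>_. 0), int k) \<in> word_ball lamplighter std_gens k"
  "((\<lambda>_. 0), - int k) \<in> word_ball lamplighter std_gens k"
proof -
  show "((\<lambda>_. 0), int k) \<in> word_ball lamplighter std_gens k"
  proof (induction k)
    case 0
    then show ?case using word_ball_one[of lamplighter] by (simp add: one_lamplighter)
  next
    case (Suc k)
    have "lamp_t \<otimes>\<^bsub>lamplighter\<^esub> ((\<lambda>_. 0), int k) \<in> word_ball lamplighter std_gens (Suc k)"
      by (rule word_ball_Cons[OF _ Suc]) simp
    then show ?case by (simp add: lamp_t_def mult_lamplighter)
  qed
  show "((\<lambda>_. 0), - int k) \<in> word_ball lamplighter std_gens k"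
  proof (induction k)
    case 0
    then show ?case using word_ball_one[of lamplighter] by (simp add: one_lamplighter)
  next
    case (Suc k)
    have "inv\<^bsub>lamplighter\<^esub> lamp_t \<otimes>\<^bsub>lamplighter\<^esub> ((\<lambda>_. 0), - int k) \<in> word_ball lamplighter std_gens (Suc k)"
      by (rule word_ball_Cons[OF _ Suc]) simp
    then show ?case by (simp add: inv_lamp_t mult_lamplighter)
  qed
qed

lemma half_line_in_word_ball:
  assumes "g \<subseteq> {0..<int k}"
  shows "(fst (lamps g), int k) \<in> word_ball lamplighter std_gens (2 * k)"
  using assms
proof (induction k arbitrary: g)
  case 0
  then show ?case using word_ball_one[of lamplighter] by (simp add: one_lamplighter lamps_def)
next
  case (Suc k)
  interpret group lamplighter by (rule group_lamplighter)
  define g' where "g' = g - {int k}"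
  have "g' \<subseteq> {0..<int k}" using Suc.prems by (auto simp: g'_def)
  then have w: "(fst (lamps g'), int k) \<in> word_ball lamplighter std_gens (2 * k)" by (rule Suc.IH)
  have t: "lamp_t \<in> std_gens \<union> m_inv lamplighter ` std_gens" by simp
  have a: "lamp_a \<in> std_gens \<union> m_inv lamplighter ` std_gens" by simp
  show ?case
  proof (cases "int k \<in> g")
    case True
    have "(fst (lamps g'), int k) \<otimes>\<^bsub>lamplighter\<^esub> lamp_a \<otimes>\<^bsub>lamplighter\<^esub> lamp_t
        \<in> word_ball lamplighter std_gens (Suc (Suc (2 * k)))"
      by (intro word_ball_mult_generator[OF std_gens_carrier] w t a)
    moreover have "(fst (lamps g'), int k) \<otimes>\<^bsub>lamplighter\<^esub> lamp_a \<otimes>\<^bsub>lamplighter\<^esub> lamp_t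
        = (fst (lamps g), int (Suc k))"
      using True by (auto simp: lamps_def lamp_a_def lamp_t_def mult_lamplighter g'_def)
    ultimately show ?thesis by simp
  next
    case False
    have "(fst (lamps g'), int k) \<otimes>\<^bsub>lamplighter\<^esub> lamp_t \<in> word_ball lamplighter std_gens (Suc (2 * k))"
      by (intro word_ball_mult_generator[OF std_gens_carrier] w t)
    moreover have "(fst (lamps g'), int k) \<otimes>\<^bsub>lamplighter\<^esub> lamp_t = (fst (lamps g), int (Suc k))"
      using False by (auto simp: lamps_def lamp_t_def mult_lamplighter g'_def)
    ultimately show ?thesis using word_ball_mono[of "Suc (2 * k)" "2 * Suc k" lamplighter std_gens] by auto
  qed
qed

text \<open>Walk to \<open>-N\<close>, switch lamps while walking to \<open>N + 1\<close>, and walk back. The length is linear in \<open>N\<close>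
  although the configurations are exponentially many.\<close>

lemma lamps_in_word_ball:
  assumes g: "g \<subseteq> {- int N..int N}"
  shows "lamps g \<in> word_ball lamplighter std_gens (6 * N + 3)"
proof -
  interpret group lamplighter by (rule group_lamplighter)
  define g' where "g' = (\<lambda>i. i + int N) ` g"
  have "g' \<subseteq> {0..<int (2 * N + 1)}" using g by (auto simp: g'_def)
  then have "(fst (lamps g'), int (2 * N + 1)) \<in> word_ball lamplighter std_gens (2 * (2 * N + 1))"
    by (rule half_line_in_word_ball)
  then have "((\<lambda>_. 0), - int N) \<otimes>\<^bsub>lamplighter\<^esub> (fst (lamps g'), int (2 * N + 1)) \<otimes>\<^bsub>lamplighter\<^esub>
      ((\<lambda>_. 0), - int (N + 1)) \<in> word_ball lamplighter std_gens (N + 2 * (2 * N + 1) + (N + 1))"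
    by (intro word_ball_mult[OF std_gens_carrier] shift_in_word_ball)
  moreover have "((\<lambda>_. 0), - int N) \<otimes>\<^bsub>lamplighter\<^esub> (fst (lamps g'), int (2 * N + 1)) \<otimes>\<^bsub>lamplighter\<^esub>
      ((\<lambda>_. 0), - int (N + 1)) = lamps g"
    by (auto simp: lamps_def mult_lamplighter g'_def image_iff)
  moreover have "N + 2 * (2 * N + 1) + (N + 1) = 6 * N + 3" by simp
  ultimately show ?thesis by (simp only:)
qed

section \<open>Representations from permuted labels\<close>

definition lamp_funs :: "(int \<Rightarrow> int) set" where
  "lamp_funs = {f. (\<forall>i. f i \<in> {0, 1}) \<and> finite {i. f i \<noteq> 0}}"

lemma lamp_funs_shift: "f \<in> lamp_funs \<Longrightarrow> (\<lambda>i. f (i + k)) \<in> lamp_funs"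
  using finite_support_shift[of f k] by (simp add: lamp_funs_def)

text \<open>The universal property of the semidirect product by the integers: a homomorphism on the lamp
  configurations and an element that implements their translation.\<close>

lemma lamplighter_hom:
  fixes G (structure)
  assumes G: "group G" and t: "t \<in> carrier G"
    and D: "\<And>f. f \<in> lamp_funs \<Longrightarrow> D f \<in> carrier G"
    and add: "\<And>f g. f \<in> lamp_funs \<Longrightarrow> g \<in> lamp_funs \<Longrightarrow> D (\<lambda>i. (f i + g i) mod 2) = D f \<otimes> D g"
    and shift: "\<And>f. f \<in> lamp_funs \<Longrightarrow> t \<otimes> D f = D (\<lambda>i. f (i - 1)) \<otimes> t"
  shows "(\<lambda>(f, m). D f \<otimes> t [^] (m :: int)) \<in> hom lamplighter G"
proof -
  interpret group G by (rule G)
  have tm [simp]: "t [^] m \<in> carrier G" for m :: int using t by simp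
  have shf: "(\<lambda>i. f (i - m)) \<in> lamp_funs" if "f \<in> lamp_funs" for f m
    using lamp_funs_shift[OF that, of "- m"] by simp
  have comm: "t [^] m \<otimes> D f = D (\<lambda>i. f (i - m)) \<otimes> t [^] m" if f: "f \<in> lamp_funs" for f and m :: int
  proof (induction m rule: int_induct[of _ 0])
    case base
    then show ?case using D[OF f] by simp
  next
    case (step1 m)
    have c: "t [^] (m + 1) = t \<otimes> t [^] m"
      using int_pow_mult[OF t, of 1 m] t by (simp add: add.commute)
    have "t [^] (m + 1) \<otimes> D f = t \<otimes> (D (\<lambda>i. f (i - m)) \<otimes> t [^] m)"
      using D[OF f] t step1 by (simp add: c m_assoc)
    also have "\<dots> = (t \<otimes> D (\<lambda>i. f (i - m))) \<otimes> t [^] m"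
      using D[OF shf[OF f]] t by (simp add: m_assoc)
    also have "\<dots> = D (\<lambda>i. f (i - (m + 1))) \<otimes> t [^] (m + 1)"
    proof -
      have "(\<lambda>i. f (i - 1 - m)) = (\<lambda>i. f (i - (m + 1)))" by (intro ext arg_cong[of _ _ f]) simp
      then have "t \<otimes> D (\<lambda>i. f (i - m)) = D (\<lambda>i. f (i - (m + 1))) \<otimes> t"
        using shift[OF shf[OF f, of m]] by (simp only:)
      then show ?thesis using D[OF shf[OF f, of "m + 1"]] t by (simp only: c) (simp add: m_assoc)
    qed
    finally show ?case .
  next
    case (step2 m)
    have c: "t [^] m = t \<otimes> t [^] (m - 1)"
      using int_pow_mult[OF t, of 1 "m - 1"] t by simp
    have "t \<otimes> (t [^] (m - 1) \<otimes> D f) = t [^] m \<otimes> D f"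
      using D[OF f] t by (simp add: c m_assoc)
    also have "\<dots> = D (\<lambda>i. f (i - m)) \<otimes> t \<otimes> t [^] (m - 1)"
      using step2 D[OF shf[OF f, of m]] t by (simp add: m_assoc flip: c)
    also have "D (\<lambda>i. f (i - m)) \<otimes> t = t \<otimes> D (\<lambda>i. f (i - (m - 1)))"
    proof -
      have "(\<lambda>i. f (i - 1 - (m - 1))) = (\<lambda>i. f (i - m))" by (intro ext arg_cong[of _ _ f]) simp
      then show ?thesis using shift[OF shf[OF f, of "m - 1"]] by (simp only:)
    qed
    also have "t \<otimes> D (\<lambda>i. f (i - (m - 1))) \<otimes> t [^] (m - 1) = t \<otimes> (D (\<lambda>i. f (i - (m - 1))) \<otimes> t [^] (m - 1))"
      using D[OF shf[OF f, of "m - 1"]] t by (simp add: m_assoc)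
    finally show ?case
      using D[OF f] D[OF shf[OF f, of "m - 1"]] t by simp
  qed
  have car: "carrier lamplighter = lamp_funs \<times> UNIV"
    by (simp add: carrier_lamplighter lamp_funs_def)
  show ?thesis
  proof (rule homI)
    fix x assume "x \<in> carrier lamplighter"
    then show "(\<lambda>(f, m). D f \<otimes> t [^] (m :: int)) x \<in> carrier G"
      using D by (auto simp: car)
  next
    fix x y assume "x \<in> carrier lamplighter" "y \<in> carrier lamplighter"
    then obtain f m g k where x: "x = (f, m)" "f \<in> lamp_funs" and y: "y = (g, k)" "g \<in> lamp_funs"
      by (auto simp: car)
    have "D f \<otimes> t [^] m \<otimes> (D g \<otimes> t [^] k) = D f \<otimes> (t [^] m \<otimes> D g) \<otimes> t [^] k"
      using D x y by (simp add: m_assoc)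
    also have "\<dots> = D f \<otimes> D (\<lambda>i. g (i - m)) \<otimes> (t [^] m \<otimes> t [^] k)"
      using D[OF x(2)] D[OF shf[OF y(2), of m]] by (simp add: comm[OF y(2)] m_assoc)
    also have "\<dots> = D (\<lambda>i. (f i + g (i - m)) mod 2) \<otimes> t [^] (m + k)"
      using add[OF x(2) shf[OF y(2), of m]] int_pow_mult[OF t] by simp
    finally show "(\<lambda>(f, m). D f \<otimes> t [^] (m :: int)) (x \<otimes>\<^bsub>lamplighter\<^esub> y)
        = (\<lambda>(f, m). D f \<otimes> t [^] m) x \<otimes> (\<lambda>(f, m). D f \<otimes> t [^] m) y"
      by (simp add: x y mult_lamplighter)
  qed
qed

text \<open>A configuration acts by the product of the signs that the label sequence shows at the lit
  positions; a lamp at position \<open>n\<close> reads the label at \<open>-n\<close>, because \<open>T\<close> shifts labels to the left.\<close>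

lemma permuted_labels_representation:
  assumes T: "T \<in> unitaries d"
    and w: "\<And>i j. i < d \<Longrightarrow> j < d \<Longrightarrow> T $$ (i, j) \<noteq> 0 \<Longrightarrow> w i = shift 1 (w j)"
  obtains \<pi> where "\<pi> \<in> hom lamplighter (unitary_group d)" "\<pi> lamp_t = T"
    "\<pi> lamp_a = diag d (\<lambda>i. sgn_of (w i 0))"
proof -
  define F where "F f u = (\<Prod>n\<in>{n. f n \<noteq> 0}. sgn_of (u (- n)))" for f :: "int \<Rightarrow> int" and u :: "int \<Rightarrow> bool"
  define D where "D f = diag d (\<lambda>i. F f (w i))" for f
  have Dc: "D f \<in> carrier_mat d d" for f by (simp add: D_def)
  have DU: "D f \<in> unitaries d" for f
    unfolding D_def by (rule diag_unitary) (simp add: F_def flip: prod_norm)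
  have Tc: "T \<in> carrier_mat d d" using T by auto
  have Fsup: "F f u = (\<Prod>n\<in>A. if f n \<noteq> 0 then sgn_of (u (- n)) else 1)" if "finite A" "{n. f n \<noteq> 0} \<subseteq> A" for f u A
  proof -
    have "(\<Prod>n\<in>A. if f n \<noteq> 0 then sgn_of (u (- n)) else 1) = (\<Prod>n\<in>A \<inter> {n. f n \<noteq> 0}. sgn_of (u (- n)))"
      using that(1) by (simp add: prod.inter_restrict)
    also have "A \<inter> {n. f n \<noteq> 0} = {n. f n \<noteq> 0}" using that(2) by auto
    finally show ?thesis by (simp add: F_def)
  qed
  have add: "D (\<lambda>i. (f i + g i) mod 2) = D f * D g" if fg: "f \<in> lamp_funs" "g \<in> lamp_funs" for f g
  proof -
    define A where "A = {n. f n \<noteq> 0} \<union> {n. g n \<noteq> 0}"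
    have A: "finite A" using fg by (simp add: A_def lamp_funs_def)
    have sub: "{n. f n \<noteq> 0} \<subseteq> A" "{n. g n \<noteq> 0} \<subseteq> A" "{n. (f n + g n) mod 2 \<noteq> 0} \<subseteq> A" by (auto simp: A_def)
    have "F (\<lambda>i. (f i + g i) mod 2) u = F f u * F g u" for u
      unfolding Fsup[OF A sub(1)] Fsup[OF A sub(2)] Fsup[OF A sub(3)] prod.distrib[symmetric]
    proof (rule prod.cong[OF refl])
      fix n
      have "f n = 0 \<or> f n = 1" "g n = 0 \<or> g n = 1" using fg by (auto simp: lamp_funs_def)
      then show "(if (f n + g n) mod 2 \<noteq> 0 then sgn_of (u (- n)) else 1)
          = (if f n \<noteq> 0 then sgn_of (u (- n)) else 1) * (if g n \<noteq> 0 then sgn_of (u (- n)) else 1)"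
        by auto
    qed
    then show ?thesis by (simp add: D_def diag_mult_diag)
  qed
  have shift: "T * D f = D (\<lambda>i. f (i - 1)) * T" if f: "f \<in> lamp_funs" for f
  proof (rule eq_matI)
    fix i j assume "i < dim_row (D (\<lambda>i. f (i - 1)) * T)" "j < dim_col (D (\<lambda>i. f (i - 1)) * T)"
    then have ij: "i < d" "j < d" using Tc Dc[of "\<lambda>i. f (i - 1)"] by auto
    have "F (\<lambda>i. f (i - 1)) (shift 1 u) = F f u" for u
      unfolding F_def
      by (rule prod.reindex_bij_witness[of _ "\<lambda>n. n + 1" "\<lambda>n. n - 1"]) (auto simp: shift_def algebra_simps)
    then have "T $$ (i, j) = 0 \<or> F (\<lambda>i. f (i - 1)) (w i) = F f (w j)" using w[OF ij] by metis
    then show "(T * D f) $$ (i, j) = (D (\<lambda>i. f (i - 1)) * T) $$ (i, j)"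
      using ij Tc by (auto simp: D_def simp del: index_mult_mat(1))
  qed (use Tc Dc[of f] Dc[of "\<lambda>i. f (i - 1)"] in auto)
  define \<pi> where "\<pi> = (\<lambda>(f, m). D f \<otimes>\<^bsub>unitary_group d\<^esub> T [^]\<^bsub>unitary_group d\<^esub> (m :: int))"
  have "\<pi> \<in> hom lamplighter (unitary_group d)"
    unfolding \<pi>_def using DU add shift by (intro lamplighter_hom group_unitary_group T) simp_all
  moreover have "\<pi> lamp_t = T"
  proof -
    interpret group "unitary_group d" by (rule group_unitary_group)
    have "D (\<lambda>_. 0) = 1\<^sub>m d" by (simp add: D_def F_def diag_one)
    moreover have "T [^]\<^bsub>unitary_group d\<^esub> (1 :: int) = T" using T by simp
    ultimately show ?thesis using Tc by (simp add: \<pi>_def lamp_t_def)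
  qed
  moreover have "\<pi> lamp_a = diag d (\<lambda>i. sgn_of (w i 0))"
  proof -
    have "{n. (if n = 0 then 1 else 0 :: int) \<noteq> 0} = {0}" by auto
    then have "D (\<lambda>i. if i = 0 then 1 else 0) = diag d (\<lambda>i. sgn_of (w i 0))" by (simp add: D_def F_def)
    then show ?thesis
      using Dc[of "\<lambda>i. if i = 0 then 1 else 0"] by (simp add: \<pi>_def lamp_a_def)
  qed
  ultimately show ?thesis by (rule that)
qed

lemma hom_conjugate:
  assumes \<pi>: "\<pi> \<in> hom G (unitary_group d)" and U: "U \<in> unitaries d"
  shows "(\<lambda>g. mat_adjoint U * \<pi> g * U) \<in> hom G (unitary_group d)"
proof (rule homI)
  fix g assume "g \<in> carrier G"
  then have "\<pi> g \<in> unitaries d" by (rule hom_in_carrier[OF \<pi>])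
  then show "mat_adjoint U * \<pi> g * U \<in> unitaries d"
    by (intro unitaries_mult unitaries_adjoint U)
next
  fix g h assume gh: "g \<in> carrier G" "h \<in> carrier G"
  have c: "\<pi> g \<in> carrier_mat d d" "\<pi> h \<in> carrier_mat d d" "U \<in> carrier_mat d d" "mat_adjoint U \<in> carrier_mat d d"
    using hom_in_carrier[OF \<pi> gh(1)] hom_in_carrier[OF \<pi> gh(2)] U by (simp_all add: unitaries_iff)
  have "mat_adjoint U * \<pi> g * U * (mat_adjoint U * \<pi> h * U) = mat_adjoint U * (\<pi> g * \<pi> h) * U"
    using c adjoint_cancel_left(2)[OF U, of "\<pi> h * U" d] by (simp add: assoc_mult_mat[of _ d d _ d _ d])
  then show "mat_adjoint U * \<pi> (g \<otimes>\<^bsub>G\<^esub> h) * U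
      = mat_adjoint U * \<pi> g * U \<otimes>\<^bsub>unitary_group d\<^esub> (mat_adjoint U * \<pi> h * U)"
    using hom_mult[OF \<pi> gh] by simp
qed

section \<open>Representations near almost multiplicative maps\<close>

lemma hs_norm_le_iff:
  assumes "A \<in> carrier_mat d d" "0 < d"
  shows "hs_norm A \<le> c \<longleftrightarrow> fnorm A \<le> c * sqrt d"
  using assms by (simp add: hs_norm_fnorm pos_divide_le_eq)

lemma hs_norm_nonneg: "0 \<le> hs_norm A"
  by (simp add: hs_norm_fnorm)

text \<open>The radius \<open>80 n\<^sup>3\<close> exceeds \<open>6 N + 4\<close> for the window \<open>N = 12 n\<^sup>3\<close>, which leaves room for multiplying a
  configuration by the generator \<open>t\<close>.\<close>

theorem lamplighter_close_representation:
  fixes \<phi> :: "(int \<Rightarrow> int) \<times> int \<Rightarrow> complex mat"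
  assumes n: "0 < n" and d: "0 < d" and r: "80 * n ^ 3 \<le> r"
    and \<phi>: "\<And>g. g \<in> word_ball lamplighter std_gens r \<Longrightarrow> \<phi> g \<in> unitaries d"
    and \<delta>: "0 < \<delta>" "\<delta> * (1000 * real n ^ 7) \<le> 1"
    and defect: "\<And>g h. g \<in> word_ball lamplighter std_gens r \<Longrightarrow> h \<in> word_ball lamplighter std_gens r \<Longrightarrow>
      g \<otimes>\<^bsub>lamplighter\<^esub> h \<in> word_ball lamplighter std_gens r \<Longrightarrow>
      hs_norm (\<phi> (g \<otimes>\<^bsub>lamplighter\<^esub> h) - \<phi> g * \<phi> h) \<le> \<delta>"
  obtains \<pi> where "\<pi> \<in> hom lamplighter (unitary_group d)"
    "\<And>s. s \<in> std_gens \<Longrightarrow> hs_norm (\<phi> s - \<pi> s) \<le> 18 / sqrt n"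
proof -
  interpret group lamplighter by (rule group_lamplighter)
  let ?B = "word_ball lamplighter std_gens"
  define N where "N = 12 * n ^ 3"
  have n3: "1 \<le> n ^ 3" using n by simp
  have rN: "6 * N + 4 \<le> r" using r n3 unfolding N_def by linarith
  have iN: "12 * int n ^ 3 = int N" by (simp add: N_def)
  have tB: "lamp_t \<in> ?B r" "lamp_a \<in> ?B r"
    using word_ball_generator[OF std_gens_carrier, of lamp_t] word_ball_generator[OF std_gens_carrier, of lamp_a]
      word_ball_mono[of "Suc 0" r lamplighter std_gens] rN by auto
  have lB: "lamps g \<in> ?B (6 * N + 3)" if "g \<subseteq> {- int N..int N}" for g
    by (rule lamps_in_word_ball[OF that])
  have lBr: "lamps g \<in> ?B r" if "g \<subseteq> {- int N..int N}" for g
    using lB[OF that] word_ball_mono[of "6 * N + 3" r lamplighter std_gens] rN by auto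
  have \<phi>c: "\<phi> g \<in> carrier_mat d d" if "g \<in> ?B r" for g using \<phi>[OF that] by auto
  have def: "fnorm (\<phi> (g \<otimes>\<^bsub>lamplighter\<^esub> h) - \<phi> g * \<phi> h) \<le> \<delta> * sqrt d"
    if "g \<in> ?B r" "h \<in> ?B r" "g \<otimes>\<^bsub>lamplighter\<^esub> h \<in> ?B r" for g h
    using defect[OF that] \<phi>c[OF that(1)] \<phi>c[OF that(2)] d
    by (subst hs_norm_le_iff[of _ d, symmetric]) (simp_all add: minus_carrier_mat)
  have T: "\<phi> lamp_t \<in> unitaries d" by (rule \<phi>[OF tB(1)])
  have 1: "\<phi> (lamps g) \<in> unitaries d" if "g \<subseteq> {- (12 * int n ^ 3)..12 * int n ^ 3}" for g
    using that unfolding iN by (intro \<phi> lBr)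
  have 2: "fnorm (\<phi> (lamps (symdiff g h)) - \<phi> (lamps g) * \<phi> (lamps h)) \<le> \<delta> * sqrt d"
    if "g \<subseteq> {- (12 * int n ^ 3)..12 * int n ^ 3}" "h \<subseteq> {- (12 * int n ^ 3)..12 * int n ^ 3}" for g h
  proof -
    have "symdiff g h \<subseteq> {- int N..int N}" using that unfolding iN by (auto simp: symdiff_def)
    then show ?thesis using def[of "lamps g" "lamps h"] lBr that unfolding iN lamps_mult by simp
  qed
  have 3: "fnorm (\<phi> lamp_t * \<phi> (lamps {k}) - \<phi> (lamps {k + 1}) * \<phi> lamp_t) \<le> 2 * \<delta> * sqrt d"
    if k: "- (12 * int n ^ 3) \<le> k" "k < 12 * int n ^ 3" for k
  proof -
    have kB: "lamps {k} \<in> ?B r" "lamps {k + 1} \<in> ?B r" using k unfolding iN by (auto intro!: lBr)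
    have "lamp_t \<otimes>\<^bsub>lamplighter\<^esub> lamps {k} \<in> ?B (Suc (6 * N + 3))"
      by (rule word_ball_Cons) (use k iN in \<open>auto intro!: lB\<close>)
    then have tk: "lamp_t \<otimes>\<^bsub>lamplighter\<^esub> lamps {k} \<in> ?B r"
      using word_ball_mono[of "Suc (6 * N + 3)" r lamplighter std_gens] rN by auto
    then have tk': "lamps {k + 1} \<otimes>\<^bsub>lamplighter\<^esub> lamp_t \<in> ?B r" by (simp only: lamp_t_lamps)
    have "fnorm (\<phi> lamp_t * \<phi> (lamps {k}) - \<phi> (lamps {k + 1}) * \<phi> lamp_t)
        \<le> fnorm (\<phi> lamp_t * \<phi> (lamps {k}) - \<phi> (lamp_t \<otimes>\<^bsub>lamplighter\<^esub> lamps {k}))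
          + fnorm (\<phi> (lamp_t \<otimes>\<^bsub>lamplighter\<^esub> lamps {k}) - \<phi> (lamps {k + 1}) * \<phi> lamp_t)"
      using \<phi>c[OF tB(1)] \<phi>c[OF kB(1)] \<phi>c[OF kB(2)] \<phi>c[OF tk] by (intro fnorm_diff_triangle[of _ d d]) simp_all
    also have "fnorm (\<phi> lamp_t * \<phi> (lamps {k}) - \<phi> (lamp_t \<otimes>\<^bsub>lamplighter\<^esub> lamps {k}))
        = fnorm (\<phi> (lamp_t \<otimes>\<^bsub>lamplighter\<^esub> lamps {k}) - \<phi> lamp_t * \<phi> (lamps {k}))"
      using \<phi>c[OF tB(1)] \<phi>c[OF kB(1)] \<phi>c[OF tk] by (intro fnorm_minus_commute[of _ d d]) simp_all
    also have "\<dots> \<le> \<delta> * sqrt d" by (rule def[OF tB(1) kB(1) tk])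
    also have "fnorm (\<phi> (lamp_t \<otimes>\<^bsub>lamplighter\<^esub> lamps {k}) - \<phi> (lamps {k + 1}) * \<phi> lamp_t) \<le> \<delta> * sqrt d"
      unfolding lamp_t_lamps by (rule def[OF kB(2) tB(1) tk'])
    finally show ?thesis by simp
  qed
  obtain U T' w where U: "U \<in> unitaries d" and T': "T' \<in> unitaries d"
    and w: "\<And>i j. i < d \<Longrightarrow> j < d \<Longrightarrow> T' $$ (i, j) \<noteq> 0 \<Longrightarrow> w i = shift 1 (w j)"
    and dT: "fnorm (U * \<phi> lamp_t - T' * U) \<le> 18 * sqrt (d / n)"
    and dA: "fnorm (U * \<phi> (lamps {0}) - diag d (\<lambda>i. sgn_of (w i 0)) * U) \<le> 18 * sqrt (d / n)"
    by (rule approximate_lamplighter_matrices[where \<Phi> = "\<lambda>g. \<phi> (lamps g)", OF n d T 1 \<delta> 2 3])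
      (assumption | rule that)+
  obtain \<pi>0 where \<pi>0: "\<pi>0 \<in> hom lamplighter (unitary_group d)" "\<pi>0 lamp_t = T'"
    "\<pi>0 lamp_a = diag d (\<lambda>i. sgn_of (w i 0))"
    by (rule permuted_labels_representation[OF T' w])
  define \<pi> where "\<pi> g = mat_adjoint U * \<pi>0 g * U" for g
  have \<pi>: "\<pi> \<in> hom lamplighter (unitary_group d)"
    using hom_conjugate[OF \<pi>0(1) U] by (simp add: \<pi>_def[abs_def])
  have Uc: "U \<in> carrier_mat d d" "mat_adjoint U \<in> carrier_mat d d" using U by (simp_all add: unitaries_iff)
  have close: "hs_norm (\<phi> s - \<pi> s) \<le> 18 / sqrt n"
    if s: "s \<in> ?B r" and le: "fnorm (U * \<phi> s - \<pi>0 s * U) \<le> 18 * sqrt (d / n)"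
      and c: "\<pi>0 s \<in> carrier_mat d d" for s
  proof -
    have "U * (\<phi> s - \<pi> s) = U * \<phi> s - U * \<pi> s"
      using Uc \<phi>c[OF s] c by (simp add: \<pi>_def mult_minus_distrib_mat[of _ d d _ d])
    also have "U * \<pi> s = \<pi>0 s * U"
      using Uc c adjoint_cancel_left(2)[OF U, of "\<pi>0 s * U" d]
      by (simp add: \<pi>_def assoc_mult_mat[of _ d d _ d _ d])
    finally have e: "U * (\<phi> s - \<pi> s) = U * \<phi> s - \<pi>0 s * U" .
    have pc: "\<phi> s - \<pi> s \<in> carrier_mat d d" using Uc c by (simp add: \<pi>_def minus_carrier_mat)
    have "fnorm (\<phi> s - \<pi> s) = fnorm (U * \<phi> s - \<pi>0 s * U)"
      unfolding e[symmetric] by (rule fnorm_unitary_left[OF U pc, symmetric])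
    then have "fnorm (\<phi> s - \<pi> s) \<le> (18 / sqrt n) * sqrt d" using le by (simp add: real_sqrt_divide)
    then show ?thesis using pc d by (simp add: hs_norm_le_iff)
  qed
  have "hs_norm (\<phi> s - \<pi> s) \<le> 18 / sqrt n" if "s \<in> std_gens" for s
  proof -
    have "s = lamp_t \<or> s = lamp_a" using that by auto
    moreover have "hs_norm (\<phi> lamp_t - \<pi> lamp_t) \<le> 18 / sqrt n"
      using dT T' \<pi>0(2) by (intro close tB) (simp_all add: unitaries_iff)
    moreover have "hs_norm (\<phi> lamp_a - \<pi> lamp_a) \<le> 18 / sqrt n"
      using dA \<pi>0(3) by (intro close tB) (simp_all add: lamp_a_lamps)
    ultimately show ?thesis by blast
  qed
  then show ?thesis by (rule that[OF \<pi>])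
qed

context group
begin

section \<open>Stability rate and stability radius\<close>

lemma local_defect_ge:
  assumes S: "finite S" and g: "g \<in> word_ball G S r" "h \<in> word_ball G S r" "g \<otimes> h \<in> word_ball G S r"
  shows "hs_norm (\<phi> (g \<otimes> h) - \<phi> g * \<phi> h) \<le> local_defect G S r \<phi>"
  unfolding local_defect_def
proof (rule Max_ge)
  let ?B = "word_ball G S r"
  have "{hs_norm (\<phi> (g \<otimes> h) - \<phi> g * \<phi> h) | g h. g \<in> ?B \<and> h \<in> ?B \<and> g \<otimes> h \<in> ?B}
      \<subseteq> (\<lambda>(g, h). hs_norm (\<phi> (g \<otimes> h) - \<phi> g * \<phi> h)) ` (?B \<times> ?B)" by auto
  then show "finite {hs_norm (\<phi> (g \<otimes> h) - \<phi> g * \<phi> h) | g h. g \<in> ?B \<and> h \<in> ?B \<and> g \<otimes> h \<in> ?B}"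
    by (rule finite_subset) (simp add: word_ball_finite[OF S])
  show "hs_norm (\<phi> (g \<otimes> h) - \<phi> g * \<phi> h)
      \<in> {hs_norm (\<phi> (g \<otimes> h) - \<phi> g * \<phi> h) | g h. g \<in> ?B \<and> h \<in> ?B \<and> g \<otimes> h \<in> ?B}"
    using g by blast
qed

end

lemma global_defect_le:
  assumes S: "finite S" "S \<noteq> {}" and \<pi>: "\<pi> \<in> hom G (unitary_group d)"
    and c: "\<And>s. s \<in> S \<Longrightarrow> hs_norm (\<phi> s - \<pi> s) \<le> c"
  shows "global_defect G S d \<phi> \<le> c"
  unfolding global_defect_def
proof (rule cINF_lower2[OF _ \<pi>])
  obtain s where s: "s \<in> S" using S by blast
  show "bdd_below ((\<lambda>\<pi>. MAX g\<in>S. hs_norm (\<phi> g - \<pi> g)) ` hom G (unitary_group d))"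
  proof (rule bdd_belowI[of _ 0])
    fix y assume "y \<in> (\<lambda>\<pi>. MAX g\<in>S. hs_norm (\<phi> g - \<pi> g)) ` hom G (unitary_group d)"
    then obtain \<rho> where y: "y = (MAX g\<in>S. hs_norm (\<phi> g - \<rho> g))" by blast
    have "hs_norm (\<phi> s - \<rho> s) \<le> y" unfolding y using S s by (intro Max_ge) auto
    then show "0 \<le> y" using hs_norm_nonneg[of "\<phi> s - \<rho> s"] by linarith
  qed
  show "(MAX g\<in>S. hs_norm (\<phi> g - \<pi> g)) \<le> c" using S c by (intro Max.boundedI) auto
qed

lemma SRate_ge:
  assumes "0 < \<delta>"
    and "\<And>d \<phi>. 0 < d \<Longrightarrow> (\<And>g. g \<in> word_ball G S r \<Longrightarrow> \<phi> g \<in> unitaries d) \<Longrightarrow>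
      local_defect G S r \<phi> < \<delta> \<Longrightarrow> global_defect G S d \<phi> < \<kappa>"
  shows "ennreal \<delta> \<le> SRate G S r \<kappa>"
  unfolding SRate_def using assms by (intro Sup_upper CollectI exI[of _ \<delta>]) (auto simp: Pi_iff)

text \<open>Each letter of a word adds its own distance and one defect. Inverse letters cost two more defects,
  since almost multiplicativity forces \<open>\<phi> (inv s)\<close> to be close to the inverse of \<open>\<phi> s\<close>.\<close>

lemma representation_close_on_ball:
  fixes G (structure)
  assumes G: "group G" and S: "S \<subseteq> carrier G" and lr: "l \<le> r" "0 < r" and d: "0 < d"
    and \<phi>: "\<And>g. g \<in> word_ball G S r \<Longrightarrow> \<phi> g \<in> unitaries d"
    and defect: "\<And>g h. g \<in> word_ball G S r \<Longrightarrow> h \<in> word_ball G S r \<Longrightarrow>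
      g \<otimes>\<^bsub>G\<^esub> h \<in> word_ball G S r \<Longrightarrow> hs_norm (\<phi> (g \<otimes>\<^bsub>G\<^esub> h) - \<phi> g * \<phi> h) \<le> \<delta>"
    and \<pi>: "\<pi> \<in> hom G (unitary_group d)" and close: "\<And>s. s \<in> S \<Longrightarrow> hs_norm (\<phi> s - \<pi> s) \<le> \<epsilon>"
    and \<epsilon>: "0 \<le> \<epsilon>" and g: "g \<in> word_ball G S l"
  shows "hs_norm (\<phi> g - \<pi> g) \<le> real l * (\<epsilon> + 3 * \<delta>) + \<delta>"
proof -
  interpret group G by (rule G)
  interpret U: group "unitary_group d" by (rule group_unitary_group)
  let ?B = "word_ball G S"
  define D where "D = \<delta> * sqrt d"
  define e where "e = \<epsilon> * sqrt d"
  have \<phi>c: "\<phi> g \<in> carrier_mat d d" if "g \<in> ?B r" for g using \<phi>[OF that] by auto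
  have def: "fnorm (\<phi> (g \<otimes> h) - \<phi> g * \<phi> h) \<le> D" if "g \<in> ?B r" "h \<in> ?B r" "g \<otimes> h \<in> ?B r" for g h
    using defect[OF that] \<phi>c[OF that(1)] \<phi>c[OF that(2)] d unfolding D_def
    by (subst hs_norm_le_iff[of _ d, symmetric]) (simp_all add: minus_carrier_mat)
  have \<pi>U: "\<pi> g \<in> unitaries d" if "g \<in> carrier G" for g by (rule hom_in_carrier[OF \<pi> that])
  have \<pi>c: "\<pi> g \<in> carrier_mat d d" if "g \<in> carrier G" for g using \<pi>U[OF that] by auto
  have \<pi>1: "\<pi> \<one> = 1\<^sub>m d" using hom_one[OF \<pi> G U.is_group] by simp
  have \<pi>m: "\<pi> (g \<otimes> h) = \<pi> g * \<pi> h" if "g \<in> carrier G" "h \<in> carrier G" for g h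
    using hom_mult[OF \<pi> that] by simp
  have oneB: "\<one> \<in> ?B r" by (rule word_ball_one)
  have D0: "0 \<le> D" using def[OF oneB oneB] oneB fnorm_nonneg order_trans by (metis r_one one_closed)
  have \<phi>1: "fnorm (\<phi> \<one> - 1\<^sub>m d) \<le> D"
  proof -
    have U1: "\<phi> \<one> \<in> unitaries d" and c1: "\<phi> \<one> \<in> carrier_mat d d" using \<phi>[OF oneB] \<phi>c[OF oneB] by auto
    have "\<phi> \<one> * \<phi> \<one> - \<phi> \<one> = \<phi> \<one> * (\<phi> \<one> - 1\<^sub>m d)"
      using c1 by (simp add: mult_minus_distrib_mat[of _ d d _ d])
    then have "fnorm (\<phi> \<one> - 1\<^sub>m d) = fnorm (\<phi> \<one> * \<phi> \<one> - \<phi> \<one>)"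
      using fnorm_unitary_left[OF U1, of "\<phi> \<one> - 1\<^sub>m d" d] by (simp add: minus_carrier_mat)
    also have "\<dots> = fnorm (\<phi> \<one> - \<phi> \<one> * \<phi> \<one>)" using c1 by (intro fnorm_minus_commute[of _ d d]) simp_all
    also have "\<dots> \<le> D" using def[OF oneB oneB] oneB by simp
    finally show ?thesis .
  qed
  have genB: "s \<in> ?B r" if "s \<in> S \<union> m_inv G ` S" for s
    using word_ball_generator[OF S that] word_ball_mono[of "Suc 0" r G S] lr by auto
  have s1: "fnorm (\<phi> s - \<pi> s) \<le> e" if s: "s \<in> S" for s
  proof -
    have "s \<in> carrier G" "s \<in> ?B r" using S s genB by auto
    then show ?thesis using close[OF s] d \<phi>c \<pi>c unfolding e_def
      by (subst hs_norm_le_iff[of _ d, symmetric]) (simp_all add: minus_carrier_mat)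
  qed
  have s2: "fnorm (\<phi> s - \<pi> s) \<le> e + 2 * D" if s: "s \<in> S \<union> m_inv G ` S" for s
  proof (cases "s \<in> S")
    case True
    then show ?thesis using s1[OF True] D0 by simp
  next
    case False
    then obtain a where a: "a \<in> S" "s = inv a" using s by blast
    have ac: "a \<in> carrier G" using a S by auto
    have B: "a \<in> ?B r" "s \<in> ?B r" using a genB s by auto
    have c: "\<phi> a \<in> carrier_mat d d" "\<phi> s \<in> carrier_mat d d" "\<pi> a \<in> carrier_mat d d" "\<pi> s \<in> carrier_mat d d"
      using B \<phi>c \<pi>c ac a by auto
    have as: "a \<otimes> s = \<one>" using a ac by simp
    have "\<pi> a * \<pi> s = 1\<^sub>m d" using \<pi>m[of a s] ac a as \<pi>1 by simp
    then have "\<pi> a * (\<phi> s - \<pi> s) = \<pi> a * \<phi> s - 1\<^sub>m d"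
      using c by (simp add: mult_minus_distrib_mat[of _ d d _ d])
    then have "fnorm (\<phi> s - \<pi> s) = fnorm (\<pi> a * \<phi> s - 1\<^sub>m d)"
      using fnorm_unitary_left[OF \<pi>U[OF ac], of "\<phi> s - \<pi> s" d] c by (simp add: minus_carrier_mat)
    also have "\<dots> \<le> fnorm (\<pi> a * \<phi> s - \<phi> a * \<phi> s) + fnorm (\<phi> a * \<phi> s - 1\<^sub>m d)"
      using c by (intro fnorm_diff_triangle[of _ d d]) simp_all
    also have "fnorm (\<phi> a * \<phi> s - 1\<^sub>m d) \<le> fnorm (\<phi> a * \<phi> s - \<phi> \<one>) + fnorm (\<phi> \<one> - 1\<^sub>m d)"
      using c \<phi>c[OF oneB] by (intro fnorm_diff_triangle[of _ d d]) simp_all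
    also have "fnorm (\<phi> a * \<phi> s - \<phi> \<one>) = fnorm (\<phi> \<one> - \<phi> a * \<phi> s)"
      using c \<phi>c[OF oneB] by (intro fnorm_minus_commute[of _ d d]) simp_all
    also have "\<dots> \<le> D" using def[OF B] as oneB by simp
    also have "fnorm (\<pi> a * \<phi> s - \<phi> a * \<phi> s) = fnorm (\<pi> a - \<phi> a)"
    proof -
      have "\<pi> a * \<phi> s - \<phi> a * \<phi> s = (\<pi> a - \<phi> a) * \<phi> s"
        using c by (simp add: minus_mult_distrib_mat[of _ d d _ _ d])
      then show ?thesis using fnorm_unitary_right[OF \<phi>[OF B(2)], of "\<pi> a - \<phi> a" d] c by (simp add: minus_carrier_mat)
    qed
    also have "\<dots> = fnorm (\<phi> a - \<pi> a)" using c by (intro fnorm_minus_commute[of _ d d]) simp_all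
    also have "\<dots> \<le> e" by (rule s1[OF a(1)])
    finally show ?thesis using \<phi>1 by linarith
  qed
  have "\<exists>k\<le>l. fnorm (\<phi> g - \<pi> g) \<le> real k * (e + 3 * D) + D"
    using g
  proof (induction rule: word_ball_induct)
    case one
    then show ?case using \<phi>1 \<pi>1 by simp
  next
    case (mult k s h)
    have sc: "s \<in> carrier G" using mult(2) S by auto
    have hc: "h \<in> carrier G" by (rule word_ball_carrier[OF S mult(3)])
    have B: "s \<in> ?B r" "h \<in> ?B r" "s \<otimes> h \<in> ?B r"
      using genB[OF mult(2)] mult(3) word_ball_Cons[OF mult(2,3)] word_ball_mono[of k r G S]
        word_ball_mono[of "Suc k" r G S] mult(1) lr by auto
    have c: "\<phi> s \<in> carrier_mat d d" "\<phi> h \<in> carrier_mat d d" "\<phi> (s \<otimes> h) \<in> carrier_mat d d"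
      "\<pi> s \<in> carrier_mat d d" "\<pi> h \<in> carrier_mat d d"
      using B \<phi>c \<pi>c sc hc by auto
    have "fnorm (\<phi> (s \<otimes> h) - \<pi> (s \<otimes> h)) \<le> fnorm (\<phi> (s \<otimes> h) - \<phi> s * \<phi> h) + fnorm (\<phi> s * \<phi> h - \<pi> s * \<pi> h)"
      unfolding \<pi>m[OF sc hc] using c by (intro fnorm_diff_triangle[of _ d d]) simp_all
    also have "fnorm (\<phi> (s \<otimes> h) - \<phi> s * \<phi> h) \<le> D" by (rule def[OF B])
    also have "fnorm (\<phi> s * \<phi> h - \<pi> s * \<pi> h) \<le> fnorm (\<phi> s * \<phi> h - \<pi> s * \<phi> h) + fnorm (\<pi> s * \<phi> h - \<pi> s * \<pi> h)"
      using c by (intro fnorm_diff_triangle[of _ d d]) simp_all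
    also have "fnorm (\<phi> s * \<phi> h - \<pi> s * \<phi> h) = fnorm (\<phi> s - \<pi> s)"
    proof -
      have "\<phi> s * \<phi> h - \<pi> s * \<phi> h = (\<phi> s - \<pi> s) * \<phi> h"
        using c by (simp add: minus_mult_distrib_mat[of _ d d _ _ d])
      then show ?thesis using fnorm_unitary_right[OF \<phi>[OF B(2)], of "\<phi> s - \<pi> s" d] c by (simp add: minus_carrier_mat)
    qed
    also have "fnorm (\<pi> s * \<phi> h - \<pi> s * \<pi> h) = fnorm (\<phi> h - \<pi> h)"
    proof -
      have "\<pi> s * \<phi> h - \<pi> s * \<pi> h = \<pi> s * (\<phi> h - \<pi> h)"
        using c by (simp add: mult_minus_distrib_mat[of _ d d _ d])
      then show ?thesis using fnorm_unitary_left[OF \<pi>U[OF sc], of "\<phi> h - \<pi> h" d] c by (simp add: minus_carrier_mat)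
    qed
    finally have "fnorm (\<phi> (s \<otimes> h) - \<pi> (s \<otimes> h)) \<le> D + ((e + 2 * D) + (real k * (e + 3 * D) + D))"
      using s2[OF mult(2)] mult(4) by linarith
    then show ?case by (simp add: algebra_simps)
  qed
  then obtain k where k: "k \<le> l" "fnorm (\<phi> g - \<pi> g) \<le> real k * (e + 3 * D) + D" by blast
  have "0 \<le> e + 3 * D" using D0 \<epsilon> by (simp add: e_def)
  then have "real k * (e + 3 * D) \<le> real l * (e + 3 * D)" using k(1) by (intro mult_right_mono) simp_all
  then have "fnorm (\<phi> g - \<pi> g) \<le> real l * (e + 3 * D) + D" using k(2) by linarith
  also have "\<dots> = (real l * (\<epsilon> + 3 * \<delta>) + \<delta>) * sqrt d" by (simp add: e_def D_def algebra_simps)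
  finally have "fnorm (\<phi> g - \<pi> g) \<le> (real l * (\<epsilon> + 3 * \<delta>) + \<delta>) * sqrt d" .
  moreover have "\<phi> g - \<pi> g \<in> carrier_mat d d"
    using \<pi>c[OF word_ball_carrier[OF S g]] by (simp add: minus_carrier_mat)
  ultimately show ?thesis using d by (simp add: hs_norm_le_iff)
qed

lemma SRate_lamplighter_std:
  assumes n: "0 < n" and r: "80 * n ^ 3 \<le> r" and \<kappa>: "18 / sqrt n < \<kappa>"
  shows "ennreal (1 / (1000 * real n ^ 7)) \<le> SRate lamplighter std_gens r \<kappa>"
proof (rule SRate_ge)
  interpret group lamplighter by (rule group_lamplighter)
  show \<delta>: "0 < 1 / (1000 * real n ^ 7)" using n by simp
  fix d and \<phi> :: "(int \<Rightarrow> int) \<times> int \<Rightarrow> complex mat"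
  assume d: "0 < d" and \<phi>: "\<And>g. g \<in> word_ball lamplighter std_gens r \<Longrightarrow> \<phi> g \<in> unitaries d"
    and ld: "local_defect lamplighter std_gens r \<phi> < 1 / (1000 * real n ^ 7)"
  have \<delta>': "1 / (1000 * real n ^ 7) * (1000 * real n ^ 7) \<le> 1" using n by simp
  have defect: "hs_norm (\<phi> (g \<otimes>\<^bsub>lamplighter\<^esub> h) - \<phi> g * \<phi> h) \<le> 1 / (1000 * real n ^ 7)"
    if "g \<in> word_ball lamplighter std_gens r" "h \<in> word_ball lamplighter std_gens r"
      "g \<otimes>\<^bsub>lamplighter\<^esub> h \<in> word_ball lamplighter std_gens r" for g h
    using local_defect_ge[OF _ that, of \<phi>] ld by simp
  obtain \<pi> where \<pi>: "\<pi> \<in> hom lamplighter (unitary_group d)"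
    "\<And>s. s \<in> std_gens \<Longrightarrow> hs_norm (\<phi> s - \<pi> s) \<le> 18 / sqrt n"
    by (rule lamplighter_close_representation[OF n d r \<phi> \<delta> \<delta>' defect]) (assumption | rule that)+
  have "global_defect lamplighter std_gens d \<phi> \<le> 18 / sqrt n"
    by (rule global_defect_le[OF _ _ \<pi>]) auto
  then show "global_defect lamplighter std_gens d \<phi> < \<kappa>" using \<kappa> by simp
qed

text \<open>The two generating sets have word lengths bounded by a common \<open>l\<close> with respect to each other. The
  ball of radius \<open>80 n\<^sup>3 + l\<close> for the standard generators contains the other generators and lies in the
  ball of \<open>l\<close> times that radius.\<close>

lemma SRate_lamplighter:
  assumes S: "finite_generating_set lamplighter S"
  obtains l where "0 < l" "\<And>n \<kappa>. 0 < n \<Longrightarrow> 22 * (real l + 1) / sqrt n < \<kappa> \<Longrightarrow>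
    ennreal (1 / (1000 * real n ^ 7)) \<le> SRate lamplighter S (l * (80 * n ^ 3 + l)) \<kappa>"
proof -
  interpret group lamplighter by (rule group_lamplighter)
  have Sf: "finite S" and Sc: "S \<subseteq> carrier lamplighter" and Sg: "generate lamplighter S = carrier lamplighter"
    using S by (simp_all add: finite_generating_set_def)
  have Sne: "S \<noteq> {}"
  proof
    assume "S = {}"
    then have "carrier lamplighter = {\<one>\<^bsub>lamplighter\<^esub>}" using Sg generate_empty by simp
    then show False using lamp_t_in by (simp add: lamp_t_def one_lamplighter)
  qed
  have uniform: "\<exists>l. \<forall>g\<in>F. g \<in> word_ball lamplighter T l"
    if T: "finite_generating_set lamplighter T" and F: "finite F" "F \<subseteq> carrier lamplighter" for F T
    using F
  proof (induction F rule: finite_induct)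
    case (insert g F)
    then obtain l where l: "\<forall>g\<in>F. g \<in> word_ball lamplighter T l" by blast
    have "g \<in> generate lamplighter T" using insert.prems T by (simp add: finite_generating_set_def)
    then obtain k where k: "g \<in> word_ball lamplighter T k"
      using word_ball_exhausts[of T g] T by (auto simp: finite_generating_set_def)
    have "h \<in> word_ball lamplighter T (max k l)" if "h \<in> insert g F" for h
      using that k l word_ball_mono[of k "max k l" lamplighter T] word_ball_mono[of l "max k l" lamplighter T] by auto
    then show ?case by blast
  qed simp
  obtain l1 where l1: "\<forall>g\<in>std_gens. g \<in> word_ball lamplighter S l1"
    using uniform[OF S, of std_gens] std_gens_carrier by auto
  obtain l2 where l2: "\<forall>g\<in>S. g \<in> word_ball lamplighter std_gens l2"
    using uniform[OF finite_generating_set_lamplighter Sf Sc] by auto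
  define l where "l = Suc (max l1 l2)"
  have l: "0 < l" and ll: "l1 \<le> l" "l2 \<le> l" by (simp_all add: l_def)
  have stdS: "g \<in> word_ball lamplighter S l" if "g \<in> std_gens" for g
    by (rule subsetD[OF word_ball_mono[OF ll(1)]]) (rule bspec[OF l1 that])
  have Sstd: "g \<in> word_ball lamplighter std_gens l" if "g \<in> S" for g
    by (rule subsetD[OF word_ball_mono[OF ll(2)]]) (rule bspec[OF l2 that])
  have "ennreal (1 / (1000 * real n ^ 7)) \<le> SRate lamplighter S (l * (80 * n ^ 3 + l)) \<kappa>"
    if n: "0 < n" and \<kappa>: "22 * (real l + 1) / sqrt n < \<kappa>" for n \<kappa>
  proof (rule SRate_ge)
    let ?\<delta> = "1 / (1000 * real n ^ 7)"
    let ?r = "80 * n ^ 3 + l"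
    show \<delta>: "0 < ?\<delta>" using n by simp
    fix d and \<phi> :: "(int \<Rightarrow> int) \<times> int \<Rightarrow> complex mat"
    assume d: "0 < d" and \<phi>S: "\<And>g. g \<in> word_ball lamplighter S (l * ?r) \<Longrightarrow> \<phi> g \<in> unitaries d"
      and ld: "local_defect lamplighter S (l * ?r) \<phi> < ?\<delta>"
    have sub: "g \<in> word_ball lamplighter S (l * ?r)" if "g \<in> word_ball lamplighter std_gens ?r" for g
      using word_ball_rescale[OF std_gens_carrier Sc stdS, of ?r] that by blast
    have \<phi>: "\<phi> g \<in> unitaries d" if "g \<in> word_ball lamplighter std_gens ?r" for g
      by (rule \<phi>S[OF sub[OF that]])
    have defect: "hs_norm (\<phi> (g \<otimes>\<^bsub>lamplighter\<^esub> h) - \<phi> g * \<phi> h) \<le> ?\<delta>"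
      if "g \<in> word_ball lamplighter std_gens ?r" "h \<in> word_ball lamplighter std_gens ?r"
        "g \<otimes>\<^bsub>lamplighter\<^esub> h \<in> word_ball lamplighter std_gens ?r" for g h
      using local_defect_ge[OF Sf sub[OF that(1)] sub[OF that(2)] sub[OF that(3)], of \<phi>] ld by simp
    have \<delta>': "?\<delta> * (1000 * real n ^ 7) \<le> 1" using n by simp
    have r80: "80 * n ^ 3 \<le> ?r" by simp
    obtain \<pi> where \<pi>: "\<pi> \<in> hom lamplighter (unitary_group d)"
      and close: "\<And>s. s \<in> std_gens \<Longrightarrow> hs_norm (\<phi> s - \<pi> s) \<le> 18 / sqrt n"
      by (rule lamplighter_close_representation[OF n d r80 \<phi> \<delta> \<delta>' defect]) (assumption | rule that)+
    have sn: "1 \<le> sqrt n" using n by simp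
    have \<delta>sn: "?\<delta> \<le> 1 / sqrt n"
    proof -
      have "1 * sqrt n \<le> sqrt n * sqrt n" using sn by (rule mult_right_mono) simp
      also have "\<dots> = real n ^ 1" by simp
      also have "\<dots> \<le> real n ^ 7" using n by (intro power_increasing) auto
      finally have "sqrt n \<le> real n ^ 7" by simp
      moreover have "0 \<le> real n ^ 7" by simp
      ultimately have "sqrt n \<le> 1000 * real n ^ 7" by linarith
      then show ?thesis using sn by (intro divide_left_mono) simp_all
    qed
    have lr: "l \<le> ?r" "0 < ?r" using l by simp_all
    have e0: "0 \<le> 18 / sqrt (real n)" by simp
    have "hs_norm (\<phi> s - \<pi> s) \<le> real l * (18 / sqrt n + 3 * ?\<delta>) + ?\<delta>" if "s \<in> S" for s
      by (rule representation_close_on_ball[OF group_lamplighter std_gens_carrier lr d \<phi> defect \<pi> close e0 Sstd[OF that]])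
    then have "global_defect lamplighter S d \<phi> \<le> real l * (18 / sqrt n + 3 * ?\<delta>) + ?\<delta>"
      by (rule global_defect_le[OF Sf Sne \<pi>])
    also have "\<dots> \<le> real l * (18 / sqrt n + 3 * (1 / sqrt n)) + 1 / sqrt n"
      using \<delta>sn by (intro add_mono mult_left_mono) auto
    also have "\<dots> = (21 * real l + 1) / sqrt n" by (simp add: add_divide_distrib algebra_simps)
    also have "\<dots> \<le> 22 * (real l + 1) / sqrt n" by (intro divide_right_mono) simp_all
    finally show "global_defect lamplighter S d \<phi> < \<kappa>" using \<kappa> by simp
  qed
  then show ?thesis by (rule that[OF l])
qed

text \<open>The choice \<open>n \<approx> (A x)\<^sup>2\<close> makes the distance \<open>A / \<surd>n\<close> smaller than \<open>1 / x\<close>; the radius is then of order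
  \<open>x\<^sup>6\<close>, which is at most \<open>x\<^sup>2\<^sup>1\<close> for \<open>x \<ge> 1\<close>.\<close>

lemma SRad_lamplighter:
  assumes S: "finite_generating_set lamplighter S"
  shows "\<exists>C::real. C \<ge> 1 \<and> (\<forall>x::real. x \<ge> 1 \<longrightarrow>
    ereal_of_enat (SRad lamplighter S x) \<le> ereal (C * (C * x) ^ 21))"
proof -
  obtain l where l: "0 < l" and rate: "\<And>n \<kappa>. 0 < n \<Longrightarrow> 22 * (real l + 1) / sqrt n < \<kappa> \<Longrightarrow>
    ennreal (1 / (1000 * real n ^ 7)) \<le> SRate lamplighter S (l * (80 * n ^ 3 + l)) \<kappa>"
    using SRate_lamplighter[OF S] by metis
  define A where "A = 22 * (real l + 1)"
  have A: "2 \<le> A" "real l \<le> A" by (simp_all add: A_def)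
  define C where "C = 641 * A ^ 7"
  have A7: "1 \<le> A ^ 7" using A by simp
  then have C: "1 \<le> C" by (simp add: C_def)
  have "ereal_of_enat (SRad lamplighter S x) \<le> ereal (C * (C * x) ^ 21)" if x: "1 \<le> x" for x
  proof -
    define q where "q = A * x"
    have q: "2 \<le> q" using mult_mono[of 2 A 1 x] A x by (simp add: q_def)
    define n where "n = nat \<lceil>q\<^sup>2\<rceil> + 1"
    have n0: "0 < n" by (simp add: n_def)
    have q2: "q\<^sup>2 < real n" unfolding n_def by linarith
    have "4 \<le> q\<^sup>2" using power_mono[of 2 q 2] q by simp
    then have n_le: "real n \<le> 2 * q\<^sup>2" unfolding n_def by linarith
    have "sqrt (q\<^sup>2) < sqrt n" using q2 by (rule real_sqrt_less_mono)
    then have "q < sqrt n" using q by simp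
    then have "A / sqrt n < 1 / x"
      using x q by (simp add: q_def divide_simps mult.commute)
    then have "ennreal (1 / (1000 * real n ^ 7)) \<le> SRate lamplighter S (l * (80 * n ^ 3 + l)) (1 / x)"
      by (intro rate n0) (simp add: A_def)
    moreover have "0 < ennreal (1 / (1000 * real n ^ 7))" using n0 by (simp add: ennreal_zero_less_divide)
    ultimately have pos: "0 < SRate lamplighter S (l * (80 * n ^ 3 + l)) (1 / x)" by (rule less_le_trans[rotated])
    have "SRad lamplighter S x \<le> enat (l * (80 * n ^ 3 + l))"
      unfolding SRad_def using pos l by (intro Inf_lower CollectI exI[of _ "l * (80 * n ^ 3 + l)"]) auto
    then have "ereal_of_enat (SRad lamplighter S x) \<le> ereal (real (l * (80 * n ^ 3 + l)))"
      by (metis ereal_of_enat_le_iff ereal_of_enat_simps(1))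
    also have "real (l * (80 * n ^ 3 + l)) \<le> C * (C * x) ^ 21"
    proof -
      have n3: "real n ^ 3 \<le> 8 * q ^ 6"
      proof -
        have "real n ^ 3 \<le> (2 * q\<^sup>2) ^ 3" using n_le by (intro power_mono) simp_all
        also have "\<dots> = 8 * q ^ 6" by (simp add: power_mult_distrib flip: power_mult)
        finally show ?thesis .
      qed
      have x6: "1 \<le> x ^ 6" using x by simp
      have "real (l * (80 * n ^ 3 + l)) = real l * (80 * real n ^ 3 + real l)" by simp
      also have "\<dots> \<le> A * (80 * (8 * q ^ 6) + A)" using A n3 by (intro mult_mono add_mono) auto
      also have "\<dots> = 640 * A ^ 7 * x ^ 6 + A\<^sup>2"
        by (simp add: q_def power_mult_distrib algebra_simps eval_nat_numeral)
      also have "A\<^sup>2 \<le> A ^ 7 * x ^ 6"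
      proof -
        have "A\<^sup>2 * 1 \<le> A ^ 7 * x ^ 6" using A x6 by (intro mult_mono power_increasing) auto
        then show ?thesis by simp
      qed
      also have "640 * A ^ 7 * x ^ 6 + A ^ 7 * x ^ 6 = C * x ^ 6" by (simp add: C_def)
      also have "C * x ^ 6 \<le> C * (C * x) ^ 21"
      proof (rule mult_left_mono)
        have "x ^ 6 \<le> x ^ 21" using x by (intro power_increasing) auto
        also have "\<dots> \<le> (C * x) ^ 21" using C x mult_mono[of 1 C x x] by (intro power_mono) auto
        finally show "x ^ 6 \<le> (C * x) ^ 21" .
      qed (use C in simp)
      finally show ?thesis by simp
    qed
    finally show ?thesis by simp
  qed
  then show ?thesis using C by blast
qed

lemma hs_norm_unitary_diff_le:
  assumes "U \<in> unitaries d" "V \<in> unitaries d" "0 < d"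
  shows "hs_norm (U - V) \<le> 2"
proof -
  have c: "U \<in> carrier_mat d d" "V \<in> carrier_mat d d" using assms by auto
  have z: "0\<^sub>m d d - V \<in> carrier_mat d d" using c by (simp add: minus_carrier_mat)
  have "fnorm (U - V) \<le> fnorm (U - 0\<^sub>m d d) + fnorm (0\<^sub>m d d - V)"
    using c by (intro fnorm_diff_triangle[of _ d d]) simp_all
  also have "fnorm (0\<^sub>m d d - V) = fnorm (V - 0\<^sub>m d d)" using c by (intro fnorm_minus_commute[of _ d d]) simp_all
  also have "V - 0\<^sub>m d d = V" using c by (intro eq_matI) auto
  also have "U - 0\<^sub>m d d = U" using c by (intro eq_matI) auto
  also have "fnorm U + fnorm V = 2 * sqrt d" using assms by (simp add: fnorm_def fro_unitary)
  finally show ?thesis using hs_norm_le_iff[OF minus_carrier_mat[OF c(2), of U] assms(3), of 2] by simp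
qed

lemma SRate_lamplighter_trivial:
  assumes \<kappa>: "2 < \<kappa>" and r: "0 < r" and \<delta>: "0 < \<delta>"
  shows "ennreal \<delta> \<le> SRate lamplighter std_gens r \<kappa>"
proof (rule SRate_ge[OF \<delta>])
  interpret group lamplighter by (rule group_lamplighter)
  fix d and \<phi> :: "(int \<Rightarrow> int) \<times> int \<Rightarrow> complex mat"
  assume d: "0 < d" and \<phi>: "\<And>g. g \<in> word_ball lamplighter std_gens r \<Longrightarrow> \<phi> g \<in> unitaries d"
  have "(\<lambda>_. 1\<^sub>m d) \<in> hom lamplighter (unitary_group d)"
    by (rule homI) simp_all
  moreover have "hs_norm (\<phi> s - 1\<^sub>m d) \<le> 2" if s: "s \<in> std_gens" for s
  proof -
    have "s \<in> word_ball lamplighter std_gens r"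
      using word_ball_generator[OF std_gens_carrier, of s] word_ball_mono[of "Suc 0" r lamplighter std_gens] s r by auto
    then show ?thesis by (rule hs_norm_unitary_diff_le[OF \<phi> unitaries_one d])
  qed
  ultimately have "global_defect lamplighter std_gens d \<phi> \<le> 2"
    by (intro global_defect_le[where \<pi> = "\<lambda>_. 1\<^sub>m d"]) auto
  then show "global_defect lamplighter std_gens d \<phi> < \<kappa>" using \<kappa> by simp
qed

text \<open>For \<open>\<kappa> \<le> 2\<close> the number \<open>n = \<lceil>400 / \<kappa>\<^sup>2\<rceil>\<close> satisfies \<open>18 / \<surd>n < \<kappa>\<close> and is at most \<open>404 / \<kappa>\<^sup>2\<close>. The powers
  of two in the constants convert the exponents 6 and 14 of \<open>\<kappa>\<close> into 21 and 70 on the range \<open>\<kappa> \<le> 2\<close>.\<close>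

lemma SRate_lamplighter_power:
  fixes \<kappa> :: real
  assumes \<kappa>: "0 < \<kappa>"
  defines "C \<equiv> 80 * 404 ^ 3 * 2 ^ 15 :: real" and "c \<equiv> 1 / (1000 * 404 ^ 7 * 2 ^ 56) :: real"
  shows "ennreal (c * \<kappa> ^ 70) \<le> SRate lamplighter std_gens (nat \<lceil>C * \<kappa> powi (- 21)\<rceil>) \<kappa>"
proof -
  have c0: "0 < c" and C0: "0 < C" by (simp_all add: c_def C_def)
  have powi: "\<kappa> powi (- 21) = 1 / \<kappa> ^ 21" by (simp add: power_int_def inverse_eq_divide power_one_over)
  show ?thesis
  proof (cases "2 < \<kappa>")
    case True
    have "0 < C * \<kappa> powi (- 21)" using C0 \<kappa> unfolding powi by simp
    then have "0 < nat \<lceil>C * \<kappa> powi (- 21)\<rceil>" by simp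
    then show ?thesis using True c0 \<kappa> by (intro SRate_lamplighter_trivial) simp_all
  next
    case False
    then have \<kappa>2: "\<kappa> \<le> 2" by simp
    define n where "n = nat \<lceil>400 / \<kappa>\<^sup>2\<rceil>"
    have k2: "0 < \<kappa>\<^sup>2" "\<kappa>\<^sup>2 \<le> 4" using \<kappa> power_mono[of \<kappa> 2 2] \<kappa>2 by simp_all
    have n_ge: "400 / \<kappa>\<^sup>2 \<le> real n" unfolding n_def by (rule real_nat_ceiling_ge)
    have q0: "0 < 400 / \<kappa>\<^sup>2" using k2 by simp
    then have n0: "0 < n" using n_ge by (cases n) auto
    have n_le: "real n \<le> 404 / \<kappa>\<^sup>2"
    proof -
      have "real n \<le> 400 / \<kappa>\<^sup>2 + 1" unfolding n_def using q0 by linarith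
      also have "1 \<le> 4 / \<kappa>\<^sup>2" using k2 by (simp add: le_divide_eq)
      finally show ?thesis by (simp add: add_divide_distrib[symmetric])
    qed
    have rate: "18 / sqrt n < \<kappa>"
    proof -
      have "sqrt (400 / \<kappa>\<^sup>2) \<le> sqrt n" using n_ge by (rule real_sqrt_le_mono)
      moreover have "sqrt (400 / \<kappa>\<^sup>2) = 20 / \<kappa>"
        using \<kappa> by (simp add: real_sqrt_divide real_sqrt_unique[of 20 400])
      ultimately have "20 / \<kappa> \<le> sqrt n" by simp
      then have "20 \<le> sqrt n * \<kappa>" using \<kappa> by (simp add: pos_divide_le_eq)
      then have "18 < \<kappa> * sqrt n" by (simp add: mult.commute)
      then show ?thesis using n0 by (simp add: pos_divide_less_eq)
    qed
    have r: "80 * n ^ 3 \<le> nat \<lceil>C * \<kappa> powi (- 21)\<rceil>"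
    proof -
      have "real n ^ 3 \<le> (404 / \<kappa>\<^sup>2) ^ 3" using n_le by (intro power_mono) simp_all
      also have "\<dots> = 404 ^ 3 / \<kappa> ^ 6" by (simp add: power_divide flip: power_mult)
      also have "\<dots> \<le> 404 ^ 3 * (2 ^ 15 / \<kappa> ^ 21)"
      proof -
        have "\<kappa> ^ 21 = \<kappa> ^ 15 * \<kappa> ^ 6" by (simp flip: power_add)
        moreover have "\<kappa> ^ 15 \<le> 2 ^ 15" using \<kappa> \<kappa>2 by (intro power_mono) auto
        ultimately have "\<kappa> ^ 21 \<le> 2 ^ 15 * \<kappa> ^ 6" using \<kappa> by (simp only:) (intro mult_right_mono, simp_all)
        then have "1 / \<kappa> ^ 6 \<le> 2 ^ 15 / \<kappa> ^ 21"
          using \<kappa> by (simp add: divide_simps)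
        then show ?thesis using mult_left_mono[of "1 / \<kappa> ^ 6" "2 ^ 15 / \<kappa> ^ 21" "404 ^ 3"] by simp
      qed
      finally have "real (80 * n ^ 3) \<le> C * \<kappa> powi (- 21)" unfolding powi C_def by simp
      also have "\<dots> \<le> real (nat \<lceil>C * \<kappa> powi (- 21)\<rceil>)" by (rule real_nat_ceiling_ge)
      finally show ?thesis by (simp only: of_nat_le_iff)
    qed
    have "c * \<kappa> ^ 70 \<le> 1 / (1000 * real n ^ 7)"
    proof -
      have "real n ^ 7 \<le> (404 / \<kappa>\<^sup>2) ^ 7" using n_le by (intro power_mono) simp_all
      also have "\<dots> = 404 ^ 7 / \<kappa> ^ 14" by (simp add: power_divide flip: power_mult)
      finally have "real n ^ 7 * \<kappa> ^ 14 \<le> 404 ^ 7" using \<kappa> by (simp add: pos_le_divide_eq)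
      then have 1: "real n ^ 7 * \<kappa> ^ 14 * \<kappa> ^ 56 \<le> 404 ^ 7 * 2 ^ 56"
        using \<kappa> \<kappa>2 by (intro mult_mono power_mono) auto
      have P: "\<kappa> ^ 70 = \<kappa> ^ 14 * \<kappa> ^ 56" by (simp flip: power_add)
      have "\<kappa> ^ 70 * (1000 * real n ^ 7) = 1000 * (real n ^ 7 * \<kappa> ^ 14 * \<kappa> ^ 56)"
        unfolding P by (simp only: mult_ac)
      also have "\<dots> \<le> 1000 * (404 ^ 7 * 2 ^ 56)" using 1 by (intro mult_left_mono) simp_all
      finally have "\<kappa> ^ 70 * (1000 * real n ^ 7) \<le> 1000 * 404 ^ 7 * 2 ^ 56" by simp
      then have "c * \<kappa> ^ 70 * (1000 * real n ^ 7) \<le> 1" by (simp add: c_def)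
      then show ?thesis using n0 by (simp add: pos_le_divide_eq)
    qed
    then have "ennreal (c * \<kappa> ^ 70) \<le> ennreal (1 / (1000 * real n ^ 7))" by (rule ennreal_leI)
    also have "\<dots> \<le> SRate lamplighter std_gens (nat \<lceil>C * \<kappa> powi (- 21)\<rceil>) \<kappa>"
      by (rule SRate_lamplighter_std[OF n0 r rate])
    finally show ?thesis .
  qed
qed

theorem theorem1p2:
  shows "(\<forall>S'. finite_generating_set lamplighter S' \<longrightarrow>
            (\<exists>C'::real. C' \<ge> 1 \<and>
              (\<forall>x::real. x \<ge> 1 \<longrightarrow>
                 ereal_of_enat (SRad lamplighter S' x) \<le> ereal (C' * (C' * x) ^ 21))))
       \<and> (\<exists>(C::real) (c::real). C > 0 \<and> c > 0 \<and>
            (\<forall>\<kappa>::real. \<kappa> > 0 \<longrightarrow>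
               SRate lamplighter {lamp_a, lamp_t} (nat \<lceil>C * \<kappa> powi (- 21)\<rceil>) \<kappa>
                 \<ge> ennreal (c * \<kappa> ^ 70)))"
proof (intro conjI allI impI)
  show "\<exists>C'::real. C' \<ge> 1 \<and> (\<forall>x::real. x \<ge> 1 \<longrightarrow>
      ereal_of_enat (SRad lamplighter S' x) \<le> ereal (C' * (C' * x) ^ 21))"
    if "finite_generating_set lamplighter S'" for S'
    by (rule SRad_lamplighter[OF that])
  show "\<exists>(C::real) (c::real). C > 0 \<and> c > 0 \<and> (\<forall>\<kappa>::real. \<kappa> > 0 \<longrightarrow>
      SRate lamplighter {lamp_a, lamp_t} (nat \<lceil>C * \<kappa> powi (- 21)\<rceil>) \<kappa> \<ge> ennreal (c * \<kappa> ^ 70))"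
    by (rule exI[of _ "80 * 404 ^ 3 * 2 ^ 15"], rule exI[of _ "1 / (1000 * 404 ^ 7 * 2 ^ 56)"])
      (intro conjI allI impI SRate_lamplighter_power, simp_all)
qed

end
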